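(* Let $P$ be a probability distribution on $\mathcal{X}=\mathbb{F}_d^2$ and let $\mathcal{A}\sim\{\sqrt{P(u)}\,N_u\}_{u\in\mathcal{X}}$ be the corresponding Pauli channel. Then $$\mathsf{C}(\mathcal{A})\ \ge\ \sup_{n\ge 1}\ \max_{\mathcal{C}\in\mathsf{S}_n(\mathcal{N})}\ \frac{I_{\rm c}\big((\dim\mathcal{C})^{-1}\Pi_{\mathcal{C}},\ \mathcal{A}^{\otimes n}\big)}{n},$$ where $\Pi_{\mathcal{C}}$ is the orthogonal projection onto $\mathcal{C}$.
   Context: Let $d$ be a prime, $\mathbb{F}=\mathbb{F}_d=\mathbb{Z}/d\mathbb{Z}$, and $\mathcal{H}$ a Hilbert space of dimension $d$ with a fixed orthonormal basis $\{|0\rangle,\dots,|d-1\rangle\}$. Let $\omega$ be a primitive $d$-th root of unity and define unitaries $X|j\rangle=|(j-1)\bmod d\rangle$, $Z|j\rangle=\omega^j|j\rangle$. Put $\mathcal{X}=\mathbb{F}^2$, $N_{(i,j)}=X^iZ^j$ for $(i,j)\in\mathcal{X}$, and $\mathcal{N}=\{N_u\}_{u\in\mathcal{X}}$. For $x=((u_1,v_1),\dots,(u_n,v_n))\in\mathcal{X}^n$, identified with $(u_1,v_1,\dots,u_n,v_n)\in\mathbb{F}^{2n}$, put $N_x=N_{(u_1,v_1)}\otimes\cdots\otimes N_{(u_n,v_n)}$. The symplectic form on $\mathbb{F}^{2n}$ is $\langle x,y\rangle=\sum_{i=1}^n(u_iv_i'-v_iu_i')$ for $y=(u_1',v_1',\dots,u_n',v_n')$;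 for a subspace $L$, $L^\perp=\{y:\langle x,y\rangle=0\ \forall x\in L\}$, and $L$ is self-orthogonal if $L\subset L^\perp$. For a self-orthogonal $L\subset\mathbb{F}^{2n}$ with $\dim L=n-k$ ($0\le k\le n$), a symplectic stabilizer code with stabilizer $N_L=\{N_x:x\in L\}$ is a $d^k$-dimensional subspace of $\mathcal{H}^{\otimes n}$ of the form $\{\psi:\ N_x\psi=\tau(x)\psi\ \forall x\in L\}$ for some scalars $\tau(x)$. $\mathsf{S}_n(\mathcal{N})$ is the set of all such codes (over all such $L$ and $k$). For a probability distribution $P$ on $\mathcal{X}$, the channel $\mathcal{A}\sim\{\sqrt{P(u)}N_u\}$ is the map $\rho\mapsto\sum_uP(u)N_u\rho N_u^\dagger$ on operators on $\mathcal{H}$; $\mathcal{A}^{\otimes n}(\rho)=\sum_{x\in\mathcal{X}^n}P^n(x)N_x\rho N_x^\dagger$ with $P^n(x)=\prod_iP(x_i)$. A code is a pair $(\mathcal{C},\mathcal{R})$ with $\mathcal{C}\subset\mathcal{H}^{\otimes n}$ a subspace and $\mathcal{R}$ a trace-preserving completely positive map on operators on $\mathcal{H}^{\otimes n}$; its minimum fidelity is $F(\mathcal{C},\mathcal{R}\mathcal{A}^{\otimes n})=\min_{\text{unit }\psi\in\mathcal{C}}\langle\psi|\mathcal{R}(\mathcal{A}^{\otimes n}(|\psi\rangle\langle\psi|))|\psi\rangle$. For an integer $n\ge1$ and real $0\le k\le n$, $F^\star_{n,k}(\mathcal{A}^{\otimes n})$ is the supremum of this fidelity over codes with $\log_d\dim\mathcal{C}\ge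 k$. The quantum capacity $\mathsf{C}(\mathcal{A})$ is the supremum of $R\ge0$ with $\limsup_{n\to\infty}F^\star_{n,Rn}(\mathcal{A}^{\otimes n})=1$. The coherent information is $I_{\rm c}(\rho,\mathcal{A}')=S(\mathcal{A}'(\rho))-S(({\rm I}\otimes\mathcal{A}')(|\Psi\rangle\langle\Psi|))$, where $S$ is von Neumann entropy with logarithm to base $d$, ${\rm I}$ is the identity map, and $|\Psi\rangle$ is a purification of $\rho$. *)

theory Defs
  imports Complex_Main
    "Jordan_Normal_Form.Spectral_Radius"
    "Jordan_Normal_Form.Schur_Decomposition"
    "HOL-Library.Extended_Real"
    "HOL-Library.Liminf_Limsup"
begin

definition Xmat :: "nat \<Rightarrow> complex mat" where
  "Xmat d = mat d d (\<lambda>(a,b). if a = (b + d - 1) mod d then 1 else 0)"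

definition Zmat :: "nat \<Rightarrow> complex \<Rightarrow> complex mat" where
  "Zmat d \<omega> = mat d d (\<lambda>(a,b). if a = b then \<omega> ^ a else 0)"

definition pauli1 :: "nat \<Rightarrow> complex \<Rightarrow> nat \<times> nat \<Rightarrow> complex mat" where
  "pauli1 d \<omega> uv = (Xmat d ^\<^sub>m fst uv) * (Zmat d \<omega> ^\<^sub>m snd uv)"

text \<open>Kronecker (tensor) product; basis index (i,j) of the product is i * dim B + j.\<close>
definition kron :: "complex mat \<Rightarrow> complex mat \<Rightarrow> complex mat" where
  "kron A B = mat (dim_row A * dim_row B) (dim_col A * dim_col B)
     (\<lambda>(i,j). A $$ (i div dim_row B, j div dim_col B) * B $$ (i mod dim_row B, j mod dim_col B))"

definition pauli :: "nat \<Rightarrow> complex \<Rightarrow> (nat \<times> nat) list \<Rightarrow> complex mat" where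
  "pauli d \<omega> xs = foldr (\<lambda>u M. kron (pauli1 d \<omega> u) M) xs (1\<^sub>m 1)"

definition pts :: "nat \<Rightarrow> (nat \<times> nat) set" where
  "pts d = {uv. fst uv < d \<and> snd uv < d}"

definition strings :: "nat \<Rightarrow> nat \<Rightarrow> (nat \<times> nat) list set" where
  "strings d n = {xs. length xs = n \<and> set xs \<subseteq> pts d}"

definition prob_dist :: "nat \<Rightarrow> (nat \<times> nat \<Rightarrow> real) \<Rightarrow> bool" where
  "prob_dist d P \<longleftrightarrow> (\<forall>u\<in>pts d. P u \<ge> 0) \<and> (\<Sum>u\<in>pts d. P u) = 1"

definition Pn :: "(nat \<times> nat \<Rightarrow> real) \<Rightarrow> (nat \<times> nat) list \<Rightarrow> real" where
  "Pn P xs = prod_list (map P xs)"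

definition cinner :: "complex vec \<Rightarrow> complex vec \<Rightarrow> complex" where
  "cinner v w = (\<Sum>i<dim_vec v. cnj (v $ i) * w $ i)"

definition outer :: "complex vec \<Rightarrow> complex mat" where
  "outer v = mat (dim_vec v) (dim_vec v) (\<lambda>(i,j). v $ i * cnj (v $ j))"

definition csubspace :: "nat \<Rightarrow> complex vec set \<Rightarrow> bool" where
  "csubspace N C \<longleftrightarrow> C \<subseteq> carrier_vec N \<and> 0\<^sub>v N \<in> C \<and>
     (\<forall>v\<in>C. \<forall>w\<in>C. v + w \<in> C) \<and> (\<forall>c. \<forall>v\<in>C. c \<cdot>\<^sub>v v \<in> C)"

definition clincomb :: "nat \<Rightarrow> complex list \<Rightarrow> complex vec list \<Rightarrow> complex vec" where
  "clincomb N cs vs = vec N (\<lambda>i. \<Sum>j<length vs. cs ! j * vs ! j $ i)"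

definition cspan :: "nat \<Rightarrow> complex vec list \<Rightarrow> complex vec set" where
  "cspan N vs = {clincomb N cs vs | cs. length cs = length vs}"

definition cdim :: "nat \<Rightarrow> complex vec set \<Rightarrow> nat" where
  "cdim N C = (LEAST m. \<exists>vs. length vs = m \<and> set vs \<subseteq> C \<and> cspan N vs = C)"

definition proj :: "nat \<Rightarrow> complex vec set \<Rightarrow> complex mat" where
  "proj N C = (THE Q. Q \<in> carrier_mat N N \<and>
     (\<forall>v\<in>carrier_vec N. Q *\<^sub>v v \<in> C \<and> (\<forall>w\<in>C. cinner w (v - Q *\<^sub>v v) = 0)))"

definition msum :: "nat \<Rightarrow> 'i set \<Rightarrow> ('i \<Rightarrow> complex mat) \<Rightarrow> complex mat" where
  "msum N S f = mat N N (\<lambda>(i,j). \<Sum>x\<in>S. f x $$ (i,j))"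

definition chan :: "nat \<Rightarrow> complex \<Rightarrow> (nat \<times> nat \<Rightarrow> real) \<Rightarrow> nat \<Rightarrow> complex mat \<Rightarrow> complex mat" where
  "chan d \<omega> P n \<rho> = msum (d ^ n) (strings d n)
     (\<lambda>xs. complex_of_real (Pn P xs) \<cdot>\<^sub>m (pauli d \<omega> xs * \<rho> * mat_adjoint (pauli d \<omega> xs)))"

definition chanI :: "nat \<Rightarrow> complex \<Rightarrow> (nat \<times> nat \<Rightarrow> real) \<Rightarrow> nat \<Rightarrow> nat \<Rightarrow> complex mat \<Rightarrow> complex mat" where
  "chanI d \<omega> P n Dr M = msum (Dr * d ^ n) (strings d n)
     (\<lambda>xs. complex_of_real (Pn P xs) \<cdot>\<^sub>m (kron (1\<^sub>m Dr) (pauli d \<omega> xs) * M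
            * mat_adjoint (kron (1\<^sub>m Dr) (pauli d \<omega> xs))))"

definition ptrace1 :: "nat \<Rightarrow> nat \<Rightarrow> complex mat \<Rightarrow> complex mat" where
  "ptrace1 Dr D M = mat D D (\<lambda>(a,b). \<Sum>r<Dr. M $$ (r * D + a, r * D + b))"

definition purification :: "nat \<Rightarrow> complex mat \<Rightarrow> complex vec \<Rightarrow> bool" where
  "purification D \<rho> \<Psi> \<longleftrightarrow> \<Psi> \<in> carrier_vec (D * D) \<and> ptrace1 D D (outer \<Psi>) = \<rho>"

definition eta :: "nat \<Rightarrow> real \<Rightarrow> real" where
  "eta d t = (if t \<le> 0 then 0 else - t * log (real d) t)"

definition vnS :: "nat \<Rightarrow> complex mat \<Rightarrow> real" where
  "vnS d \<rho> = (\<Sum>e\<in>spectrum \<rho>. real (order e (char_poly \<rho>)) * eta d (Re e))"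

definition coh_info :: "nat \<Rightarrow> complex \<Rightarrow> (nat \<times> nat \<Rightarrow> real) \<Rightarrow> nat \<Rightarrow> complex mat \<Rightarrow> real" where
  "coh_info d \<omega> P n \<rho> =
     vnS d (chan d \<omega> P n \<rho>)
     - vnS d (chanI d \<omega> P n (d ^ n) (outer (SOME \<Psi>. purification (d ^ n) \<rho> \<Psi>)))"

definition kraus_tp :: "nat \<Rightarrow> complex mat list \<Rightarrow> bool" where
  "kraus_tp N Ks \<longleftrightarrow> set Ks \<subseteq> carrier_mat N N \<and>
     msum N {..<length Ks} (\<lambda>i. mat_adjoint (Ks ! i) * Ks ! i) = 1\<^sub>m N"

definition kraus_apply :: "nat \<Rightarrow> complex mat list \<Rightarrow> complex mat \<Rightarrow> complex mat" where
  "kraus_apply N Ks M = msum N {..<length Ks} (\<lambda>i. Ks ! i * M * mat_adjoint (Ks ! i))"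

definition fidelity :: "nat \<Rightarrow> complex \<Rightarrow> (nat \<times> nat \<Rightarrow> real) \<Rightarrow> nat \<Rightarrow> complex vec set \<Rightarrow> complex mat list \<Rightarrow> ereal" where
  "fidelity d \<omega> P n C Rs = (INF \<psi>\<in>{\<psi>\<in>C. cinner \<psi> \<psi> = 1}.
     ereal (Re (cinner \<psi> (kraus_apply (d ^ n) Rs (chan d \<omega> P n (outer \<psi>)) *\<^sub>v \<psi>))))"

definition Fstar :: "nat \<Rightarrow> complex \<Rightarrow> (nat \<times> nat \<Rightarrow> real) \<Rightarrow> nat \<Rightarrow> real \<Rightarrow> ereal" where
  "Fstar d \<omega> P n k = (SUP CR\<in>{(C, Rs). csubspace (d ^ n) C \<and> kraus_tp (d ^ n) Rs
        \<and> real (cdim (d ^ n) C) \<ge> real d powr k}.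
     fidelity d \<omega> P n (fst CR) (snd CR))"

definition capacity :: "nat \<Rightarrow> complex \<Rightarrow> (nat \<times> nat \<Rightarrow> real) \<Rightarrow> ereal" where
  "capacity d \<omega> P = Sup {ereal R | R. R \<ge> 0 \<and>
     limsup (\<lambda>m. Fstar d \<omega> P (Suc m) (R * real (Suc m))) = 1}"

definition fzero :: "nat \<Rightarrow> (nat \<times> nat) list" where
  "fzero n = replicate n (0, 0)"

definition fadd :: "nat \<Rightarrow> (nat \<times> nat) list \<Rightarrow> (nat \<times> nat) list \<Rightarrow> (nat \<times> nat) list" where
  "fadd d xs ys = map2 (\<lambda>a b. ((fst a + fst b) mod d, (snd a + snd b) mod d)) xs ys"

definition fscale :: "nat \<Rightarrow> nat \<Rightarrow> (nat \<times> nat) list \<Rightarrow> (nat \<times> nat) list" where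
  "fscale d c xs = map (\<lambda>a. ((c * fst a) mod d, (c * snd a) mod d)) xs"

definition fsubspace :: "nat \<Rightarrow> nat \<Rightarrow> (nat \<times> nat) list set \<Rightarrow> bool" where
  "fsubspace d n L \<longleftrightarrow> L \<subseteq> strings d n \<and> fzero n \<in> L \<and>
     (\<forall>x\<in>L. \<forall>y\<in>L. fadd d x y \<in> L) \<and> (\<forall>c<d. \<forall>x\<in>L. fscale d c x \<in> L)"

definition flincomb :: "nat \<Rightarrow> nat \<Rightarrow> nat list \<Rightarrow> (nat \<times> nat) list list \<Rightarrow> (nat \<times> nat) list" where
  "flincomb d n cs bs = foldr (\<lambda>(c, b) acc. fadd d (fscale d c b) acc) (zip cs bs) (fzero n)"

definition fspan :: "nat \<Rightarrow> nat \<Rightarrow> (nat \<times> nat) list list \<Rightarrow> (nat \<times> nat) list set" where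
  "fspan d n bs = {flincomb d n cs bs | cs. length cs = length bs \<and> set cs \<subseteq> {..<d}}"

definition fdim :: "nat \<Rightarrow> nat \<Rightarrow> (nat \<times> nat) list set \<Rightarrow> nat" where
  "fdim d n L = (LEAST m. \<exists>bs. length bs = m \<and> set bs \<subseteq> L \<and> fspan d n bs = L)"

definition sympl :: "nat \<Rightarrow> (nat \<times> nat) list \<Rightarrow> (nat \<times> nat) list \<Rightarrow> int" where
  "sympl d xs ys = (\<Sum>i<length xs. int (fst (xs ! i)) * int (snd (ys ! i))
                                   - int (snd (xs ! i)) * int (fst (ys ! i))) mod int d"

definition self_orth :: "nat \<Rightarrow> (nat \<times> nat) list set \<Rightarrow> bool" where
  "self_orth d L \<longleftrightarrow> (\<forall>x\<in>L. \<forall>y\<in>L. sympl d x y = 0)"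

definition stab_codes :: "nat \<Rightarrow> complex \<Rightarrow> nat \<Rightarrow> complex vec set set" where
  "stab_codes d \<omega> n = {C. \<exists>L k \<tau>. fsubspace d n L \<and> self_orth d L \<and> k \<le> n \<and> fdim d n L = n - k \<and>
      C = {\<psi>\<in>carrier_vec (d ^ n). \<forall>x\<in>L. pauli d \<omega> x *\<^sub>v \<psi> = \<tau> x \<cdot>\<^sub>v \<psi>} \<and>
      cdim (d ^ n) C = d ^ k}"

end

theory Submission
  imports Defs "HOL-Analysis.Convex"
begin

text \<open>
  For an isotropic L with code projection Pi, the channel output on the normalised projection is a
  mixture of orthogonal translates of Pi indexed by the cosets of the orthogonal complement of L, and
  the output on a purification is a mixture of orthonormal vectors indexed by the cosets of L.  Hence the
  coherent information equals k - H, where H is the conditional entropy of the error modulo L given its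
  syndrome.  To achieve the rate (k - H)/n, take the m-fold power of L and enlarge it inside its
  complement.  Adjoining a random vector v of the complement of an isotropic M keeps any fixed element of
  the complement outside M undetected with probability at most 1/d, so some choice of v shrinks the
  expected number of undetected competitors of the true error by a factor d.  After j > m H steps, decoding
  to the most likely coset of L succeeds with probability tending to 1, by Chebyshev's inequality for the
  information density, and the code has dimension at least d^(m k - j).
\<close>

section \<open>Matrices and inner products\<close>

text \<open>The argument runs over an abstract finite group of exponent d with unitary
  representatives and bimultiplicative phases, because the same facts are needed for the given block
  length n and for the lengths n * m. Dimensions over the field are replaced by cardinalities of
  subgroups. The entropy is defined through the characteristic polynomial; it is recovered from
  traces of powers, so that no eigenbasis has to be exhibited. The purification inside
  \<open>coh_info\<close> is an arbitrary choice, so its entropy is computed from the partial trace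
  alone. The capacity asks for a limit superior equal to 1: this needs the bound 1 on every
  fidelity, hence unit vectors in every admissible code, while the lower bound is needed only along
  a subsequence of lengths. The coherent information may be negative whereas rates may not; then the
  rate 0 has to be supplied, by codes of positive dimension that are decoded without error.
  Adjoining one vector at a time keeps the averaging elementary: it only needs the size of the
  kernel of a character, not a count of isotropic subgroups.\<close>

lemma mat_adjoint_dim [simp]:
  "dim_row (mat_adjoint A) = dim_col A" "dim_col (mat_adjoint A) = dim_row A"
  by (simp_all add: mat_adjoint_def)

lemma mat_adjoint_carrier [simp]:
  "A \<in> carrier_mat m n \<Longrightarrow> mat_adjoint A \<in> carrier_mat n m"
  by (rule carrier_matI) auto

lemma mat_adjoint_index [simp]:
  fixes A :: "complex mat"
  assumes "i < dim_col A" "j < dim_row A"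
  shows "mat_adjoint A $$ (i, j) = cnj (A $$ (j, i))"
  using assms by (simp add: mat_adjoint_def mat_of_rows_def)

lemma mult_index_sum:
  fixes A :: "complex mat"
  assumes "A \<in> carrier_mat a b" "B \<in> carrier_mat b c" "i < a" "j < c"
  shows "(A * B) $$ (i, j) = (\<Sum>k<b. A $$ (i, k) * B $$ (k, j))"
  using assms by (auto simp: scalar_prod_def atLeast0LessThan intro!: sum.cong)

lemma mult_vec_index_sum:
  fixes A :: "complex mat"
  assumes "A \<in> carrier_mat a b" "v \<in> carrier_vec b" "i < a"
  shows "(A *\<^sub>v v) $ i = (\<Sum>k<b. A $$ (i, k) * v $ k)"
  using assms by (auto simp: scalar_prod_def atLeast0LessThan intro!: sum.cong)

lemma mat_adjoint_mult:
  fixes A :: "complex mat"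
  assumes "A \<in> carrier_mat a b" "B \<in> carrier_mat b c"
  shows "mat_adjoint (A * B) = mat_adjoint B * mat_adjoint A"
proof (rule eq_matI)
  fix i j assume "i < dim_row (mat_adjoint B * mat_adjoint A)" "j < dim_col (mat_adjoint B * mat_adjoint A)"
  then have ij: "i < c" "j < a" using assms by auto
  have "(mat_adjoint B * mat_adjoint A) $$ (i, j) = (\<Sum>k<b. cnj (B $$ (k, i)) * cnj (A $$ (j, k)))"
    using assms ij by (subst mult_index_sum[where a = c and b = b and c = a]) auto
  then show "mat_adjoint (A * B) $$ (i, j) = (mat_adjoint B * mat_adjoint A) $$ (i, j)"
    using assms ij mult_index_sum[OF assms ij(2,1)]
    by (auto simp: mult.commute)
qed (use assms in auto)

lemma mat_adjoint_adjoint [simp]: "mat_adjoint (mat_adjoint A) = (A :: complex mat)"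
  by (rule eq_matI) auto

lemma mat_adjoint_smult: "mat_adjoint (c \<cdot>\<^sub>m A) = cnj c \<cdot>\<^sub>m mat_adjoint (A :: complex mat)"
  by (rule eq_matI) auto

lemma mat_adjoint_one [simp]: "mat_adjoint (1\<^sub>m n) = (1\<^sub>m n :: complex mat)"
  by (rule eq_matI) auto

section \<open>Finite sums of square matrices\<close>

lemma msum_carrier [simp]: "msum N S f \<in> carrier_mat N N"
  by (simp add: msum_def)

lemma msum_dim [simp]: "dim_row (msum N S f) = N" "dim_col (msum N S f) = N"
  by (simp_all add: msum_def)

lemma msum_index [simp]: "i < N \<Longrightarrow> j < N \<Longrightarrow> msum N S f $$ (i, j) = (\<Sum>x\<in>S. f x $$ (i, j))"
  by (simp add: msum_def)

lemma msum_cong: "S = T \<Longrightarrow> (\<And>x. x \<in> T \<Longrightarrow> f x = g x) \<Longrightarrow> msum N S f = msum N T g"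
  by (simp add: msum_def)

lemma mult_msum:
  assumes "A \<in> carrier_mat N N" "\<And>x. x \<in> S \<Longrightarrow> f x \<in> carrier_mat N N"
  shows "A * msum N S f = msum N S (\<lambda>x. A * f x)"
proof (rule eq_matI)
  fix i j assume "i < dim_row (msum N S (\<lambda>x. A * f x))" "j < dim_col (msum N S (\<lambda>x. A * f x))"
  then have ij: "i < N" "j < N" by auto
  have "(A * msum N S f) $$ (i, j) = (\<Sum>k<N. \<Sum>x\<in>S. A $$ (i, k) * f x $$ (k, j))"
    using ij by (subst mult_index_sum[OF assms(1) msum_carrier]) (auto simp: sum_distrib_left)
  also have "\<dots> = (\<Sum>x\<in>S. (A * f x) $$ (i, j))"
    by (subst sum.swap) (use assms ij in \<open>auto simp: mult_index_sum[of A N N _ N] intro!: sum.cong\<close>)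
  finally show "(A * msum N S f) $$ (i, j) = msum N S (\<lambda>x. A * f x) $$ (i, j)" using ij by simp
qed (use assms in auto)

lemma msum_mult:
  assumes "A \<in> carrier_mat N N" "\<And>x. x \<in> S \<Longrightarrow> f x \<in> carrier_mat N N"
  shows "msum N S f * A = msum N S (\<lambda>x. f x * A)"
proof (rule eq_matI)
  fix i j assume "i < dim_row (msum N S (\<lambda>x. f x * A))" "j < dim_col (msum N S (\<lambda>x. f x * A))"
  then have ij: "i < N" "j < N" by auto
  have "(msum N S f * A) $$ (i, j) = (\<Sum>k<N. \<Sum>x\<in>S. f x $$ (i, k) * A $$ (k, j))"
    using ij by (subst mult_index_sum[OF msum_carrier assms(1)]) (auto simp: sum_distrib_right)
  also have "\<dots> = (\<Sum>x\<in>S. (f x * A) $$ (i, j))"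
    by (subst sum.swap) (use assms ij in \<open>auto simp: mult_index_sum[of _ N N A N] intro!: sum.cong\<close>)
  finally show "(msum N S f * A) $$ (i, j) = msum N S (\<lambda>x. f x * A) $$ (i, j)" using ij by simp
qed (use assms in auto)

lemma smult_msum:
  assumes "\<And>x. x \<in> S \<Longrightarrow> f x \<in> carrier_mat N N"
  shows "c \<cdot>\<^sub>m msum N S f = msum N S (\<lambda>x. c \<cdot>\<^sub>m f x)"
proof (rule eq_matI)
  fix i j assume "i < dim_row (msum N S (\<lambda>x. c \<cdot>\<^sub>m f x))" "j < dim_col (msum N S (\<lambda>x. c \<cdot>\<^sub>m f x))"
  then have ij: "i < N" "j < N" by auto
  have "(c \<cdot>\<^sub>m f x) $$ (i, j) = c * f x $$ (i, j)" if "x \<in> S" for x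
    using assms[OF that] ij by auto
  then show "(c \<cdot>\<^sub>m msum N S f) $$ (i, j) = msum N S (\<lambda>x. c \<cdot>\<^sub>m f x) $$ (i, j)"
    using ij by (simp add: sum_distrib_left)
qed auto

lemma msum_smult_const:
  assumes "A \<in> carrier_mat N N"
  shows "msum N S (\<lambda>x. c x \<cdot>\<^sub>m A) = (\<Sum>x\<in>S. c x) \<cdot>\<^sub>m A"
  by (rule eq_matI) (use assms in \<open>auto simp: sum_distrib_right\<close>)

lemma msum_swap: "msum N S (\<lambda>x. msum N T (f x)) = msum N T (\<lambda>y. msum N S (\<lambda>x. f x y))"
  by (rule eq_matI) (auto intro: sum.swap)

lemma msum_reindex_bij: "bij_betw h S T \<Longrightarrow> msum N S (\<lambda>x. f (h x)) = msum N T f"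
  by (rule eq_matI) (auto intro: sum.reindex_bij_betw)

lemma msum_delta:
  assumes "finite S" "a \<in> S" "f a \<in> carrier_mat N N" "\<And>x. x \<in> S \<Longrightarrow> x \<noteq> a \<Longrightarrow> f x = 0\<^sub>m N N"
  shows "msum N S f = f a"
proof (rule eq_matI)
  fix i j assume "i < dim_row (f a)" "j < dim_col (f a)"
  then have ij: "i < N" "j < N" using assms(3) by auto
  have "(\<Sum>x\<in>S. f x $$ (i, j)) = (\<Sum>x\<in>S. if x = a then f a $$ (i, j) else 0)"
    by (intro sum.cong) (use assms(4) ij in auto)
  then show "msum N S f $$ (i, j) = f a $$ (i, j)" using ij assms(1,2) by simp
qed (use assms(3) in auto)

lemma mat_adjoint_msum:
  assumes "\<And>x. x \<in> S \<Longrightarrow> f x \<in> carrier_mat N N"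
  shows "mat_adjoint (msum N S f) = msum N S (\<lambda>x. mat_adjoint (f x))"
proof (rule eq_matI)
  fix i j assume "i < dim_row (msum N S (\<lambda>x. mat_adjoint (f x)))" "j < dim_col (msum N S (\<lambda>x. mat_adjoint (f x)))"
  then have ij: "i < N" "j < N" by auto
  then show "mat_adjoint (msum N S f) $$ (i, j) = msum N S (\<lambda>x. mat_adjoint (f x)) $$ (i, j)"
    using assms by (auto intro!: sum.cong) (metis carrier_matD mat_adjoint_index)
qed auto

section \<open>Traces\<close>

definition mtrace :: "complex mat \<Rightarrow> complex" where
  "mtrace A = (\<Sum>i<dim_row A. A $$ (i, i))"

lemma mtrace_smult [simp]: "A \<in> carrier_mat N N \<Longrightarrow> mtrace (c \<cdot>\<^sub>m A) = c * mtrace A"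
  by (auto simp: mtrace_def sum_distrib_left)

lemma mtrace_one [simp]: "mtrace (1\<^sub>m N) = of_nat N"
  by (simp add: mtrace_def)

lemma mtrace_zero [simp]: "mtrace (0\<^sub>m N N) = 0"
  by (simp add: mtrace_def)

lemma mtrace_msum:
  assumes "\<And>x. x \<in> S \<Longrightarrow> f x \<in> carrier_mat N N"
  shows "mtrace (msum N S f) = (\<Sum>x\<in>S. mtrace (f x))"
proof -
  have "mtrace (msum N S f) = (\<Sum>x\<in>S. \<Sum>i<N. f x $$ (i, i))"
    by (subst sum.swap) (simp add: mtrace_def)
  also have "\<dots> = (\<Sum>x\<in>S. mtrace (f x))"
    using assms by (auto simp: mtrace_def intro!: sum.cong)
  finally show ?thesis .
qed

lemma mtrace_mult_commute:
  assumes "A \<in> carrier_mat m n" "B \<in> carrier_mat n m"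
  shows "mtrace (A * B) = mtrace (B * A)"
proof -
  have "mtrace (A * B) = (\<Sum>i<m. \<Sum>k<n. A $$ (i, k) * B $$ (k, i))"
    using assms by (auto simp: mtrace_def mult_index_sum[OF assms] simp del: index_mult_mat(1) intro!: sum.cong)
  also have "\<dots> = mtrace (B * A)"
    using assms by (subst sum.swap) (auto simp: mtrace_def mult_index_sum[OF assms(2,1)] mult.commute simp del: index_mult_mat(1) intro!: sum.cong)
  finally show ?thesis .
qed

section \<open>Inner products and rank-one operators\<close>

lemma cinner_adjoint:
  assumes "A \<in> carrier_mat m n" "v \<in> carrier_vec m" "w \<in> carrier_vec n"
  shows "cinner v (A *\<^sub>v w) = cinner (mat_adjoint A *\<^sub>v v) w"
proof -
  have "cinner v (A *\<^sub>v w) = (\<Sum>i<m. \<Sum>k<n. cnj (v $ i) * (A $$ (i, k) * w $ k))"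
    using assms by (auto simp: cinner_def mult_vec_index_sum[OF assms(1,3)] sum_distrib_left simp del: index_mult_mat_vec intro!: sum.cong)
  also have "\<dots> = (\<Sum>k<n. (\<Sum>i<m. cnj (v $ i) * A $$ (i, k)) * w $ k)"
    by (subst sum.swap) (auto simp: sum_distrib_right mult.assoc)
  also have "\<dots> = cinner (mat_adjoint A *\<^sub>v v) w"
    using assms by (auto simp: cinner_def mult_vec_index_sum[of "mat_adjoint A" n m v] mult.commute simp del: index_mult_mat_vec intro!: sum.cong)
  finally show ?thesis .
qed

lemma cinner_cnj: "dim_vec v = dim_vec w \<Longrightarrow> cnj (cinner v w) = cinner w v"
  by (auto simp: cinner_def mult.commute)

lemma cinner_smult_right: "dim_vec w = dim_vec v \<Longrightarrow> cinner v (c \<cdot>\<^sub>v w) = c * cinner v w"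
  by (auto simp: cinner_def sum_distrib_left mult.assoc mult.left_commute)

lemma cinner_smult_left: "cinner (c \<cdot>\<^sub>v v) w = cnj c * cinner v w"
  by (auto simp: cinner_def sum_distrib_left mult.assoc)

lemma cinner_add_right: "dim_vec w = dim_vec v \<Longrightarrow> dim_vec u = dim_vec v \<Longrightarrow> cinner v (w + u) = cinner v w + cinner v u"
  by (auto simp: cinner_def sum.distrib algebra_simps)

lemma cinner_minus_right: "dim_vec w = dim_vec v \<Longrightarrow> dim_vec u = dim_vec v \<Longrightarrow> cinner v (w - u) = cinner v w - cinner v u"
  by (auto simp: cinner_def sum_subtractf algebra_simps)

lemma cinner_minus_left: "dim_vec w = dim_vec v \<Longrightarrow> dim_vec u = dim_vec v \<Longrightarrow> cinner (w - u) v = cinner w v - cinner u v"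
  by (auto simp: cinner_def sum_subtractf algebra_simps)

lemma cinner_self: "cinner v v = of_real (\<Sum>i<dim_vec v. (cmod (v $ i))\<^sup>2)"
  unfolding cinner_def of_real_sum complex_norm_square by (simp only: mult.commute)

lemma cinner_self_zero_iff: "v \<in> carrier_vec n \<Longrightarrow> cinner v v = 0 \<longleftrightarrow> v = 0\<^sub>v n"
proof
  assume v: "v \<in> carrier_vec n" "cinner v v = 0"
  then have "(\<Sum>i<n. (cmod (v $ i))\<^sup>2) = 0" by (simp only: cinner_self of_real_eq_0_iff carrier_vecD)
  then have "\<forall>i<n. v $ i = 0" by (subst (asm) sum_nonneg_eq_0_iff) auto
  then show "v = 0\<^sub>v n" using v by auto
qed (simp add: cinner_def)

lemma cinner_Cauchy_Schwarz:
  assumes "dim_vec v = dim_vec w"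
  shows "(cmod (cinner v w))\<^sup>2 \<le> Re (cinner v v) * Re (cinner w w)"
proof -
  have "cmod (cinner v w) \<le> (\<Sum>i<dim_vec v. cmod (v $ i) * cmod (w $ i))"
    unfolding cinner_def by (rule order.trans[OF norm_sum]) (simp add: norm_mult)
  then have "(cmod (cinner v w))\<^sup>2 \<le> (\<Sum>i<dim_vec v. cmod (v $ i) * cmod (w $ i))\<^sup>2"
    by (intro power_mono) auto
  also have "\<dots> \<le> (\<Sum>i<dim_vec v. (cmod (v $ i))\<^sup>2) * (\<Sum>i<dim_vec v. (cmod (w $ i))\<^sup>2)"
    by (rule Cauchy_Schwarz_ineq_sum)
  finally show ?thesis using assms by (simp add: cinner_self)
qed

lemma outer_carrier [simp]: "v \<in> carrier_vec n \<Longrightarrow> outer v \<in> carrier_mat n n"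
  by (auto simp: outer_def)

lemma outer_dim [simp]: "dim_row (outer v) = dim_vec v" "dim_col (outer v) = dim_vec v"
  by (simp_all add: outer_def)

lemma outer_mult_vec:
  assumes "v \<in> carrier_vec n" "w \<in> carrier_vec n"
  shows "outer v *\<^sub>v w = cinner v w \<cdot>\<^sub>v v"
  using assms by (intro eq_vecI)
    (auto simp: mult_vec_index_sum[of _ n n] outer_def cinner_def sum_distrib_left sum_distrib_right ac_simps
      simp del: index_mult_mat_vec intro!: sum.cong)

lemma mtrace_outer: "mtrace (outer v) = cinner v v"
  by (simp add: mtrace_def outer_def cinner_def mult.commute)

lemma outer_smult: "cmod c = 1 \<Longrightarrow> outer (c \<cdot>\<^sub>v v) = outer v"
proof (rule eq_matI)
  fix i j assume c: "cmod c = 1" and "i < dim_row (outer v)" "j < dim_col (outer v)"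
  then have "outer (c \<cdot>\<^sub>v v) $$ (i, j) = (c * cnj c) * outer v $$ (i, j)"
    by (simp add: outer_def)
  then show "outer (c \<cdot>\<^sub>v v) $$ (i, j) = outer v $$ (i, j)"
    using c complex_norm_square[of c] by (metis mult_1 of_real_1 one_power2)
qed auto

lemma mat_eqI_mult_vec:
  fixes A :: "complex mat"
  assumes "A \<in> carrier_mat m n" "B \<in> carrier_mat m n" "\<And>v. v \<in> carrier_vec n \<Longrightarrow> A *\<^sub>v v = B *\<^sub>v v"
  shows "A = B"
proof (rule eq_matI)
  fix i j assume ij: "i < dim_row B" "j < dim_col B"
  have "A *\<^sub>v unit_vec n j = B *\<^sub>v unit_vec n j" by (rule assms) auto
  then have "(A *\<^sub>v unit_vec n j) $ i = (B *\<^sub>v unit_vec n j) $ i" by simp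
  then show "A $$ (i, j) = B $$ (i, j)" using ij assms(1,2) by simp
qed (use assms in auto)

text \<open>With this a Kraus term applied to a pure state is the rank-one operator of the image
  vector, so a unitary mixture of a pure state becomes a mixture of such operators.\<close>

lemma conj_outer:
  assumes "A \<in> carrier_mat m n" "v \<in> carrier_vec n"
  shows "A * outer v * mat_adjoint A = outer (A *\<^sub>v v)"
proof (rule mat_eqI_mult_vec[of _ m m])
  fix w :: "complex vec" assume w: "w \<in> carrier_vec m"
  have Aw: "mat_adjoint A *\<^sub>v w \<in> carrier_vec n" using assms w by (meson mat_adjoint_carrier mult_mat_vec_carrier)
  have "(A * outer v * mat_adjoint A) *\<^sub>v w = A *\<^sub>v (outer v *\<^sub>v (mat_adjoint A *\<^sub>v w))"
    using assms w Aw by (simp add: assoc_mult_mat_vec[of _ m n _ m] assoc_mult_mat_vec[of _ m n _ n])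
  also have "\<dots> = cinner v (mat_adjoint A *\<^sub>v w) \<cdot>\<^sub>v (A *\<^sub>v v)"
    using assms w Aw by (simp add: outer_mult_vec mult_mat_vec)
  also have "\<dots> = outer (A *\<^sub>v v) *\<^sub>v w"
    using assms w by (simp add: outer_mult_vec[of _ m] cinner_adjoint[of _ n m])
  finally show "(A * outer v * mat_adjoint A) *\<^sub>v w = outer (A *\<^sub>v v) *\<^sub>v w" .
next
  show "A * outer v * mat_adjoint A \<in> carrier_mat m m"
    using assms by (intro mult_carrier_mat[of _ m n] mult_carrier_mat[of A m n] outer_carrier mat_adjoint_carrier)
  show "outer (A *\<^sub>v v) \<in> carrier_mat m m"
    using assms by (intro outer_carrier mult_mat_vec_carrier)
qed

lemma msum_mult_vec_cinner:
  assumes "v \<in> carrier_vec N" "w \<in> carrier_vec N" "\<And>x. x \<in> S \<Longrightarrow> f x \<in> carrier_mat N N"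
  shows "cinner v (msum N S f *\<^sub>v w) = (\<Sum>x\<in>S. cinner v (f x *\<^sub>v w))"
proof -
  have 1: "(msum N S f *\<^sub>v w) $ i = (\<Sum>x\<in>S. (f x *\<^sub>v w) $ i)" if "i < N" for i
  proof -
    have "(msum N S f *\<^sub>v w) $ i = (\<Sum>k<N. msum N S f $$ (i, k) * w $ k)"
      by (rule mult_vec_index_sum[OF msum_carrier assms(2) that])
    also have "\<dots> = (\<Sum>k<N. \<Sum>x\<in>S. f x $$ (i, k) * w $ k)"
      by (rule sum.cong) (use that in \<open>simp_all add: sum_distrib_right\<close>)
    also have "\<dots> = (\<Sum>x\<in>S. \<Sum>k<N. f x $$ (i, k) * w $ k)"
      by (rule sum.swap)
    also have "\<dots> = (\<Sum>x\<in>S. (f x *\<^sub>v w) $ i)"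
      by (intro sum.cong refl mult_vec_index_sum[symmetric, OF assms(3) assms(2) that])
    finally show ?thesis .
  qed
  have "cinner v (msum N S f *\<^sub>v w) = (\<Sum>i<N. cnj (v $ i) * (msum N S f *\<^sub>v w) $ i)"
    using assms(1) by (simp add: cinner_def)
  also have "\<dots> = (\<Sum>i<N. \<Sum>x\<in>S. cnj (v $ i) * (f x *\<^sub>v w) $ i)"
  proof (rule sum.cong[OF refl])
    fix i assume "i \<in> {..<N}"
    then have "i < N" by simp
    show "cnj (v $ i) * (msum N S f *\<^sub>v w) $ i = (\<Sum>x\<in>S. cnj (v $ i) * (f x *\<^sub>v w) $ i)"
      unfolding 1[OF \<open>i < N\<close>] by (rule sum_distrib_left)
  qed
  also have "\<dots> = (\<Sum>x\<in>S. \<Sum>i<N. cnj (v $ i) * (f x *\<^sub>v w) $ i)"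
    by (rule sum.swap)
  also have "\<dots> = (\<Sum>x\<in>S. cinner v (f x *\<^sub>v w))"
    using assms(1) by (simp add: cinner_def)
  finally show ?thesis .
qed

text \<open>Identities for a matrix sum applied to a vector are checked through inner products, over
  which \<open>msum_mult_vec_cinner\<close> distributes the sum.\<close>

lemma cvec_eqI_cinner:
  assumes "v \<in> carrier_vec n" "w \<in> carrier_vec n" "\<And>u. u \<in> carrier_vec n \<Longrightarrow> cinner u v = cinner u w"
  shows "v = w"
proof -
  have "cinner (v - w) (v - w) = cinner (v - w) v - cinner (v - w) w"
    using assms(1,2) by (intro cinner_minus_right) auto
  also have "cinner (v - w) v = cinner (v - w) w" using assms(1,2) by (intro assms(3)) simp
  finally have "cinner (v - w) (v - w) = 0" by simp
  then have "v - w = 0\<^sub>v n" using assms(1,2) cinner_self_zero_iff[of "v - w" n] by simp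
  then have *: "(v - w) $ i = 0" if "i < n" for i using that by simp
  show ?thesis
  proof (rule eq_vecI)
    fix i assume "i < dim_vec w"
    then show "v $ i = w $ i" using *[of i] assms(1,2) by simp
  qed (use assms(1,2) in simp)
qed

section \<open>Von Neumann entropy of block-diagonal mixtures\<close>

text \<open>Newton's step: a polynomial vanishing on the old nodes but not at the new one corrects
  the value there. It serves to replace the entropy function by a polynomial on finitely many
  points.\<close>

lemma poly_interpolation_exists:
  fixes v :: "'a :: field \<Rightarrow> 'a"
  assumes "finite E"
  shows "\<exists>f. \<forall>x\<in>E. poly f x = v x"
  using assms
proof (induction E rule: finite_induct)
  case (insert a E)
  then obtain f where f: "\<forall>x\<in>E. poly f x = v x" by blast
  define g where "g = (\<Prod>b\<in>E. [:- b, 1:])"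
  have g: "poly g x = (\<Prod>b\<in>E. x - b)" for x by (simp add: g_def poly_prod)
  have "poly g a \<noteq> 0" "\<forall>x\<in>E. poly g x = 0" using insert by (auto simp: g)
  then have "\<forall>x\<in>insert a E. poly (f + Polynomial.smult ((v a - poly f a) / poly g a) g) x = v x"
    using f by auto
  then show ?case by blast
qed simp

text \<open>In the sum for an entry (i, j) a term survives only if the middle index k satisfies i
  \<le> k \<le> j: there is none below the diagonal, and only k = i on it.\<close>

lemma upper_triangular_mult:
  fixes A B :: "complex mat"
  assumes A: "A \<in> carrier_mat n n" "upper_triangular A" and B: "B \<in> carrier_mat n n" "upper_triangular B"
  shows "upper_triangular (A * B)"
    and "i < n \<Longrightarrow> (A * B) $$ (i, i) = A $$ (i, i) * B $$ (i, i)"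
proof -
  have ut: "M $$ (i, j) = 0" if "M \<in> carrier_mat n n" "upper_triangular M" "i < n" "j < i" for M :: "complex mat" and i j
    using that(2)[unfolded upper_triangular_def, rule_format, of i j] that(3,4) carrier_matD(1)[OF that(1)] by simp
  show "upper_triangular (A * B)"
  proof (rule upper_triangularI)
    fix i j assume ij: "j < i" "i < dim_row (A * B)"
    have "dim_row (A * B) = n" using A(1) by simp
    then have n: "i < n" "j < n" using ij by simp_all
    have "A $$ (i, k) * B $$ (k, j) = 0" if "k < n" for k
    proof (cases "k < i")
      case True
      then show ?thesis using ut[OF A n(1) True] by simp
    next
      case False
      then have "j < k" using ij by simp
      then show ?thesis using ut[OF B that] by simp
    qed
    then show "(A * B) $$ (i, j) = 0"
      unfolding mult_index_sum[OF A(1) B(1) n] by (intro sum.neutral) simp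
  qed
  show "(A * B) $$ (i, i) = A $$ (i, i) * B $$ (i, i)" if "i < n"
  proof -
    have "A $$ (i, k) * B $$ (k, i) = (if k = i then A $$ (i, i) * B $$ (i, i) else 0)" if k: "k < n" for k
    proof (cases k i rule: linorder_cases)
      case less
      then show ?thesis using ut[OF A \<open>i < n\<close> less] by simp
    next
      case greater
      then show ?thesis using ut[OF B k greater] by simp
    qed simp
    then have "(\<Sum>k<n. A $$ (i, k) * B $$ (k, i)) = (\<Sum>k<n. if k = i then A $$ (i, i) * B $$ (i, i) else 0)"
      by (intro sum.cong refl) (simp only: lessThan_iff)
    then show ?thesis
      unfolding mult_index_sum[OF A(1) B(1) that that] using that by simp
  qed
qed

lemma upper_triangular_pow:
  fixes A :: "complex mat"
  assumes A: "A \<in> carrier_mat n n" "upper_triangular A"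
  shows "upper_triangular (A ^\<^sub>m k) \<and> (\<forall>i<n. (A ^\<^sub>m k) $$ (i, i) = (A $$ (i, i)) ^ k)"
proof (induction k)
  case 0
  show ?case using A by (auto intro!: upper_triangularI)
next
  case (Suc k)
  have c: "A ^\<^sub>m k \<in> carrier_mat n n" using A by simp
  show ?case using Suc upper_triangular_mult[OF c _ A] by (auto simp del: index_mult_mat(1))
qed

text \<open>The Schur form carries \<open>es\<close> on its diagonal, its powers carry the powers of
  \<open>es\<close>, and cyclicity of the trace removes the similarity.\<close>

lemma mtrace_pow_eq_sum_eigenvalues:
  fixes A :: "complex mat"
  assumes A: "A \<in> carrier_mat n n" and es: "char_poly A = (\<Prod>a\<leftarrow>es. [:- a, 1:])"
  shows "mtrace (A ^\<^sub>m k) = (\<Sum>a\<leftarrow>es. a ^ k)"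
proof -
  obtain B P Q where "schur_decomposition A es = (B, P, Q)" by (metis prod_cases3)
  from schur_decomposition[OF A es this]
  have wit: "similar_mat_wit A B P Q" and B: "upper_triangular B" "diag_mat B = es" by auto
  from similar_mat_witD2[OF A wit] have c: "B \<in> carrier_mat n n" "P \<in> carrier_mat n n" "Q \<in> carrier_mat n n"
    and QP: "Q * P = 1\<^sub>m n" by auto
  have ck: "B ^\<^sub>m k \<in> carrier_mat n n" using c by simp
  have "A ^\<^sub>m k = P * B ^\<^sub>m k * Q"
    using similar_mat_wit_pow_id[OF wit] by blast
  then have "mtrace (A ^\<^sub>m k) = mtrace (P * (B ^\<^sub>m k * Q))"
    using c ck by (simp add: assoc_mult_mat[of _ n n _ n _ n])
  also have "\<dots> = mtrace ((B ^\<^sub>m k * Q) * P)"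
    using c ck by (intro mtrace_mult_commute[of _ n n]) auto
  also have "\<dots> = mtrace (B ^\<^sub>m k)"
    using c ck QP by (simp add: assoc_mult_mat[of _ n n _ n _ n])
  also have "\<dots> = (\<Sum>i<n. (B $$ (i, i)) ^ k)"
    using upper_triangular_pow[OF c(1) B(1), of k] ck by (auto simp: mtrace_def)
  also have "\<dots> = (\<Sum>a\<leftarrow>diag_mat B. a ^ k)"
    using c by (simp add: diag_mat_def sum_list_distinct_conv_sum_set atLeast0LessThan o_def)
  finally show ?thesis using B by simp
qed

lemma order_prod_linear_factors:
  "Polynomial.order a (\<Prod>b\<leftarrow>es. [:- b, 1:]) = count_list es (a :: 'a :: field)"
proof (induction es)
  case (Cons b es)
  have "(\<Prod>b\<leftarrow>es. [:- b, 1:]) \<noteq> (0 :: 'a poly)" by (auto simp: prod_list_zero_iff)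
  then have "[:- b, 1:] * (\<Prod>b\<leftarrow>es. [:- b, 1:]) \<noteq> 0" by (simp only: mult_eq_0_iff) simp
  from order_mult[OF this, of a]
  have "Polynomial.order a (\<Prod>b\<leftarrow>b # es. [:- b, 1:]) = Polynomial.order a [:- b, 1:] + count_list es a"
    by (simp add: Cons)
  moreover have "Polynomial.order a [:- b, 1:] = (if a = b then 1 else 0)"
    using order_power_n_n[of b 1] by (auto intro!: order_0I)
  ultimately show ?case by simp
qed (simp add: order_0I)

lemma sum_list_map_eq_sum_count_real:
  fixes f :: "'a \<Rightarrow> real"
  shows "sum_list (map f xs) = (\<Sum>x\<in>set xs. real (count_list xs x) * f x)"
proof (induction xs)
  case (Cons a xs)
  have "(\<Sum>x\<in>set (a # xs). real (count_list (a # xs) x) * f x) =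
      (\<Sum>x\<in>set (a # xs). real (count_list xs x) * f x) + (\<Sum>x\<in>set (a # xs). if x = a then f a else 0)"
    unfolding sum.distrib[symmetric] by (intro sum.cong) (auto simp: algebra_simps)
  also have "(\<Sum>x\<in>set (a # xs). real (count_list xs x) * f x) = (\<Sum>x\<in>set xs. real (count_list xs x) * f x)"
    by (intro sum.mono_neutral_right) (auto simp: count_list_0_iff)
  finally show ?case using Cons by simp
qed simp

text \<open>The definition sums over distinct eigenvalues weighted by root order; the list form
  counts multiplicities by repetition, as the traces of powers do.\<close>

lemma vnS_eq_sum_eigenvalues:
  assumes A: "A \<in> carrier_mat n n" and es: "char_poly A = (\<Prod>a\<leftarrow>es. [:- a, 1:])"
  shows "vnS d A = (\<Sum>a\<leftarrow>es. eta d (Re a))"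
proof -
  have "spectrum A = set es"
    unfolding spectrum_root_char_poly[OF A] es
    by (auto simp: poly_prod_list prod_list_zero_iff o_def)
  then show ?thesis
    unfolding vnS_def es order_prod_linear_factors by (simp add: sum_list_map_eq_sum_count_real)
qed

lemma sum_list_sum_swap:
  "(\<Sum>a\<leftarrow>xs. \<Sum>j\<in>J. f a j) = (\<Sum>j\<in>J. \<Sum>a\<leftarrow>xs. f a j :: 'b :: comm_monoid_add)"
  by (induction xs) (simp_all add: sum.distrib)

(* The traces of the powers of A determine sums of polynomials over its eigenvalues; on the finitely many
   relevant points eta agrees with a polynomial without constant term. *)
lemma vnS_block_decomposition:
  fixes p :: "'x \<Rightarrow> real" and t :: "'x \<Rightarrow> real" and r :: "'x \<Rightarrow> 'x \<Rightarrow> bool"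
  assumes fin: "finite S"
    and p: "\<And>x. x \<in> S \<Longrightarrow> p x \<ge> 0"
    and Q: "\<And>x. x \<in> S \<Longrightarrow> Q x \<in> carrier_mat N N"
    and QQ: "\<And>x y. x \<in> S \<Longrightarrow> y \<in> S \<Longrightarrow> Q x * Q y = (if r x y then Q x else 0\<^sub>m N N)"
    and r: "\<And>x. x \<in> S \<Longrightarrow> r x x"
    and t: "\<And>x. x \<in> S \<Longrightarrow> mtrace (Q x) = of_real (t x)"
  shows "vnS d (msum N S (\<lambda>x. of_real (p x) \<cdot>\<^sub>m Q x)) =
    - (\<Sum>x\<in>S. p x * log (real d) (\<Sum>y\<in>{y\<in>S. r x y}. p y) * t x)"
proof -
  define A where "A = msum N S (\<lambda>x. of_real (p x) \<cdot>\<^sub>m Q x)"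
  define q where "q x = (\<Sum>y\<in>{y\<in>S. r x y}. p y)" for x
  have A: "A \<in> carrier_mat N N" by (simp add: A_def)
  have cQ: "of_real (p x) \<cdot>\<^sub>m Q x \<in> carrier_mat N N" if "x \<in> S" for x using Q[OF that] by simp
  obtain es where es: "char_poly A = (\<Prod>a\<leftarrow>es. [:- a, 1:])"
    using char_poly_factorized[OF A] by blast
  \<comment> \<open>On the block of x the matrix \<open>A\<close> acts as the scalar
    \<open>q x\<close>, the total weight of that block.\<close>
  have QA: "Q x * A = of_real (q x) \<cdot>\<^sub>m Q x" if x: "x \<in> S" for x
  proof -
    have "Q x * A = msum N S (\<lambda>y. Q x * (of_real (p y) \<cdot>\<^sub>m Q y))"
      unfolding A_def by (rule mult_msum[OF Q[OF x] cQ])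
    also have "\<dots> = msum N S (\<lambda>y. of_real (if r x y then p y else 0) \<cdot>\<^sub>m Q x)"
    proof (rule msum_cong[OF refl])
      fix y assume y: "y \<in> S"
      have "Q x * (of_real (p y) \<cdot>\<^sub>m Q y) = of_real (p y) \<cdot>\<^sub>m (Q x * Q y)"
        using Q[OF x] Q[OF y] by (simp add: mult_smult_distrib)
      also have "\<dots> = of_real (if r x y then p y else 0) \<cdot>\<^sub>m Q x"
        using Q[OF x] by (auto simp: QQ[OF x y] intro!: eq_matI)
      finally show "Q x * (of_real (p y) \<cdot>\<^sub>m Q y) = of_real (if r x y then p y else 0) \<cdot>\<^sub>m Q x" .
    qed
    also have "\<dots> = (\<Sum>y\<in>S. of_real (if r x y then p y else 0)) \<cdot>\<^sub>m Q x"
      by (rule msum_smult_const[OF Q[OF x]])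
    also have "(\<Sum>y\<in>S. of_real (if r x y then p y else 0)) = (of_real (q x) :: complex)"
      unfolding q_def of_real_sum[symmetric] using fin
      by (simp add: sum.If_cases Int_def conj_commute)
    finally show ?thesis .
  qed
  \<comment> \<open>Only positive powers have this form, since the blocks need not sum to the
    identity.\<close>
  have pow: "A ^\<^sub>m Suc j = msum N S (\<lambda>x. of_real (p x * q x ^ j) \<cdot>\<^sub>m Q x)" for j
  proof (induction j)
    case 0
    have "A ^\<^sub>m Suc 0 = A" using A by simp
    then show ?case by (simp add: A_def)
  next
    case (Suc j)
    have "A ^\<^sub>m Suc (Suc j) = A ^\<^sub>m Suc j * A" by simp
    also have "\<dots> = msum N S (\<lambda>x. (of_real (p x * q x ^ j) \<cdot>\<^sub>m Q x) * A)"
      unfolding Suc using Q by (intro msum_mult[OF A]) simp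
    also have "\<dots> = msum N S (\<lambda>x. of_real (p x * q x ^ Suc j) \<cdot>\<^sub>m Q x)"
    proof (rule msum_cong[OF refl])
      fix x assume x: "x \<in> S"
      have "(of_real (p x * q x ^ j) \<cdot>\<^sub>m Q x) * A = of_real (p x * q x ^ j) \<cdot>\<^sub>m (Q x * A)"
        by (rule mult_smult_assoc_mat[OF Q[OF x] A])
      also have "\<dots> = of_real (p x * q x ^ Suc j) \<cdot>\<^sub>m Q x"
        unfolding QA[OF x] by (rule eq_matI) (use Q[OF x] in auto)
      finally show "(of_real (p x * q x ^ j) \<cdot>\<^sub>m Q x) * A = of_real (p x * q x ^ Suc j) \<cdot>\<^sub>m Q x" .
    qed
    finally show ?case .
  qed
  have trp: "(\<Sum>a\<leftarrow>es. a ^ Suc j) = (\<Sum>x\<in>S. of_real (p x * q x ^ j * t x))" for j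
  proof -
    have "(\<Sum>a\<leftarrow>es. a ^ Suc j) = mtrace (A ^\<^sub>m Suc j)"
      by (rule mtrace_pow_eq_sum_eigenvalues[OF A es, symmetric])
    also have "\<dots> = (\<Sum>x\<in>S. mtrace (of_real (p x * q x ^ j) \<cdot>\<^sub>m Q x))"
      unfolding pow using Q by (intro mtrace_msum) simp
    also have "\<dots> = (\<Sum>x\<in>S. of_real (p x * q x ^ j * t x))"
      by (intro sum.cong refl) (simp add: mtrace_smult[OF Q] t)
    finally show ?thesis .
  qed
  \<comment> \<open>The node 0 makes the constant term vanish, so that only traces of positive
    powers enter. \<open>eta\<close> is 0 there, so eigenvalues outside all blocks contribute
    nothing.\<close>
  have "finite (insert 0 (set es \<union> (\<lambda>x. of_real (q x)) ` S))" using fin by simp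
  from poly_interpolation_exists[OF this, of "\<lambda>e. of_real (eta d (Re e))"]
  obtain f where f0: "poly f 0 = 0" and fe: "\<And>e. e \<in> set es \<Longrightarrow> poly f e = of_real (eta d (Re e))"
    and fq: "\<And>x. x \<in> S \<Longrightarrow> poly f (of_real (q x)) = of_real (eta d (q x))"
    by (auto simp: eta_def)
  then obtain g where g: "f = pCons 0 g" by (metis poly_0_coeff_0 pCons_cases coeff_pCons_0)
  have pf: "poly f z = (\<Sum>j\<le>degree g. coeff g j * z ^ Suc j)" for z
    unfolding g poly_pCons poly_altdef[of g] by (simp add: sum_distrib_left ac_simps)
  \<comment> \<open>The weight of a block can vanish only together with \<open>p x\<close>, so a
    logarithm that counts has a positive argument.\<close>
  have q: "q x > 0 \<or> p x = 0" if x: "x \<in> S" for x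
  proof -
    have "p x \<le> q x" unfolding q_def
      by (rule member_le_sum[of x _ p]) (use x r[OF x] fin p in auto)
    then show ?thesis using p[OF x] by linarith
  qed
  have "of_real (vnS d A) = (\<Sum>a\<leftarrow>es. poly f a)"
    unfolding vnS_eq_sum_eigenvalues[OF A es]
    using fe by (induction es) auto
  also have "\<dots> = (\<Sum>j\<le>degree g. coeff g j * (\<Sum>a\<leftarrow>es. a ^ Suc j))"
    unfolding pf by (simp add: sum_list_const_mult[symmetric] sum_list_sum_swap)
  also have "\<dots> = (\<Sum>x\<in>S. \<Sum>j\<le>degree g. coeff g j * of_real (p x * q x ^ j * t x))"
    unfolding trp sum_distrib_left by (rule sum.swap)
  also have "\<dots> = (\<Sum>x\<in>S. of_real (- (p x * log (real d) (q x) * t x)))"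
  proof (intro sum.cong refl)
    fix x assume x: "x \<in> S"
    show "(\<Sum>j\<le>degree g. coeff g j * of_real (p x * q x ^ j * t x)) = of_real (- (p x * log (real d) (q x) * t x))"
    proof (cases "p x = 0")
      case False
      then have qx: "q x > 0" using q[OF x] by simp
      \<comment> \<open>The exponents are one lower than in \<open>poly f\<close>, hence the
        division by \<open>q x\<close>; it turns \<open>eta d (q x)\<close> into minus the
        logarithm.\<close>
      have "(\<Sum>j\<le>degree g. coeff g j * of_real (p x * q x ^ j * t x)) =
          of_real (p x * t x / q x) * poly f (of_real (q x))"
        unfolding pf sum_distrib_left using qx by (intro sum.cong) (auto simp: field_simps)
      also have "\<dots> = of_real (p x * t x / q x * eta d (q x))" using fq[OF x] by simp
      also have "p x * t x / q x * eta d (q x) = - (p x * log (real d) (q x) * t x)"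
        using qx by (simp add: eta_def field_simps)
      finally show ?thesis .
    qed simp
  qed
  also have "\<dots> = of_real (- (\<Sum>x\<in>S. p x * log (real d) (q x) * t x))"
    by (simp add: sum_negf)
  finally have "(of_real (vnS d A) :: complex) = of_real (- (\<Sum>x\<in>S. p x * log (real d) (q x) * t x))" .
  then have "vnS d A = - (\<Sum>x\<in>S. p x * log (real d) (q x) * t x)"
    by (simp only: of_real_eq_iff)
  then show ?thesis by (simp add: A_def q_def)
qed

section \<open>Weyl systems and stabilizer projections\<close>

lemma smult_smult_mat: "a \<cdot>\<^sub>m (b \<cdot>\<^sub>m A) = (a * b) \<cdot>\<^sub>m (A :: complex mat)"
  by (rule eq_matI) (simp_all add: mult.assoc)

lemma smult_mat_mult_vec:
  fixes A :: "complex mat"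
  assumes "A \<in> carrier_mat m n" "v \<in> carrier_vec n"
  shows "(c \<cdot>\<^sub>m A) *\<^sub>v v = c \<cdot>\<^sub>v (A *\<^sub>v v)"
  by (rule eq_vecI) (use assms in \<open>simp_all add: scalar_prod_def sum_distrib_left mult.assoc\<close>)

lemma smult_one_mat [simp]: "1 \<cdot>\<^sub>m A = (A :: complex mat)"
  by (rule eq_matI) simp_all

text \<open>The common structure of the Pauli operators of any fixed length. A vector space over the
  prime field is encoded as a commutative group of exponent d, so that subspaces become subgroups.
  The phases are bimultiplicative rather than merely a cocycle, which makes their antisymmetrisation
  a bicharacter without further argument.\<close>

locale weyl_system = comm_group G for G (structure) +
  fixes D d :: nat and W :: "'a \<Rightarrow> complex mat" and \<beta> :: "'a \<Rightarrow> 'a \<Rightarrow> complex"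
  assumes fin: "finite (carrier G)"
    and prime_d: "prime d"
    and D_pos: "0 < D"
    and W_carrier [simp]: "x \<in> carrier G \<Longrightarrow> W x \<in> carrier_mat D D"
    and W_mult: "x \<in> carrier G \<Longrightarrow> y \<in> carrier G \<Longrightarrow> W x * W y = \<beta> x y \<cdot>\<^sub>m W (x \<otimes> y)"
    and W_one: "W \<one> = 1\<^sub>m D"
    and W_unitary: "x \<in> carrier G \<Longrightarrow> mat_adjoint (W x) * W x = 1\<^sub>m D"
    and W_trace: "x \<in> carrier G \<Longrightarrow> x \<noteq> \<one> \<Longrightarrow> mtrace (W x) = 0"
    and exponent: "x \<in> carrier G \<Longrightarrow> x [^] d = \<one>"
    and \<beta>_unit: "x \<in> carrier G \<Longrightarrow> y \<in> carrier G \<Longrightarrow> cmod (\<beta> x y) = 1"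
    and \<beta>_mult_left: "x \<in> carrier G \<Longrightarrow> y \<in> carrier G \<Longrightarrow> z \<in> carrier G \<Longrightarrow> \<beta> (x \<otimes> y) z = \<beta> x z * \<beta> y z"
    and \<beta>_mult_right: "x \<in> carrier G \<Longrightarrow> y \<in> carrier G \<Longrightarrow> z \<in> carrier G \<Longrightarrow> \<beta> x (y \<otimes> z) = \<beta> x y * \<beta> x z"
    and nondegenerate: "x \<in> carrier G \<Longrightarrow> x \<noteq> \<one> \<Longrightarrow> \<exists>y\<in>carrier G. \<beta> x y \<noteq> \<beta> y x"
begin

text \<open>The symplectic form in exponentiated form: for Pauli strings this is \<omega> raised to
  the form of x and y.\<close>

definition chi :: "'a \<Rightarrow> 'a \<Rightarrow> complex" where
  "chi x y = \<beta> x y / \<beta> y x"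

definition perp :: "'a set \<Rightarrow> 'a set" where
  "perp M = {y \<in> carrier G. \<forall>x\<in>M. chi x y = 1}"

lemma square_mat_simps:
  fixes A B C :: "complex mat"
  shows "A \<in> carrier_mat D D \<Longrightarrow> B \<in> carrier_mat D D \<Longrightarrow> C \<in> carrier_mat D D \<Longrightarrow> A * B * C = A * (B * C)"
  "A \<in> carrier_mat D D \<Longrightarrow> A * 1\<^sub>m D = A"
  "A \<in> carrier_mat D D \<Longrightarrow> 1\<^sub>m D * A = A"
  "A \<in> carrier_mat D D \<Longrightarrow> B \<in> carrier_mat D D \<Longrightarrow> (c \<cdot>\<^sub>m A) * B = c \<cdot>\<^sub>m (A * B)"
  "A \<in> carrier_mat D D \<Longrightarrow> B \<in> carrier_mat D D \<Longrightarrow> A * (c \<cdot>\<^sub>m B) = c \<cdot>\<^sub>m (A * B)"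
  "A \<in> carrier_mat D D \<Longrightarrow> B \<in> carrier_mat D D \<Longrightarrow> A * B \<in> carrier_mat D D"
  by (auto intro: assoc_mult_mat mult_smult_assoc_mat mult_smult_distrib
      right_mult_one_mat left_mult_one_mat)

lemma \<beta>_nonzero: "x \<in> carrier G \<Longrightarrow> y \<in> carrier G \<Longrightarrow> \<beta> x y \<noteq> 0"
  using \<beta>_unit[of x y] by auto

lemma chi_mult_left:
  "x \<in> carrier G \<Longrightarrow> y \<in> carrier G \<Longrightarrow> z \<in> carrier G \<Longrightarrow> chi (x \<otimes> y) z = chi x z * chi y z"
  by (simp add: chi_def \<beta>_mult_left \<beta>_mult_right)

lemma chi_mult_right:
  "x \<in> carrier G \<Longrightarrow> y \<in> carrier G \<Longrightarrow> z \<in> carrier G \<Longrightarrow> chi x (y \<otimes> z) = chi x y * chi x z"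
  by (simp add: chi_def \<beta>_mult_left \<beta>_mult_right)

lemma chi_unit: "x \<in> carrier G \<Longrightarrow> y \<in> carrier G \<Longrightarrow> cmod (chi x y) = 1"
  by (simp add: chi_def norm_divide \<beta>_unit)

lemma chi_nonzero: "x \<in> carrier G \<Longrightarrow> y \<in> carrier G \<Longrightarrow> chi x y \<noteq> 0"
  using chi_unit[of x y] by auto

lemma chi_swap: "chi y x = inverse (chi x y)"
  by (simp add: chi_def)

lemma chi_swap_eq_1: "chi y x = 1 \<longleftrightarrow> chi x y = 1"
  using chi_swap[of y x] by (metis inverse_1 inverse_eq_1_iff)

lemma cnj_chi: "x \<in> carrier G \<Longrightarrow> y \<in> carrier G \<Longrightarrow> cnj (chi x y) = chi y x"
  using complex_norm_square[of "chi x y"] chi_unit[of x y] chi_swap[of y x]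
  by (metis inverse_unique of_real_1 one_power2)

lemma chi_one_left: "x \<in> carrier G \<Longrightarrow> chi \<one> x = 1"
  using chi_mult_left[OF one_closed one_closed, of x] chi_nonzero[of \<one> x] by (metis l_one mult_cancel_right1 one_closed)

lemma chi_one_right: "x \<in> carrier G \<Longrightarrow> chi x \<one> = 1"
  using chi_one_left chi_swap_eq_1 by blast

lemma chi_inv_right:
  assumes "x \<in> carrier G" "y \<in> carrier G"
  shows "chi x (inv y) = inverse (chi x y)"
proof -
  have "chi x y * chi x (inv y) = chi x (y \<otimes> inv y)"
    using assms by (intro chi_mult_right[symmetric]) auto
  then have "chi x y * chi x (inv y) = 1" using assms by (simp add: chi_one_right)
  then show ?thesis by (metis inverse_unique)
qed

lemma chi_pow_left: "x \<in> carrier G \<Longrightarrow> y \<in> carrier G \<Longrightarrow> chi (x [^] (i :: nat)) y = chi x y ^ i"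
  by (induction i) (simp_all add: chi_one_left chi_mult_left mult.commute)

lemma chi_root: "x \<in> carrier G \<Longrightarrow> y \<in> carrier G \<Longrightarrow> chi x y ^ d = 1"
  using chi_pow_left[of x y d] by (simp add: exponent chi_one_left)

lemma \<beta>_one_one: "\<beta> \<one> \<one> = 1"
  using \<beta>_mult_left[of \<one> \<one> \<one>] \<beta>_nonzero[of \<one> \<one>] by (metis l_one mult_cancel_right1 one_closed)

section \<open>Symplectic complements\<close>

lemma perp_carrier: "perp M \<subseteq> carrier G"
  by (auto simp: perp_def)

lemma subgroup_perp:
  assumes "M \<subseteq> carrier G" shows "subgroup (perp M) G"
proof (rule subgroupI)
  have "\<one> \<in> perp M" unfolding perp_def using assms by (auto intro: chi_one_right)
  then show "perp M \<noteq> {}" by blast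
  show "inv a \<in> perp M" if "a \<in> perp M" for a
  proof -
    have "chi x (inv a) = 1" if "x \<in> M" for x
      using \<open>a \<in> perp M\<close> that assms chi_inv_right[of x a] by (auto simp: perp_def)
    then show ?thesis using that by (simp add: perp_def)
  qed
  show "a \<otimes> b \<in> perp M" if "a \<in> perp M" "b \<in> perp M" for a b
  proof -
    have "chi x (a \<otimes> b) = 1" if "x \<in> M" for x
      using \<open>a \<in> perp M\<close> \<open>b \<in> perp M\<close> that assms chi_mult_right[of x a b] by (auto simp: perp_def)
    then show ?thesis using that by (simp add: perp_def)
  qed
qed (auto simp: perp_def)

section \<open>Character sums and the size of the complement\<close>

lemma subgroup_translate_bij:
  assumes "subgroup H G" "h \<in> H"
  shows "bij_betw (\<lambda>x. h \<otimes> x) H H"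
proof -
  interpret H: subgroup H G by fact
  show ?thesis
    by (rule bij_betw_byWitness[where f' = "\<lambda>x. inv h \<otimes> x"])
      (use assms in \<open>auto simp: m_assoc[symmetric]\<close>)
qed

text \<open>Translating the summation variable by h multiplies the sum by \<open>f h\<close>, which
  differs from 1.\<close>

lemma subgroup_character_sum:
  fixes f :: "'a \<Rightarrow> complex"
  assumes H: "subgroup H G" and f: "\<And>x y. x \<in> H \<Longrightarrow> y \<in> H \<Longrightarrow> f (x \<otimes> y) = f x * f y"
    and h: "h \<in> H" "f h \<noteq> 1"
  shows "(\<Sum>x\<in>H. f x) = 0"
proof -
  have "(\<Sum>x\<in>H. f x) = (\<Sum>x\<in>H. f (h \<otimes> x))"
    by (rule sum.reindex_bij_betw[OF subgroup_translate_bij[OF H h(1)], symmetric])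
  also have "\<dots> = f h * (\<Sum>x\<in>H. f x)"
    unfolding sum_distrib_left by (intro sum.cong refl f h)
  finally show ?thesis using h(2) by (metis mult_cancel_right1)
qed

lemma chi_sum_left:
  assumes "y \<in> carrier G"
  shows "(\<Sum>x\<in>carrier G. chi x y) = (if y = \<one> then of_nat (card (carrier G)) else 0)"
proof (cases "y = \<one>")
  case False
  obtain z where z: "z \<in> carrier G" "\<beta> y z \<noteq> \<beta> z y" using nondegenerate[OF assms False] by blast
  have "chi z y \<noteq> 1" using z \<beta>_nonzero[OF assms z(1)] by (auto simp: chi_def divide_eq_eq)
  then have "(\<Sum>x\<in>carrier G. chi x y) = 0"
    using z assms by (intro subgroup_character_sum[OF subgroup_self _ z(1)]) (auto simp: chi_mult_left)
  then show ?thesis using False by simp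
qed (simp add: chi_one_right)

text \<open>Double counting of the sum of \<open>chi x y\<close> over x in M and all y. Summing over
  M first leaves \<open>card M\<close> for each y in \<open>perp M\<close>; summing over y first
  leaves only x = 1, by nondegeneracy. This takes the place of the dimension formula for symplectic
  complements.\<close>

lemma card_perp:
  assumes M: "subgroup M G"
  shows "card M * card (perp M) = card (carrier G)"
proof -
  interpret M: subgroup M G by fact
  have fM: "finite M" by (rule finite_subset[OF M.subset fin])
  have "(\<Sum>x\<in>M. chi x y) = (if y \<in> perp M then of_nat (card M) else 0)" if y: "y \<in> carrier G" for y
  proof (cases "y \<in> perp M")
    case False
    then obtain h where "h \<in> M" "chi h y \<noteq> 1" using y by (auto simp: perp_def)
    then have "(\<Sum>x\<in>M. chi x y) = 0"
      using y by (intro subgroup_character_sum[OF M]) (auto simp: chi_mult_left)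
    then show ?thesis using False by simp
  qed (simp add: perp_def)
  then have "(\<Sum>y\<in>carrier G. \<Sum>x\<in>M. chi x y) = (\<Sum>y\<in>carrier G. if y \<in> perp M then of_nat (card M) else 0)"
    by (intro sum.cong refl) simp
  also have "\<dots> = of_nat (card M * card (perp M))"
    using perp_carrier[of M] fin by (simp add: sum.If_cases Int_absorb1 mult.commute)
  finally have 1: "(\<Sum>y\<in>carrier G. \<Sum>x\<in>M. chi x y) = of_nat (card M * card (perp M))" .
  have "(\<Sum>y\<in>carrier G. chi x y) = (if x = \<one> then of_nat (card (carrier G)) else 0)" if "x \<in> M" for x
  proof -
    have "(\<Sum>y\<in>carrier G. chi x y) = cnj (\<Sum>y\<in>carrier G. chi y x)"
      using that by (simp add: cnj_chi)
    then show ?thesis using that by (simp add: chi_sum_left)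
  qed
  then have "(\<Sum>x\<in>M. \<Sum>y\<in>carrier G. chi x y) = (\<Sum>x\<in>M. if x = \<one> then of_nat (card (carrier G)) else 0)"
    by (intro sum.cong refl) simp
  also have "\<dots> = of_nat (card (carrier G))" using fM by simp
  finally have "(of_nat (card M * card (perp M)) :: complex) = of_nat (card (carrier G))"
    unfolding 1[symmetric] by (subst sum.swap)
  then show ?thesis using of_nat_eq_iff by blast
qed

text \<open>One inclusion is the symmetry of commuting; two uses of \<open>card_perp\<close> give
  both sides the same finite size.\<close>

lemma perp_perp:
  assumes M: "subgroup M G" shows "perp (perp M) = M"
proof -
  have Mc: "M \<subseteq> carrier G" by (rule subgroup.subset[OF M])
  have sub: "M \<subseteq> perp (perp M)" using Mc chi_swap_eq_1 by (auto simp: perp_def)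
  have c: "card (perp M) * card (perp (perp M)) = card (carrier G)" by (rule card_perp[OF subgroup_perp[OF Mc]])
  have "card (carrier G) > 0" using fin one_closed by (auto simp: card_gt_0_iff)
  then have "card (perp (perp M)) = card M" using c card_perp[OF M] by (metis mult.commute mult_cancel1 less_not_refl mult_0)
  then show ?thesis using card_subset_eq[OF _ sub] finite_subset[OF perp_carrier fin] by simp
qed

section \<open>Commutation relations of the Weyl operators\<close>

lemma W_commute:
  assumes "x \<in> carrier G" "y \<in> carrier G"
  shows "W x * W y = chi x y \<cdot>\<^sub>m (W y * W x)"
  using assms \<beta>_nonzero[of y x] by (simp add: W_mult smult_smult_mat chi_def m_comm)

lemma W_unitary_right: "x \<in> carrier G \<Longrightarrow> W x * mat_adjoint (W x) = 1\<^sub>m D"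
  by (rule mat_mult_left_right_inverse[OF _ _ W_unitary]) auto

lemma W_conj:
  assumes "x \<in> carrier G" "y \<in> carrier G"
  shows "W x * W y * mat_adjoint (W x) = chi x y \<cdot>\<^sub>m W y"
proof -
  have "W x * W y * mat_adjoint (W x) = (chi x y \<cdot>\<^sub>m (W y * W x)) * mat_adjoint (W x)"
    using W_commute[OF assms] by simp
  also have "\<dots> = chi x y \<cdot>\<^sub>m (W y * (W x * mat_adjoint (W x)))"
    using assms by (simp add: square_mat_simps)
  finally show ?thesis using assms by (simp add: W_unitary_right square_mat_simps)
qed

lemma W_inv:
  assumes "x \<in> carrier G"
  shows "W (inv x) = \<beta> x (inv x) \<cdot>\<^sub>m mat_adjoint (W x)"
proof -
  have "W (inv x) = (mat_adjoint (W x) * W x) * W (inv x)" using assms by (simp add: W_unitary square_mat_simps)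
  also have "\<dots> = mat_adjoint (W x) * (W x * W (inv x))"
    using assms by (simp add: square_mat_simps)
  also have "\<dots> = \<beta> x (inv x) \<cdot>\<^sub>m mat_adjoint (W x)"
    using assms by (simp add: W_mult W_one square_mat_simps)
  finally show ?thesis .
qed

text \<open>The possible families of eigenvalues of the operators of M on a common eigenvector:
  characters of M twisted by the phases \<open>\<beta>\<close>.\<close>

definition stab_char :: "'a set \<Rightarrow> ('a \<Rightarrow> complex) \<Rightarrow> bool" where
  "stab_char M \<tau> \<longleftrightarrow> subgroup M G \<and> (\<forall>g\<in>M. cmod (\<tau> g) = 1) \<and>
     (\<forall>g\<in>M. \<forall>h\<in>M. \<tau> g * \<tau> h = \<beta> g h * \<tau> (g \<otimes> h))"

definition stab_code :: "'a set \<Rightarrow> ('a \<Rightarrow> complex) \<Rightarrow> complex vec set" where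
  "stab_code M \<tau> = {\<psi> \<in> carrier_vec D. \<forall>g\<in>M. W g *\<^sub>v \<psi> = \<tau> g \<cdot>\<^sub>v \<psi>}"

text \<open>The Fourier average over M: on a vector with eigenvalues \<open>\<tau>\<close> every
  summand acts as the identity, on other joint eigenspaces the summands cancel.\<close>

definition stab_proj :: "'a set \<Rightarrow> ('a \<Rightarrow> complex) \<Rightarrow> complex mat" where
  "stab_proj M \<tau> = (1 / of_nat (card M)) \<cdot>\<^sub>m msum D M (\<lambda>g. cnj (\<tau> g) \<cdot>\<^sub>m W g)"

lemma stab_charD:
  assumes "stab_char M \<tau>"
  shows "subgroup M G" "M \<subseteq> carrier G" "finite M" "card M > 0"
    "\<And>g. g \<in> M \<Longrightarrow> cmod (\<tau> g) = 1"
    "\<And>g. g \<in> M \<Longrightarrow> \<tau> g \<noteq> 0"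
    "\<And>g. g \<in> M \<Longrightarrow> \<tau> g * cnj (\<tau> g) = 1"
    "\<And>g h. g \<in> M \<Longrightarrow> h \<in> M \<Longrightarrow> \<tau> g * \<tau> h = \<beta> g h * \<tau> (g \<otimes> h)"
    "\<tau> \<one> = 1"
proof -
  show M: "subgroup M G" and u: "\<And>g. g \<in> M \<Longrightarrow> cmod (\<tau> g) = 1"
    and m: "\<And>g h. g \<in> M \<Longrightarrow> h \<in> M \<Longrightarrow> \<tau> g * \<tau> h = \<beta> g h * \<tau> (g \<otimes> h)"
    using assms by (auto simp: stab_char_def)
  show "M \<subseteq> carrier G" by (rule subgroup.subset[OF M])
  then show "finite M" using fin finite_subset by blast
  show "card M > 0" by (rule subgroup.finite_imp_card_positive[OF M fin])
  show nz: "\<tau> g \<noteq> 0" if "g \<in> M" for g using u[OF that] by auto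
  show "\<tau> g * cnj (\<tau> g) = 1" if "g \<in> M" for g
    using u[OF that] complex_norm_square[of "\<tau> g"] by simp
  have 1: "\<one> \<in> M" by (rule subgroup.one_closed[OF M])
  have "\<tau> \<one> * \<tau> \<one> = \<tau> \<one>" using m[OF 1 1] by (simp add: \<beta>_one_one)
  then show "\<tau> \<one> = 1" using nz[OF 1] by simp
qed

text \<open>A code is defined with arbitrary scalars; a single nonzero vector in it forces them to
  be a twisted character. Unitarity of \<open>W g\<close> gives modulus 1, and applying
  \<open>W g * W h\<close> to the vector in two ways gives the product rule.\<close>

lemma stab_char_of_eigenvector:
  assumes M: "subgroup M G" and \<psi>: "\<psi> \<in> carrier_vec D" "\<psi> \<noteq> 0\<^sub>v D"
    and e: "\<And>g. g \<in> M \<Longrightarrow> W g *\<^sub>v \<psi> = \<tau> g \<cdot>\<^sub>v \<psi>"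
  shows "stab_char M \<tau>"
proof -
  interpret M: subgroup M G by fact
  have nz: "cinner \<psi> \<psi> \<noteq> 0" using \<psi> cinner_self_zero_iff by blast
  have inj: "a = b" if "a \<cdot>\<^sub>v \<psi> = b \<cdot>\<^sub>v \<psi>" for a b
  proof -
    have "a * cinner \<psi> \<psi> = b * cinner \<psi> \<psi>"
      using that cinner_smult_right[OF refl, of \<psi> a] cinner_smult_right[OF refl, of \<psi> b] by metis
    then show ?thesis using nz by simp
  qed
  have "cmod (\<tau> g) = 1" if g: "g \<in> M" for g
  proof -
    have "cinner (W g *\<^sub>v \<psi>) (W g *\<^sub>v \<psi>) = cinner (mat_adjoint (W g) *\<^sub>v (W g *\<^sub>v \<psi>)) \<psi>"
      using g \<psi> by (intro cinner_adjoint[of _ D D] mult_mat_vec_carrier[of _ D D]) auto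
    also have "mat_adjoint (W g) *\<^sub>v (W g *\<^sub>v \<psi>) = (mat_adjoint (W g) * W g) *\<^sub>v \<psi>"
      using g \<psi> by (intro assoc_mult_mat_vec[symmetric, of _ D D _ D]) auto
    finally have "cnj (\<tau> g) * (\<tau> g * cinner \<psi> \<psi>) = cinner \<psi> \<psi>"
      using g \<psi> by (simp add: e W_unitary cinner_smult_left cinner_smult_right)
    then have "\<tau> g * cnj (\<tau> g) = 1" using nz by (simp add: field_simps)
    then have "(cmod (\<tau> g))\<^sup>2 = 1" using complex_norm_square[of "\<tau> g"] by (metis of_real_eq_1_iff)
    then show ?thesis by (simp add: power2_eq_1_iff) (use norm_ge_zero[of "\<tau> g"] in linarith)
  qed
  moreover have "\<tau> g * \<tau> h = \<beta> g h * \<tau> (g \<otimes> h)" if g: "g \<in> M" and h: "h \<in> M" for g h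
  proof (rule inj)
    have "(\<tau> g * \<tau> h) \<cdot>\<^sub>v \<psi> = \<tau> h \<cdot>\<^sub>v (W g *\<^sub>v \<psi>)"
      using e[OF g] by (simp add: smult_smult_assoc mult.commute)
    also have "\<dots> = W g *\<^sub>v (W h *\<^sub>v \<psi>)"
      using e[OF h] g \<psi> by (simp add: mult_mat_vec[of _ D D])
    also have "\<dots> = (W g * W h) *\<^sub>v \<psi>"
      using g h \<psi> by (intro assoc_mult_mat_vec[symmetric, of _ D D _ D]) auto
    also have "\<dots> = \<beta> g h \<cdot>\<^sub>v (W (g \<otimes> h) *\<^sub>v \<psi>)"
      using g h \<psi> W_carrier[of "g \<otimes> h"] by (simp add: W_mult smult_mat_mult_vec[of _ D D])
    also have "\<dots> = (\<beta> g h * \<tau> (g \<otimes> h)) \<cdot>\<^sub>v \<psi>"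
      using e[of "g \<otimes> h"] g h by (simp add: smult_smult_assoc)
    finally show "(\<tau> g * \<tau> h) \<cdot>\<^sub>v \<psi> = (\<beta> g h * \<tau> (g \<otimes> h)) \<cdot>\<^sub>v \<psi>" .
  qed
  ultimately show ?thesis using M by (auto simp: stab_char_def)
qed

text \<open>The error x carries the code with eigenvalues \<open>\<tau>\<close> to the one with
  these eigenvalues, so the character \<open>chi g x\<close> of g in M is the syndrome of x.\<close>

lemma stab_char_translate:
  assumes "stab_char M \<tau>" "x \<in> carrier G"
  shows "stab_char M (\<lambda>g. \<tau> g * chi g x)"
proof -
  note D = stab_charD[OF assms(1)]
  interpret M: subgroup M G by (rule D)
  show ?thesis unfolding stab_char_def
  proof (intro conjI ballI)
    show "cmod (\<tau> g * chi g x) = 1" if "g \<in> M" for g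
      using that D(5) assms(2) by (simp add: norm_mult chi_unit)
    show "\<tau> g * chi g x * (\<tau> h * chi h x) = \<beta> g h * (\<tau> (g \<otimes> h) * chi (g \<otimes> h) x)"
      if "g \<in> M" "h \<in> M" for g h
    proof -
      have "\<tau> g * chi g x * (\<tau> h * chi h x) = (\<tau> g * \<tau> h) * (chi g x * chi h x)" by simp
      also have "\<dots> = (\<beta> g h * \<tau> (g \<otimes> h)) * chi (g \<otimes> h) x"
        using that D(8) assms(2) by (simp add: chi_mult_left)
      finally show ?thesis by simp
    qed
  qed (rule D)
qed

lemma stab_proj_carrier [simp]: "stab_proj M \<tau> \<in> carrier_mat D D"
  by (simp add: stab_proj_def)

lemma stab_proj_cong: "(\<And>g. g \<in> M \<Longrightarrow> \<tau> g = \<sigma> g) \<Longrightarrow> stab_proj M \<tau> = stab_proj M \<sigma>"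
  unfolding stab_proj_def by (simp cong: msum_cong)

text \<open>Multiplication by \<open>W h\<close> permutes the summands of the average, and the phase
  it creates is absorbed by the product rule of \<open>\<tau>\<close>.\<close>

lemma W_stab_proj:
  assumes "stab_char M \<tau>" "h \<in> M"
  shows "W h * stab_proj M \<tau> = \<tau> h \<cdot>\<^sub>m stab_proj M \<tau>"
    and "stab_proj M \<tau> * W h = \<tau> h \<cdot>\<^sub>m stab_proj M \<tau>"
proof -
  note D = stab_charD[OF assms(1)]
  interpret M: subgroup M G by (rule D)
  define F where "F g = cnj (\<tau> g) \<cdot>\<^sub>m W g" for g
  have F: "F g \<in> carrier_mat D D" if "g \<in> M" for g using that by (simp add: F_def)
  have Wh: "W h \<in> carrier_mat D D" using assms(2) by simp
  have bij: "bij_betw (\<lambda>g. h \<otimes> g) M M" by (rule subgroup_translate_bij[OF D(1) assms(2)])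
  \<comment> \<open>Applied with \<open>b\<close> equal to \<open>\<beta> h g\<close> for the left
    product and to \<open>\<beta> g h\<close> for the right one: the scalars commute, so both phases
    satisfy the same product rule.\<close>
  have key: "cnj (\<tau> g) * b = \<tau> h * cnj (\<tau> (h \<otimes> g))"
    if g: "g \<in> M" and b: "\<tau> h * \<tau> g = b * \<tau> (h \<otimes> g)" for g b
  proof -
    have "cnj (\<tau> g) * b = cnj (\<tau> g) * b * (\<tau> (h \<otimes> g) * cnj (\<tau> (h \<otimes> g)))"
      using D(7)[of "h \<otimes> g"] g assms(2) by simp
    also have "\<dots> = (b * \<tau> (h \<otimes> g)) * cnj (\<tau> g) * cnj (\<tau> (h \<otimes> g))" by simp
    also have "\<dots> = (\<tau> g * cnj (\<tau> g)) * (\<tau> h * cnj (\<tau> (h \<otimes> g)))"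
      unfolding b[symmetric] by simp
    finally show ?thesis using D(7)[OF g] by simp
  qed
  have l: "W h * F g = \<tau> h \<cdot>\<^sub>m F (h \<otimes> g)" if g: "g \<in> M" for g
    using g assms(2) key[OF g D(8)[OF assms(2) g]]
    by (simp add: F_def square_mat_simps W_mult smult_smult_mat)
  have r: "F g * W h = \<tau> h \<cdot>\<^sub>m F (h \<otimes> g)" if g: "g \<in> M" for g
  proof -
    have "\<tau> h * \<tau> g = \<beta> g h * \<tau> (h \<otimes> g)"
      using D(8)[OF g assms(2)] g assms(2) by (simp add: mult.commute m_comm)
    from key[OF g this] show ?thesis
      using g assms(2) by (simp add: F_def square_mat_simps W_mult smult_smult_mat m_comm[of h g])
  qed
  have sum: "msum D M (\<lambda>g. \<tau> h \<cdot>\<^sub>m F (h \<otimes> g)) = \<tau> h \<cdot>\<^sub>m msum D M F"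
    using msum_reindex_bij[OF bij, of D "\<lambda>g. \<tau> h \<cdot>\<^sub>m F g"] smult_msum[of M F D "\<tau> h"] F by simp
  have S: "stab_proj M \<tau> = (1 / of_nat (card M)) \<cdot>\<^sub>m msum D M F"
    by (simp add: stab_proj_def F_def[abs_def])
  have "W h * msum D M F = \<tau> h \<cdot>\<^sub>m msum D M F"
    using mult_msum[of "W h" D M F, OF Wh F] sum msum_cong[of M M "\<lambda>g. W h * F g" "\<lambda>g. \<tau> h \<cdot>\<^sub>m F (h \<otimes> g)" D, OF refl l] by simp
  then show "W h * stab_proj M \<tau> = \<tau> h \<cdot>\<^sub>m stab_proj M \<tau>"
    unfolding S by (simp add: square_mat_simps Wh smult_smult_mat)
  have "msum D M F * W h = \<tau> h \<cdot>\<^sub>m msum D M F"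
    using msum_mult[of "W h" D M F, OF Wh F] sum msum_cong[of M M "\<lambda>g. F g * W h" "\<lambda>g. \<tau> h \<cdot>\<^sub>m F (h \<otimes> g)" D, OF refl r] by simp
  then show "stab_proj M \<tau> * W h = \<tau> h \<cdot>\<^sub>m stab_proj M \<tau>"
    unfolding S by (simp add: square_mat_simps Wh smult_smult_mat)
qed

text \<open>For equal characters each summand of the first factor fixes the second. If they differ
  at h, a \<open>W h\<close> inserted between the factors is absorbed as \<open>\<tau> h\<close> on
  one side and as \<open>\<sigma> h\<close> on the other, so the product is zero.\<close>

lemma stab_proj_mult:
  assumes "stab_char M \<tau>" "stab_char M \<sigma>"
  shows "stab_proj M \<tau> * stab_proj M \<sigma> = (if \<forall>g\<in>M. \<tau> g = \<sigma> g then stab_proj M \<tau> else 0\<^sub>m D D)"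
proof (cases "\<forall>g\<in>M. \<tau> g = \<sigma> g")
  case True
  note D = stab_charD[OF assms(1)]
  let ?P = "stab_proj M \<tau>"
  have eq: "stab_proj M \<sigma> = ?P" by (rule stab_proj_cong) (use True in auto)
  have c: "cnj (\<tau> g) \<cdot>\<^sub>m W g \<in> carrier_mat D D" if "g \<in> M" for g using that D(2) by auto
  have "msum D M (\<lambda>g. cnj (\<tau> g) \<cdot>\<^sub>m W g) * ?P = msum D M (\<lambda>g. cnj (\<tau> g) \<cdot>\<^sub>m W g * ?P)"
    by (rule msum_mult[OF stab_proj_carrier c])
  also have "\<dots> = msum D M (\<lambda>g. 1 \<cdot>\<^sub>m ?P)"
  proof (rule msum_cong[OF refl])
    fix g assume g: "g \<in> M"
    have "cnj (\<tau> g) \<cdot>\<^sub>m W g * ?P = (\<tau> g * cnj (\<tau> g)) \<cdot>\<^sub>m ?P"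
      using g D(2) by (simp add: square_mat_simps subset_iff W_stab_proj[OF assms(1)] smult_smult_mat mult.commute)
    then show "cnj (\<tau> g) \<cdot>\<^sub>m W g * ?P = 1 \<cdot>\<^sub>m ?P" using D(7)[OF g] by simp
  qed
  also have "\<dots> = of_nat (card M) \<cdot>\<^sub>m ?P" by (subst msum_smult_const) simp_all
  finally have "?P * ?P = (1 / of_nat (card M)) \<cdot>\<^sub>m (of_nat (card M) \<cdot>\<^sub>m ?P)"
    by (subst (1) stab_proj_def) (simp add: square_mat_simps)
  then show ?thesis using True D(4) by (simp add: eq smult_smult_mat)
next
  case False
  then obtain h where h: "h \<in> M" "\<tau> h \<noteq> \<sigma> h" by blast
  let ?A = "stab_proj M \<tau> * stab_proj M \<sigma>"
  have Wh: "W h \<in> carrier_mat D D" using h stab_charD(2)[OF assms(1)] by auto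
  have A: "?A \<in> carrier_mat D D" by (simp add: square_mat_simps)
  have "\<tau> h \<cdot>\<^sub>m ?A = stab_proj M \<tau> * W h * stab_proj M \<sigma>"
    by (simp add: W_stab_proj(2)[OF assms(1) h(1)] square_mat_simps)
  also have "\<dots> = \<sigma> h \<cdot>\<^sub>m ?A"
    by (simp add: square_mat_simps Wh W_stab_proj(1)[OF assms(2) h(1)])
  finally have eq: "\<tau> h \<cdot>\<^sub>m ?A = \<sigma> h \<cdot>\<^sub>m ?A" .
  have "?A = 0\<^sub>m D D"
  proof (rule eq_matI)
    fix i j assume "i < dim_row (0\<^sub>m D D :: complex mat)" "j < dim_col (0\<^sub>m D D :: complex mat)"
    then have ij: "i < D" "j < D" by auto
    have "(\<tau> h \<cdot>\<^sub>m ?A) $$ (i, j) = (\<sigma> h \<cdot>\<^sub>m ?A) $$ (i, j)" using eq by simp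
    then have "\<tau> h * ?A $$ (i, j) = \<sigma> h * ?A $$ (i, j)"
      using ij carrier_matD[OF A] by (simp del: index_mult_mat)
    then show "?A $$ (i, j) = 0\<^sub>m D D $$ (i, j)" using h(2) ij by (simp del: index_mult_mat)
  qed (use carrier_matD[OF A] in simp_all)
  then show ?thesis using h by auto
qed

lemma stab_proj_conj:
  assumes "stab_char M \<tau>" "x \<in> carrier G"
  shows "W x * stab_proj M \<tau> * mat_adjoint (W x) = stab_proj M (\<lambda>g. \<tau> g * chi g x)"
proof -
  note D = stab_charD[OF assms(1)]
  have c: "cnj (\<tau> g) \<cdot>\<^sub>m W g \<in> carrier_mat D D" if "g \<in> M" for g using that D(2) by auto
  have cx: "W x \<in> carrier_mat D D" "mat_adjoint (W x) \<in> carrier_mat D D" using assms(2) by simp_all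
  have c': "W x * (cnj (\<tau> g) \<cdot>\<^sub>m W g) \<in> carrier_mat D D" if "g \<in> M" for g
    using c[OF that] cx by (simp add: square_mat_simps)
  have "W x * msum D M (\<lambda>g. cnj (\<tau> g) \<cdot>\<^sub>m W g) * mat_adjoint (W x) =
      msum D M (\<lambda>g. W x * (cnj (\<tau> g) \<cdot>\<^sub>m W g) * mat_adjoint (W x))"
    by (simp add: mult_msum[OF cx(1) c] msum_mult[OF cx(2) c'])
  also have "\<dots> = msum D M (\<lambda>g. cnj (\<tau> g * chi g x) \<cdot>\<^sub>m W g)"
  proof (rule msum_cong[OF refl])
    fix g assume "g \<in> M"
    then have g: "g \<in> carrier G" using D(2) by auto
    have "W x * (cnj (\<tau> g) \<cdot>\<^sub>m W g) * mat_adjoint (W x) = cnj (\<tau> g) \<cdot>\<^sub>m (W x * W g * mat_adjoint (W x))"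
      using g assms(2) by (simp add: square_mat_simps)
    then show "W x * (cnj (\<tau> g) \<cdot>\<^sub>m W g) * mat_adjoint (W x) = cnj (\<tau> g * chi g x) \<cdot>\<^sub>m W g"
      using g assms(2) by (simp add: W_conj smult_smult_mat cnj_chi)
  qed
  finally show ?thesis unfolding stab_proj_def by (simp add: square_mat_simps cx)
qed

text \<open>Only \<open>W \<one>\<close> has a nonzero trace, and for x outside M no product of x
  with an element of M is the identity. Besides the dimension of the code this gives the overlaps of
  the error vectors in the purified output.\<close>

lemma mtrace_W_stab_proj:
  assumes "stab_char M \<tau>" "x \<in> carrier G"
  shows "mtrace (W x * stab_proj M \<tau>) =
    (if x \<in> M then \<tau> x * of_nat D / of_nat (card M) else 0)"
proof -
  note D = stab_charD[OF assms(1)]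
  interpret M: subgroup M G by (rule D)
  have c: "cnj (\<tau> g) \<cdot>\<^sub>m W g \<in> carrier_mat D D" if "g \<in> M" for g using that by simp
  have tr: "mtrace (stab_proj M \<tau>) = of_nat D / of_nat (card M)"
  proof -
    have "mtrace (msum D M (\<lambda>g. cnj (\<tau> g) \<cdot>\<^sub>m W g)) = (\<Sum>g\<in>M. mtrace (cnj (\<tau> g) \<cdot>\<^sub>m W g))"
      by (rule mtrace_msum[OF c])
    also have "\<dots> = (\<Sum>g\<in>M. if g = \<one> then of_nat D else 0)"
      by (intro sum.cong refl) (auto simp: mtrace_smult[OF W_carrier] W_trace W_one D(9))
    finally show ?thesis using D(3) by (simp add: stab_proj_def mtrace_smult[OF msum_carrier])
  qed
  show ?thesis
  proof (cases "x \<in> M")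
    case True
    then show ?thesis by (simp add: W_stab_proj(1)[OF assms(1)] mtrace_smult[OF stab_proj_carrier] tr)
  next
    case False
    have Wx: "W x \<in> carrier_mat D D" using assms by simp
    have c': "W x * (cnj (\<tau> g) \<cdot>\<^sub>m W g) \<in> carrier_mat D D" if "g \<in> M" for g
      using c[OF that] Wx by (simp add: square_mat_simps)
    have "mtrace (W x * (cnj (\<tau> g) \<cdot>\<^sub>m W g)) = 0" if g: "g \<in> M" for g
    proof -
      have "x \<otimes> g \<noteq> \<one>"
      proof
        assume "x \<otimes> g = \<one>"
        then have "x = inv g" using assms(2) g by (metis inv_equality inv_inv M.mem_carrier inv_closed)
        then show False using False g by simp
      qed
      then show ?thesis using assms(2) g
        by (simp add: square_mat_simps W_mult smult_smult_mat mtrace_smult[OF W_carrier] W_trace)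
    qed
    then have "mtrace (W x * msum D M (\<lambda>g. cnj (\<tau> g) \<cdot>\<^sub>m W g)) = 0"
      using mult_msum[of "W x" D M "\<lambda>g. cnj (\<tau> g) \<cdot>\<^sub>m W g", OF Wx c]
        mtrace_msum[of M "\<lambda>g. W x * (cnj (\<tau> g) \<cdot>\<^sub>m W g)" D, OF c'] by simp
    then have "mtrace (W x * stab_proj M \<tau>) = 0"
      unfolding stab_proj_def using Wx
      by (simp add: square_mat_simps mtrace_smult[of _ D])
    then show ?thesis using False by simp
  qed
qed

lemma mtrace_stab_proj:
  assumes "stab_char M \<tau>"
  shows "mtrace (stab_proj M \<tau>) = of_nat D / of_nat (card M)"
  using mtrace_W_stab_proj[OF assms one_closed] stab_charD(9)[OF assms]
    subgroup.one_closed[OF stab_charD(1)[OF assms]]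
  by (simp add: W_one square_mat_simps)

text \<open>Inversion permutes M and exchanges the summands with their adjoints; the phase in
  \<open>W_inv\<close> is exactly \<open>\<tau> g * \<tau> (inv g)\<close>.\<close>

lemma stab_proj_adjoint:
  assumes "stab_char M \<tau>"
  shows "mat_adjoint (stab_proj M \<tau>) = stab_proj M \<tau>"
proof -
  note D = stab_charD[OF assms(1)]
  interpret M: subgroup M G by (rule D)
  define F where "F g = cnj (\<tau> g) \<cdot>\<^sub>m W g" for g
  have F: "F g \<in> carrier_mat D D" if "g \<in> M" for g using that by (simp add: F_def)
  have bij: "bij_betw (\<lambda>g. inv g) M M"
    by (rule bij_betw_byWitness[where f' = "\<lambda>g. inv g"]) auto
  have "mat_adjoint (msum D M F) = msum D M (\<lambda>g. mat_adjoint (F g))" by (rule mat_adjoint_msum[OF F])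
  also have "\<dots> = msum D M (\<lambda>g. F (inv g))"
  proof (rule msum_cong[OF refl])
    fix g assume g: "g \<in> M"
    have "\<tau> g * \<tau> (inv g) = \<beta> g (inv g)"
      using D(8)[OF g, of "inv g"] g D(9) by simp
    then have "cnj (\<tau> (inv g)) * \<beta> g (inv g) = \<tau> g * (\<tau> (inv g) * cnj (\<tau> (inv g)))" by simp
    then have "cnj (\<tau> (inv g)) * \<beta> g (inv g) = \<tau> g" using D(7)[of "inv g"] g by simp
    then show "mat_adjoint (F g) = F (inv g)"
      using g by (simp add: F_def mat_adjoint_smult W_inv smult_smult_mat)
  qed
  also have "\<dots> = msum D M F" by (rule msum_reindex_bij[OF bij])
  finally show ?thesis by (simp add: stab_proj_def F_def[abs_def] mat_adjoint_smult)
qed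

text \<open>After exchanging the sums, orthogonality of the characters \<open>chi\<close> removes
  every g except the identity. This becomes the trace preservation of the recovery map; the factor
  is \<open>card (perp M)\<close>, the number of errors per syndrome.\<close>

lemma sum_stab_proj_translates:
  assumes "stab_char M \<tau>"
  shows "msum D (carrier G) (\<lambda>x. stab_proj M (\<lambda>g. \<tau> g * chi g x)) =
    (of_nat (card (carrier G)) / of_nat (card M)) \<cdot>\<^sub>m 1\<^sub>m D"
proof -
  note D = stab_charD[OF assms(1)]
  interpret M: subgroup M G by (rule D)
  have c: "cnj (\<tau> g * chi g x) \<cdot>\<^sub>m W g \<in> carrier_mat D D" if "g \<in> M" for g x using that by simp
  have "msum D (carrier G) (\<lambda>x. msum D M (\<lambda>g. cnj (\<tau> g * chi g x) \<cdot>\<^sub>m W g)) =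
      msum D M (\<lambda>g. msum D (carrier G) (\<lambda>x. cnj (\<tau> g * chi g x) \<cdot>\<^sub>m W g))"
    by (rule msum_swap)
  also have "\<dots> = msum D M (\<lambda>g. (if g = \<one> then of_nat (card (carrier G)) else 0) \<cdot>\<^sub>m W g)"
  proof (rule msum_cong[OF refl])
    fix g assume g: "g \<in> M"
    have "msum D (carrier G) (\<lambda>x. cnj (\<tau> g * chi g x) \<cdot>\<^sub>m W g) = (\<Sum>x\<in>carrier G. cnj (\<tau> g * chi g x)) \<cdot>\<^sub>m W g"
      using g by (intro msum_smult_const) simp
    also have "(\<Sum>x\<in>carrier G. cnj (\<tau> g * chi g x)) = cnj (\<tau> g) * (\<Sum>x\<in>carrier G. chi x g)"
      using g by (simp add: sum_distrib_left cnj_chi)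
    also have "\<dots> = (if g = \<one> then of_nat (card (carrier G)) else 0)"
      using g D(9) by (simp add: chi_sum_left)
    finally show "msum D (carrier G) (\<lambda>x. cnj (\<tau> g * chi g x) \<cdot>\<^sub>m W g) =
      (if g = \<one> then of_nat (card (carrier G)) else 0) \<cdot>\<^sub>m W g" .
  qed
  also have "\<dots> = (if \<one> = \<one> then of_nat (card (carrier G)) else 0) \<cdot>\<^sub>m W \<one>"
    by (rule msum_delta[OF D(3) M.one_closed]) (auto intro!: eq_matI simp: W_one dest: W_carrier[OF M.mem_carrier])
  finally show ?thesis
    unfolding stab_proj_def by (subst smult_msum[symmetric]) (simp_all add: W_one smult_smult_mat)
qed

end

section \<open>Extending isotropic subgroups\<close>

lemma mult_vec_linear_combination:
  fixes A :: "complex mat"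
  assumes "A \<in> carrier_mat N N" "\<And>j. j \<in> J \<Longrightarrow> f j \<in> carrier_vec N"
  shows "A *\<^sub>v vec N (\<lambda>i. \<Sum>j\<in>J. c j * f j $ i) = vec N (\<lambda>i. \<Sum>j\<in>J. c j * (A *\<^sub>v f j) $ i)"
proof (rule eq_vecI)
  fix i assume "i < dim_vec (vec N (\<lambda>i. \<Sum>j\<in>J. c j * (A *\<^sub>v f j) $ i))"
  then have i: "i < N" by simp
  have "(A *\<^sub>v vec N (\<lambda>i. \<Sum>j\<in>J. c j * f j $ i)) $ i = (\<Sum>k<N. \<Sum>j\<in>J. c j * (A $$ (i, k) * f j $ k))"
    by (subst mult_vec_index_sum[OF assms(1) _ i]) (auto simp: sum_distrib_left mult.left_commute intro!: sum.cong)
  also have "\<dots> = (\<Sum>j\<in>J. \<Sum>k<N. c j * (A $$ (i, k) * f j $ k))" by (rule sum.swap)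
  also have "\<dots> = (\<Sum>j\<in>J. c j * (A *\<^sub>v f j) $ i)"
    unfolding sum_distrib_left[symmetric]
    by (intro sum.cong refl) (simp only: mult_vec_index_sum[OF assms(1) assms(2) i])
  finally show "(A *\<^sub>v vec N (\<lambda>i. \<Sum>j\<in>J. c j * f j $ i)) $ i = vec N (\<lambda>i. \<Sum>j\<in>J. c j * (A *\<^sub>v f j) $ i) $ i"
    using i by simp
qed (use assms(1) in simp)

context weyl_system
begin

lemma perpD: "w \<in> perp M \<Longrightarrow> x \<in> M \<Longrightarrow> chi x w = 1" and perp_mem_carrier: "w \<in> perp M \<Longrightarrow> w \<in> carrier G"
  by (simp_all add: perp_def)

lemma d_gt_1: "d > 1" using prime_d by (rule prime_gt_1_nat)

lemma pow_mod_d: "v \<in> carrier G \<Longrightarrow> v [^] (k mod d) = v [^] (k :: nat)"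
proof -
  assume v: "v \<in> carrier G"
  have "v [^] k = v [^] (d * (k div d) + k mod d)" by simp
  also have "\<dots> = v [^] (d * (k div d)) \<otimes> v [^] (k mod d)" using v by (simp only: nat_pow_mult)
  also have "v [^] (d * (k div d)) = \<one>" using v nat_pow_pow[OF v, of d "k div d"] by (simp add: exponent)
  finally show ?thesis using v by simp
qed

lemma subgroup_nat_pow_closed:
  assumes "subgroup H G" "v \<in> H" shows "v [^] (i :: nat) \<in> H"
proof (induction i)
  case 0
  show ?case using subgroup.one_closed[OF assms(1)] by simp
next
  case (Suc i)
  show ?case using subgroup.m_closed[OF assms(1) Suc assms(2)] by simp
qed

text \<open>The subgroup generated by M and v. Exponents below d suffice because the group has
  exponent d, and bounding them makes the size estimate immediate.\<close>

definition adjoin :: "'a set \<Rightarrow> 'a \<Rightarrow> 'a set" where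
  "adjoin M v = (\<lambda>(g, i). g \<otimes> v [^] (i :: nat)) ` (M \<times> {..<d})"

lemma adjoin_iff:
  assumes "M \<subseteq> carrier G" "v \<in> carrier G"
  shows "x \<in> adjoin M v \<longleftrightarrow> (\<exists>g\<in>M. \<exists>i :: nat. x = g \<otimes> v [^] i)"
proof
  assume "\<exists>g\<in>M. \<exists>i :: nat. x = g \<otimes> v [^] i"
  then obtain g i where "g \<in> M" "x = g \<otimes> v [^] (i mod d)" using pow_mod_d[OF assms(2)] by metis
  moreover have "i mod d < d" using d_gt_1 by simp
  ultimately show "x \<in> adjoin M v" unfolding adjoin_def by (auto intro!: image_eqI[of _ _ "(g, i mod d)"])
qed (auto simp: adjoin_def)

lemma card_adjoin: "finite M \<Longrightarrow> card (adjoin M v) \<le> d * card M"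
  unfolding adjoin_def by (rule order.trans[OF card_image_le]) (simp_all add: card_cartesian_product)

lemma
  assumes M: "subgroup M G" and v: "v \<in> carrier G"
  shows subgroup_adjoin: "subgroup (adjoin M v) G"
    and subset_adjoin: "M \<subseteq> adjoin M v"
    and mem_adjoin: "v \<in> adjoin M v"
proof -
  interpret M: subgroup M G by fact
  note iff = adjoin_iff[OF M.subset v]
  show sub: "M \<subseteq> adjoin M v"
  proof
    fix g assume "g \<in> M"
    then show "g \<in> adjoin M v" unfolding iff by (intro bexI[of _ g] exI[of _ 0]) auto
  qed
  show "v \<in> adjoin M v" unfolding iff using v by (intro bexI[of _ \<one>] exI[of _ 1]) auto
  show "subgroup (adjoin M v) G"
  proof (rule subgroupI)
    show "adjoin M v \<subseteq> carrier G" using v by (auto simp: adjoin_def)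
    show "adjoin M v \<noteq> {}" using sub M.one_closed by blast
    show "inv a \<in> adjoin M v" if "a \<in> adjoin M v" for a
    proof -
      from that obtain g and i :: nat where g: "g \<in> M" and a: "a = g \<otimes> v [^] i" unfolding iff by blast
      \<comment> \<open>The exponent (d - 1) * i is a nonnegative substitute for - i.\<close>
      have "i + (d - 1) * i = d * i" using d_gt_1 by (cases d) auto
      then have "v [^] i \<otimes> v [^] ((d - 1) * i) = v [^] (d * i)" using v by (simp only: nat_pow_mult)
      also have "\<dots> = \<one>" using v nat_pow_pow[OF v, of d i] by (simp add: exponent)
      finally have p: "v [^] i \<otimes> v [^] ((d - 1) * i) = \<one>" .
      have "inv (v [^] i) = v [^] ((d - 1) * i)"
        using p m_comm[of "v [^] i" "v [^] ((d - 1) * i)"] v by (intro inv_equality) simp_all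
      then have "inv a = inv g \<otimes> v [^] ((d - 1) * i)" using g v by (simp add: a inv_mult)
      then show ?thesis unfolding iff using g by blast
    qed
    show "a \<otimes> b \<in> adjoin M v" if ab: "a \<in> adjoin M v" "b \<in> adjoin M v" for a b
    proof -
      from ab obtain g h and i j :: nat where g: "g \<in> M" "h \<in> M" and a: "a = g \<otimes> v [^] i" "b = h \<otimes> v [^] j"
        unfolding iff by blast
      have "a \<otimes> b = (g \<otimes> h) \<otimes> (v [^] i \<otimes> v [^] j)" using g v by (simp add: a m_ac)
      then have "a \<otimes> b = (g \<otimes> h) \<otimes> v [^] (i + j)" using v by (simp add: nat_pow_mult)
      then show ?thesis unfolding iff using g by blast
    qed
  qed
qed

lemma perp_adjoin:
  assumes M: "subgroup M G" and v: "v \<in> carrier G"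
  shows "perp (adjoin M v) = {w \<in> perp M. chi v w = 1}"
proof
  show "perp (adjoin M v) \<subseteq> {w \<in> perp M. chi v w = 1}"
    using subset_adjoin[OF M v] mem_adjoin[OF M v] by (auto simp: perp_def)
  show "{w \<in> perp M. chi v w = 1} \<subseteq> perp (adjoin M v)"
  proof
    fix w assume w: "w \<in> {w \<in> perp M. chi v w = 1}"
    then have wc: "w \<in> carrier G" by (simp add: perp_def)
    have "chi (g \<otimes> v [^] i) w = 1" if g: "g \<in> M" for g and i :: nat
    proof -
      have "g \<in> carrier G" using g subgroup.subset[OF M] by blast
      then have "chi (g \<otimes> v [^] i) w = chi g w * chi v w ^ i"
        using wc v by (simp add: chi_mult_left chi_pow_left)
      then show ?thesis using w g by (simp add: perp_def)
    qed
    then show "w \<in> perp (adjoin M v)" using wc by (auto simp: perp_def adjoin_def)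
  qed
qed

text \<open>The form is alternating, \<open>chi v v\<close> being 1, so v commutes with its own
  powers, and it commutes with M as an element of the complement.\<close>

lemma adjoin_isotropic:
  assumes M: "subgroup M G" "M \<subseteq> perp M" and v: "v \<in> perp M"
  shows "adjoin M v \<subseteq> perp (adjoin M v)"
proof
  fix x assume x: "x \<in> adjoin M v"
  have vc: "v \<in> carrier G" by (rule perp_mem_carrier[OF v])
  interpret P: subgroup "perp M" G by (rule subgroup_perp[OF subgroup.subset[OF M(1)]])
  from x obtain g and i :: nat where g: "g \<in> M" and xg: "x = g \<otimes> v [^] i"
    unfolding adjoin_iff[OF subgroup.subset[OF M(1)] vc] by blast
  have gc: "g \<in> carrier G" using g subgroup.subset[OF M(1)] by blast
  have vp: "v [^] i \<in> perp M" by (rule subgroup_nat_pow_closed[OF P.subgroup_axioms v])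
  have "chi g v = 1" by (rule perpD[OF v g])
  then have vg: "chi v g = 1" by (rule chi_swap_eq_1[THEN iffD1])
  have "chi v v ^ i = 1" using \<beta>_nonzero[OF vc vc] by (simp add: chi_def)
  then have "chi (v [^] i) v = 1" using vc by (simp add: chi_pow_left)
  then have vv: "chi v (v [^] i) = 1" by (rule chi_swap_eq_1[THEN iffD1])
  have "chi v x = 1" unfolding xg using vg vv gc vc by (simp add: chi_mult_right)
  moreover have "x \<in> perp M" unfolding xg by (rule P.m_closed[OF subsetD[OF M(2) g] vp])
  ultimately show "x \<in> perp (adjoin M v)" unfolding perp_adjoin[OF M(1) vc] by simp
qed


(* A nontrivial character of perp M takes each of its d values equally often, and it is trivial on M. *)
lemma card_commuting_le:
  assumes M: "subgroup M G" "M \<subseteq> perp M" and w: "w \<in> perp M - M"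
  shows "d * card {v \<in> perp M - M. chi v w = 1} \<le> card (perp M - M)"
proof -
  have Mc: "M \<subseteq> carrier G" by (rule subgroup.subset[OF M(1)])
  interpret P: subgroup "perp M" G by (rule subgroup_perp[OF Mc])
  have wc: "w \<in> carrier G" using w perp_mem_carrier by blast
  define K where "K = {v \<in> perp M. chi v w = 1}"
  have fP: "finite (perp M)" by (rule finite_subset[OF perp_carrier fin])
  have MK: "M \<subseteq> K"
  proof
    fix g assume g: "g \<in> M"
    have "chi g w = 1" using w g perpD by blast
    then show "g \<in> K" using subsetD[OF M(2) g] by (simp add: K_def)
  qed
  have fK: "finite K" "K \<subseteq> perp M" using fP by (simp_all add: K_def)
  \<comment> \<open>As w is outside M, which equals its double complement, some element of
    \<open>perp M\<close> does not commute with w.\<close>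
  have "w \<notin> perp (perp M)" using w perp_perp[OF M(1)] by simp
  then obtain v0 where v0: "v0 \<in> perp M" "chi v0 w \<noteq> 1" using wc unfolding perp_def[of "perp M"] by blast
  have v0c: "v0 \<in> carrier G" by (rule P.mem_carrier[OF v0(1)])
  define z where "z = chi v0 w"
  have z: "z ^ d = 1" "z \<noteq> 1" using chi_root[OF v0c wc] v0(2) by (simp_all add: z_def)
  have z0: "z \<noteq> 0" using chi_nonzero[OF v0c wc] by (simp add: z_def)
  \<comment> \<open>Here primality enters: z is a d-th root of unity other than 1, and a power k
    with 0 < k < d and \<open>z ^ k = 1\<close> would, by Bezout for k and d, give z = 1.\<close>
  have inj_aux: "i = j" if ij: "i \<le> j" "j < d" "z ^ i = z ^ j" for i j
  proof (rule ccontr)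
    assume "i \<noteq> j"
    define k where "k = j - i"
    have k: "0 < k" "k < d" using ij \<open>i \<noteq> j\<close> by (auto simp: k_def)
    have "z ^ i * z ^ k = z ^ j" using ij(1) by (simp add: k_def power_add[symmetric])
    then have "z ^ i * z ^ k = z ^ i" using ij(3) by simp
    then have zk: "z ^ k = 1" using z0 by simp
    have "coprime d k" using k by (intro prime_imp_coprime[OF prime_d] nat_dvd_not_less)
    then have "gcd k d = 1" by (simp add: gcd.commute)
    then obtain a b where ab: "k * a = d * b + 1" using bezout_nat[of k d] k(1) by auto
    have "z = z ^ (d * b + 1)" by (simp add: power_add power_mult z(1))
    also have "\<dots> = 1" unfolding ab[symmetric] by (simp add: power_mult zk)
    finally show False using z(2) by simp
  qed
  \<comment> \<open>The d translates of the kernel K by powers of \<open>v0\<close> are disjoint,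
    since the character takes the value \<open>z ^ i\<close> on the i-th of them.\<close>
  have "inj_on (\<lambda>(i, v). v0 [^] (i :: nat) \<otimes> v) ({..<d} \<times> K)"
  proof (rule inj_onI, clarify)
    fix i v j u
    assume iv: "i < d" "v \<in> K" "j < d" "u \<in> K" and eq: "v0 [^] (i :: nat) \<otimes> v = v0 [^] (j :: nat) \<otimes> u"
    have uv: "u \<in> carrier G" "v \<in> carrier G" "chi u w = 1" "chi v w = 1"
      using iv(2,4) P.mem_carrier by (simp_all add: K_def)
    have "chi (v0 [^] i \<otimes> v) w = z ^ i" "chi (v0 [^] j \<otimes> u) w = z ^ j"
      unfolding chi_mult_left[OF nat_pow_closed[OF v0c] uv(1) wc] chi_mult_left[OF nat_pow_closed[OF v0c] uv(2) wc]
        chi_pow_left[OF v0c wc] uv z_def by simp_all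
    then have "z ^ i = z ^ j" using eq by simp
    then have "i = j" using inj_aux[of i j] inj_aux[of j i] iv(1,3) by (cases "i \<le> j") simp_all
    then show "i = j \<and> v = u" using eq uv(1,2) nat_pow_closed[OF v0c, of j] by simp
  qed
  then have "card ({..<d} \<times> K) = card ((\<lambda>(i, v). v0 [^] (i :: nat) \<otimes> v) ` ({..<d} \<times> K))"
    by (rule card_image[symmetric])
  also have "\<dots> \<le> card (perp M)"
  proof (rule card_mono[OF fP], clarify)
    fix i :: nat and v assume "v \<in> K"
    then have "v \<in> perp M" using fK(2) by blast
    then show "v0 [^] i \<otimes> v \<in> perp M"
      by (intro P.m_closed subgroup_nat_pow_closed[OF P.subgroup_axioms v0(1)])
  qed
  finally have dK: "d * card K \<le> card (perp M)" by (simp add: card_cartesian_product)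
  have "{v \<in> perp M - M. chi v w = 1} = K - M" unfolding K_def by blast
  then have "card {v \<in> perp M - M. chi v w = 1} = card K - card M"
    using card_Diff_subset[OF finite_subset[OF MK fK(1)] MK] by simp
  \<comment> \<open>Removing M favours the inequality: d * card M is subtracted on the left and only
    card M on the right. So restricting v to elements outside M costs nothing.\<close>
  then have "d * card {v \<in> perp M - M. chi v w = 1} = d * card K - d * card M" by (simp add: diff_mult_distrib2)
  also have "\<dots> \<le> card (perp M) - card M"
  proof -
    have "card M \<le> d * card M" using d_gt_1 by simp
    then show ?thesis using dK by linarith
  qed
  also have "\<dots> = card (perp M - M)"
    using card_Diff_subset[OF finite_subset[OF M(2) fP] M(2)] by simp
  finally show ?thesis .
qed

text \<open>The first-moment method with arbitrary nonnegative weights: the average of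
  \<open>F v\<close> over v in \<open>perp M - M\<close> is at most 1/d of the whole weight, and
  some v does no worse than the average. The weights are left free so that they can encode the error
  statistics later.\<close>

lemma isotropic_extension_step:
  fixes c :: "'a \<Rightarrow> real"
  assumes M: "subgroup M G" "M \<subseteq> perp M" "M \<noteq> perp M"
    and c: "\<And>w. w \<in> carrier G \<Longrightarrow> c w \<ge> 0"
  shows "\<exists>M'. subgroup M' G \<and> M \<subseteq> M' \<and> M' \<subseteq> perp M' \<and> card M' \<le> d * card M \<and>
    real d * (\<Sum>w\<in>perp M' - M'. c w) \<le> (\<Sum>w\<in>perp M - M. c w)"
proof -
  define S where "S = perp M - M"
  define F where "F v = (\<Sum>w\<in>{w\<in>S. chi v w = 1}. c w)" for v
  have Mc: "M \<subseteq> carrier G" by (rule subgroup.subset[OF M(1)])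
  have Sc: "S \<subseteq> carrier G" using perp_carrier by (auto simp: S_def)
  have fS: "finite S" by (rule finite_subset[OF Sc fin])
  have Sne: "S \<noteq> {}" using M by (auto simp: S_def)
  \<comment> \<open>If every v were worse than the average, summing over v and exchanging the two
    sums would contradict \<open>card_commuting_le\<close> for some w.\<close>
  have "\<exists>v\<in>S. real d * F v \<le> sum c S"
  proof (rule ccontr)
    assume "\<not> ?thesis"
    then have "\<And>v. v \<in> S \<Longrightarrow> sum c S < real d * F v" by force
    then have "(\<Sum>v\<in>S. sum c S) < (\<Sum>v\<in>S. real d * F v)" using fS Sne by (intro sum_strict_mono) auto
    also have "\<dots> = (\<Sum>v\<in>S. \<Sum>w\<in>S. if chi v w = 1 then real d * c w else 0)"
      unfolding F_def sum_distrib_left by (rule sum.cong[OF refl]) (simp only: sum.inter_filter[OF fS])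
    also have "\<dots> = (\<Sum>w\<in>S. \<Sum>v\<in>S. if chi v w = 1 then real d * c w else 0)" by (rule sum.swap)
    also have "\<dots> = (\<Sum>w\<in>S. real (d * card {v\<in>S. chi v w = 1}) * c w)"
    proof (rule sum.cong[OF refl])
      fix w
      show "(\<Sum>v\<in>S. if chi v w = 1 then real d * c w else 0) = real (d * card {v\<in>S. chi v w = 1}) * c w"
        unfolding sum.inter_filter[OF fS, symmetric] by simp
    qed
    also have "\<dots> \<le> (\<Sum>w\<in>S. real (card S) * c w)"
    proof (rule sum_mono)
      fix w assume w: "w \<in> S"
      have "d * card {v \<in> S. chi v w = 1} \<le> card S"
        using card_commuting_le[OF M(1,2), of w] w by (simp add: S_def)
      then have "real (d * card {v\<in>S. chi v w = 1}) \<le> real (card S)" by (rule of_nat_mono)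
      then show "real (d * card {v\<in>S. chi v w = 1}) * c w \<le> real (card S) * c w"
        using c w Sc by (intro mult_right_mono) auto
    qed
    also have "\<dots> = (\<Sum>v\<in>S. sum c S)" by (simp add: sum_distrib_left)
    finally show False by simp
  qed
  then obtain v where v: "v \<in> S" "real d * F v \<le> sum c S" by blast
  have vc: "v \<in> carrier G" using v Sc by blast
  define M' where "M' = adjoin M v"
  \<comment> \<open>A survivor must commute with the new v; elements absorbed into \<open>M'\<close>
    are dropped as well, which only helps.\<close>
  have "perp M' - M' \<subseteq> {w\<in>S. chi v w = 1}"
    unfolding M'_def perp_adjoin[OF M(1) vc] using subset_adjoin[OF M(1) vc] by (auto simp: S_def)
  then have "(\<Sum>w\<in>perp M' - M'. c w) \<le> F v" unfolding F_def
    using fS Sc c by (intro sum_mono2) auto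
  then have "real d * (\<Sum>w\<in>perp M' - M'. c w) \<le> real d * F v" by (intro mult_left_mono) auto
  then have "real d * (\<Sum>w\<in>perp M' - M'. c w) \<le> sum c S" using v(2) by linarith
  moreover have "M' \<subseteq> perp M'" unfolding M'_def using v by (intro adjoin_isotropic[OF M(1,2)]) (simp add: S_def)
  ultimately show ?thesis
    using subgroup_adjoin[OF M(1) vc] subset_adjoin[OF M(1) vc] card_adjoin[OF finite_subset[OF Mc fin], of v]
    by (intro exI[of _ M']) (auto simp: M'_def S_def)
qed

text \<open>The size hypothesis guarantees room for all j steps: if M were equal to its complement,
  the square of its size would be the size of the group, whereas before the last step the square is
  still strictly smaller.\<close>

lemma isotropic_extension:
  fixes c :: "'a \<Rightarrow> real"
  assumes L: "subgroup L G" "L \<subseteq> perp L" and c: "\<And>w. w \<in> carrier G \<Longrightarrow> c w \<ge> 0"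
    and j: "(d ^ j * card L) ^ 2 \<le> card (carrier G)"
  shows "\<exists>M. subgroup M G \<and> L \<subseteq> M \<and> M \<subseteq> perp M \<and> card M \<le> d ^ j * card L \<and>
    real d ^ j * (\<Sum>w\<in>perp M - M. c w) \<le> (\<Sum>w\<in>perp L - L. c w)"
  using j
proof (induction j)
  case 0
  then show ?case using L by (intro exI[of _ L]) auto
next
  case (Suc j)
  have L0: "card L > 0" by (rule subgroup.finite_imp_card_positive[OF L(1) fin])
  have lt: "(d ^ j * card L) ^ 2 < (d ^ Suc j * card L) ^ 2"
  proof (rule power_strict_mono)
    show "d ^ j * card L < d ^ Suc j * card L" using d_gt_1 L0 by simp
  qed simp_all
  have "(d ^ j * card L) ^ 2 \<le> card (carrier G)" by (rule order.trans[OF less_imp_le[OF lt] Suc.prems])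
  from Suc.IH[OF this] obtain M where M: "subgroup M G" "L \<subseteq> M" "M \<subseteq> perp M" "card M \<le> d ^ j * card L"
    "real d ^ j * (\<Sum>w\<in>perp M - M. c w) \<le> (\<Sum>w\<in>perp L - L. c w)" by blast
  have "M \<noteq> perp M"
  proof
    assume "M = perp M"
    then have "card (perp M) = card M" by (rule arg_cong[OF sym])
    then have "card (carrier G) = card M ^ 2" using card_perp[OF M(1)] by (simp add: power2_eq_square)
    also have "\<dots> \<le> (d ^ j * card L) ^ 2" using M(4) by (rule power_mono) simp
    also note lt
    also note Suc.prems
    finally show False by simp
  qed
  obtain M' where *: "subgroup M' G \<and> M \<subseteq> M' \<and> M' \<subseteq> perp M' \<and> card M' \<le> d * card M \<and>
    real d * (\<Sum>w\<in>perp M' - M'. c w) \<le> (\<Sum>w\<in>perp M - M. c w)"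
    by (rule exE[OF isotropic_extension_step[where M = M and c = c, OF M(1,3) \<open>M \<noteq> perp M\<close> c]])
  note M' = *[THEN conjunct1] *[THEN conjunct2, THEN conjunct1] *[THEN conjunct2, THEN conjunct2, THEN conjunct1]
    *[THEN conjunct2, THEN conjunct2, THEN conjunct2, THEN conjunct1]
    *[THEN conjunct2, THEN conjunct2, THEN conjunct2, THEN conjunct2]
  have "real d ^ Suc j * (\<Sum>w\<in>perp M' - M'. c w) = real d ^ j * (real d * (\<Sum>w\<in>perp M' - M'. c w))" by simp
  also have "\<dots> \<le> real d ^ j * (\<Sum>w\<in>perp M - M. c w)" using M'(5) by (intro mult_left_mono) auto
  finally have "real d ^ Suc j * (\<Sum>w\<in>perp M' - M'. c w) \<le> (\<Sum>w\<in>perp L - L. c w)" using M(5) by linarith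
  moreover have "card M' \<le> d ^ Suc j * card L"
    using order.trans[OF M'(4) mult_le_mono2[OF M(4)]] by (simp only: power_Suc mult.assoc)
  ultimately show ?case using M' M(2) by blast
qed

text \<open>An isotropic subgroup maximal under inclusion contains every v of its complement, since
  adjoining v preserves isotropy. It provides the codes for the rate 0.\<close>

lemma maximal_isotropic_exists: "\<exists>M. subgroup M G \<and> M = perp M"
proof -
  define I where "I = {M. subgroup M G \<and> M \<subseteq> perp M}"
  have "I \<subseteq> Pow (carrier G)" using subgroup.subset by (auto simp: I_def)
  then have fI: "finite I" using fin finite_subset by blast
  have "{\<one>} \<in> I" using triv_subgroup chi_one_left by (auto simp: I_def perp_def)
  then obtain M where M: "M \<in> I" "\<And>K. K \<in> I \<Longrightarrow> M \<subseteq> K \<Longrightarrow> M = K"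
    using finite_has_maximal[OF fI] by blast
  have Ms: "subgroup M G" "M \<subseteq> perp M" using M(1) by (auto simp: I_def)
  have "v \<in> M" if v: "v \<in> perp M" for v
  proof -
    have vc: "v \<in> carrier G" using v by (simp add: perp_def)
    have "adjoin M v \<in> I" unfolding I_def using subgroup_adjoin[OF Ms(1) vc] adjoin_isotropic[OF Ms v] by simp
    then have "adjoin M v \<subseteq> M" using M(2)[OF _ subset_adjoin[OF Ms(1) vc]] by (metis order_refl)
    then show ?thesis using mem_adjoin[OF Ms(1) vc] by (rule subsetD)
  qed
  then have "M = perp M" by (intro subset_antisym[OF Ms(2)] subsetI)
  with Ms(1) show ?thesis by (intro exI[of _ M] conjI)
qed

section \<open>Common eigenvectors of isotropic subgroups\<close>

lemma W_iterate:
  assumes v: "v \<in> carrier G" and \<psi>: "\<psi> \<in> carrier_vec D"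
  shows "\<exists>s. s \<noteq> 0 \<and> ((\<lambda>u. W v *\<^sub>v u) ^^ j) \<psi> = s \<cdot>\<^sub>v (W (v [^] j) *\<^sub>v \<psi>)"
proof (induction j)
  case 0
  show ?case using \<psi> by (intro exI[of _ 1]) (simp add: W_one)
next
  case (Suc j)
  then obtain s where s: "s \<noteq> 0" "((\<lambda>u. W v *\<^sub>v u) ^^ j) \<psi> = s \<cdot>\<^sub>v (W (v [^] j) *\<^sub>v \<psi>)" by blast
  have vj: "v [^] j \<in> carrier G" using v by simp
  have c: "W (v [^] j) *\<^sub>v \<psi> \<in> carrier_vec D" by (rule mult_mat_vec_carrier[OF W_carrier[OF vj] \<psi>])
  have "((\<lambda>u. W v *\<^sub>v u) ^^ Suc j) \<psi> = W v *\<^sub>v (s \<cdot>\<^sub>v (W (v [^] j) *\<^sub>v \<psi>))" using s(2) by simp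
  also have "\<dots> = s \<cdot>\<^sub>v (W v *\<^sub>v (W (v [^] j) *\<^sub>v \<psi>))" by (rule mult_mat_vec[OF W_carrier[OF v] c])
  also have "W v *\<^sub>v (W (v [^] j) *\<^sub>v \<psi>) = (W v * W (v [^] j)) *\<^sub>v \<psi>"
    by (rule assoc_mult_mat_vec[OF W_carrier[OF v] W_carrier[OF vj] \<psi>, symmetric])
  also have "W v * W (v [^] j) = \<beta> v (v [^] j) \<cdot>\<^sub>m W (v [^] Suc j)"
    using v by (simp add: W_mult m_comm)
  also have "(\<beta> v (v [^] j) \<cdot>\<^sub>m W (v [^] Suc j)) *\<^sub>v \<psi> = \<beta> v (v [^] j) \<cdot>\<^sub>v (W (v [^] Suc j) *\<^sub>v \<psi>)"
    by (rule smult_mat_mult_vec[OF W_carrier[OF nat_pow_closed[OF v]] \<psi>])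
  finally have "((\<lambda>u. W v *\<^sub>v u) ^^ Suc j) \<psi> = (s * \<beta> v (v [^] j)) \<cdot>\<^sub>v (W (v [^] Suc j) *\<^sub>v \<psi>)"
    by (simp only: smult_smult_assoc)
  moreover have "s * \<beta> v (v [^] j) \<noteq> 0" using s(1) \<beta>_nonzero[OF v vj] by simp
  ultimately show ?case by blast
qed

(* For a root z of z^d = c, where W_v^d acts on \<psi> as c, the vector sum_j z^(d-1-j) W_v^j \<psi> is
   an eigenvector of W_v or zero; it cannot vanish for all d roots, since its coordinates are
   polynomials of degree < d in z. *)
lemma adjoin_eigenvector:
  assumes v: "v \<in> carrier G" and \<psi>: "\<psi> \<in> carrier_vec D" "\<psi> \<noteq> 0\<^sub>v D"
  shows "\<exists>\<phi> z. \<phi> \<in> carrier_vec D \<and> \<phi> \<noteq> 0\<^sub>v D \<and> W v *\<^sub>v \<phi> = z \<cdot>\<^sub>v \<phi> \<and>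
    (\<forall>h t. h \<in> carrier G \<longrightarrow> chi h v = 1 \<longrightarrow> W h *\<^sub>v \<psi> = t \<cdot>\<^sub>v \<psi> \<longrightarrow> W h *\<^sub>v \<phi> = t \<cdot>\<^sub>v \<phi>)"
proof -
  define f where "f j = ((\<lambda>u. W v *\<^sub>v u) ^^ j) \<psi>" for j
  have f0: "f 0 = \<psi>" and fSuc: "\<And>j. f (Suc j) = W v *\<^sub>v f j" by (simp_all add: f_def)
  have fc: "f j \<in> carrier_vec D" for j
  proof (induction j)
    case (Suc j)
    show ?case unfolding fSuc by (rule mult_mat_vec_carrier[OF W_carrier[OF v] Suc])
  qed (simp add: f0 \<psi>)
  \<comment> \<open>The d-th power of v is the identity, so d applications of \<open>W v\<close>
    multiply \<psi> by a nonzero scalar s; the eigenvalues to be tried are the d-th roots of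
    s.\<close>
  obtain s where s: "s \<noteq> 0" "f d = s \<cdot>\<^sub>v (W (v [^] d) *\<^sub>v \<psi>)"
    using W_iterate[OF v \<psi>(1), of d] unfolding f_def by blast
  have fd: "f d = s \<cdot>\<^sub>v \<psi>" using s(2) \<psi>(1) by (simp add: exponent[OF v] W_one)
  define g where "g z = vec D (\<lambda>i. \<Sum>j<d. z ^ (d - 1 - j) * f j $ i)" for z :: complex
  have gc: "g z \<in> carrier_vec D" for z by (simp add: g_def)
  have eig: "W v *\<^sub>v g z = z \<cdot>\<^sub>v g z" if z: "z ^ d = s" for z
  proof (rule eq_vecI)
    fix i assume "i < dim_vec (z \<cdot>\<^sub>v g z)"
    then have i: "i < D" by (simp add: g_def)
    obtain e where e: "d = Suc e" using d_gt_1 by (cases d) auto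
    have "W v *\<^sub>v g z = vec D (\<lambda>i. \<Sum>j<d. z ^ (d - 1 - j) * (W v *\<^sub>v f j) $ i)"
      unfolding g_def by (rule mult_vec_linear_combination[OF W_carrier[OF v] fc])
    then have "(W v *\<^sub>v g z) $ i = (\<Sum>j<d. z ^ (d - 1 - j) * f (Suc j) $ i)"
      using i by (simp add: fSuc del: index_mult_mat_vec)
    also have "\<dots> = (\<Sum>j<e. z ^ (e - j) * f (Suc j) $ i) + s * \<psi> $ i"
      using fd i \<psi>(1) unfolding e by simp
    also have "\<dots> = z * (\<Sum>j<e. z ^ (e - Suc j) * f (Suc j) $ i) + z ^ d * \<psi> $ i"
    proof -
      have "(\<Sum>j<e. z ^ (e - j) * f (Suc j) $ i) = z * (\<Sum>j<e. z ^ (e - Suc j) * f (Suc j) $ i)"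
        unfolding sum_distrib_left
      proof (rule sum.cong[OF refl])
        fix j assume "j \<in> {..<e}"
        then have "e - j = Suc (e - Suc j)" by auto
        then show "z ^ (e - j) * f (Suc j) $ i = z * (z ^ (e - Suc j) * f (Suc j) $ i)" by simp
      qed
      then show ?thesis using z by simp
    qed
    also have "\<dots> = z * (\<Sum>j<d. z ^ (d - 1 - j) * f j $ i)"
      unfolding e sum.lessThan_Suc_shift by (simp add: f0 algebra_simps)
    also have "\<dots> = (z \<cdot>\<^sub>v g z) $ i" using i by (simp add: g_def)
    finally show "(W v *\<^sub>v g z) $ i = (z \<cdot>\<^sub>v g z) $ i" .
  qed (use carrier_matD(1)[OF W_carrier[OF v]] in \<open>simp add: g_def\<close>)
  \<comment> \<open>An operator commuting with \<open>W v\<close> keeps its eigenvalue along all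
    iterates of \<psi>, hence on their combination \<open>g z\<close>.\<close>
  have other: "W h *\<^sub>v g z = t \<cdot>\<^sub>v g z"
    if h: "h \<in> carrier G" "chi h v = 1" "W h *\<^sub>v \<psi> = t \<cdot>\<^sub>v \<psi>" for h t z
  proof -
    have hf: "W h *\<^sub>v f j = t \<cdot>\<^sub>v f j" for j
    proof (induction j)
      case (Suc j)
      have "W h *\<^sub>v f (Suc j) = (W h * W v) *\<^sub>v f j"
        unfolding fSuc by (rule assoc_mult_mat_vec[OF W_carrier[OF h(1)] W_carrier[OF v] fc, symmetric])
      also have "W h * W v = W v * W h" using W_commute[OF h(1) v] h(2) by simp
      also have "(W v * W h) *\<^sub>v f j = W v *\<^sub>v (W h *\<^sub>v f j)"
        by (rule assoc_mult_mat_vec[OF W_carrier[OF v] W_carrier[OF h(1)] fc])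
      also have "\<dots> = t \<cdot>\<^sub>v f (Suc j)"
        unfolding Suc fSuc by (rule mult_mat_vec[OF W_carrier[OF v] fc])
      finally show ?case .
    qed (simp add: f0 h(3))
    have "W h *\<^sub>v g z = vec D (\<lambda>i. \<Sum>j<d. z ^ (d - 1 - j) * (W h *\<^sub>v f j) $ i)"
      unfolding g_def by (rule mult_vec_linear_combination[OF W_carrier[OF h(1)] fc])
    also have "\<dots> = t \<cdot>\<^sub>v g z"
    proof (rule eq_vecI)
      fix i assume "i < dim_vec (t \<cdot>\<^sub>v g z)"
      then have i: "i < D" by (simp add: g_def)
      have "(t \<cdot>\<^sub>v f j) $ i = t * f j $ i" for j using i carrier_vecD[OF fc[of j]] by simp
      then show "vec D (\<lambda>i. \<Sum>j<d. z ^ (d - 1 - j) * (W h *\<^sub>v f j) $ i) $ i = (t \<cdot>\<^sub>v g z) $ i"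
        unfolding hf using i by (simp add: g_def sum_distrib_left mult.left_commute)
    qed (simp add: g_def)
    finally show ?thesis .
  qed
  have "\<exists>z. z ^ d = s \<and> g z \<noteq> 0\<^sub>v D"
  proof (rule ccontr)
    assume "\<not> ?thesis"
    then have all0: "\<And>z. z ^ d = s \<Longrightarrow> g z = 0\<^sub>v D" by blast
    have "\<psi> $ i = 0" if i: "i < D" for i
    proof (rule ccontr)
      assume nz: "\<psi> $ i \<noteq> 0"
      \<comment> \<open>The i-th coordinate of \<open>g z\<close> as a polynomial in z; the
        coefficient at degree d - 1 comes from j = 0 and is the nonzero coordinate of
        \<psi>.\<close>
      define p where "p = (\<Sum>j<d. monom (f j $ i) (d - 1 - j))"
      have "coeff p (d - 1) = (\<Sum>j<d. if j = 0 then \<psi> $ i else 0)"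
        unfolding p_def coeff_sum by (rule sum.cong[OF refl]) (auto simp: f0)
      also have "\<dots> = \<psi> $ i" using d_gt_1 by simp
      finally have p0: "p \<noteq> 0" using nz by auto
      have "degree p \<le> d - 1"
        unfolding p_def by (intro degree_sum_le) (auto intro: order.trans[OF degree_monom_le])
      have "{z. z ^ d = s} \<subseteq> {z. poly p z = 0}"
      proof (rule subsetI, unfold mem_Collect_eq)
        fix z assume z: "z ^ d = s"
        have "g z $ i = 0" using all0[OF z] i by simp
        then show "poly p z = 0" using i by (simp add: g_def p_def poly_sum poly_monom mult.commute)
      qed
      then have "card {z. z ^ d = s} \<le> card {z. poly p z = 0}" by (intro card_mono poly_roots_finite p0)
      also have "\<dots> \<le> degree p" by (rule card_poly_roots_bound[OF p0])
      finally have "d \<le> d - 1" using card_nth_roots[OF s(1), of d] d_gt_1 \<open>degree p \<le> d - 1\<close> by simp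
      then show False using d_gt_1 by simp
    qed
    then have "\<psi> = 0\<^sub>v D" using \<psi>(1) by (intro eq_vecI) auto
    then show False using \<psi>(2) by simp
  qed
  then obtain z where "z ^ d = s" "g z \<noteq> 0\<^sub>v D" by blast
  then show ?thesis using gc eig other by (intro exI[of _ "g z"] exI[of _ z]) blast
qed

text \<open>Choose a nonzero vector that is an eigenvector of as many operators of M as possible.
  For an operator left out, \<open>adjoin_eigenvector\<close> would produce a nonzero eigenvector of
  it that keeps all previous eigenvalues, because M is isotropic.\<close>

lemma isotropic_stab_char_exists:
  assumes M: "subgroup M G" "M \<subseteq> perp M"
  shows "\<exists>\<tau>. stab_char M \<tau>"
proof -
  define S where "S \<psi> = {h \<in> M. \<exists>t. W h *\<^sub>v \<psi> = t \<cdot>\<^sub>v \<psi>}" for \<psi>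
  have Mc: "M \<subseteq> carrier G" by (rule subgroup.subset[OF M(1)])
  have fM: "finite M" by (rule finite_subset[OF Mc fin])
  have fS: "finite (S \<psi>)" "card (S \<psi>) \<le> card M" for \<psi> using fM by (auto simp: S_def intro: card_mono)
  define ok where "ok \<psi> \<longleftrightarrow> \<psi> \<in> carrier_vec D \<and> \<psi> \<noteq> 0\<^sub>v D" for \<psi> :: "complex vec"
  have ne: "unit_vec D 0 $ 0 \<noteq> (0\<^sub>v D :: complex vec) $ 0" using D_pos by simp
  have "unit_vec D 0 \<noteq> (0\<^sub>v D :: complex vec)" by (rule contrapos_nn[OF ne]) simp
  then have "ok (unit_vec D 0)" unfolding ok_def by simp
  moreover have "\<forall>\<psi>. ok \<psi> \<longrightarrow> card (S \<psi>) < Suc (card M)" using fS(2) by (simp add: less_Suc_eq_le)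
  ultimately have "\<exists>\<psi>. ok \<psi> \<and> (\<forall>\<phi>. ok \<phi> \<longrightarrow> card (S \<phi>) \<le> card (S \<psi>))"
    by (rule ex_has_greatest_nat)
  then obtain \<psi> where \<psi>: "ok \<psi>" "\<And>\<phi>. ok \<phi> \<Longrightarrow> card (S \<phi>) \<le> card (S \<psi>)" by blast
  have "v \<in> S \<psi>" if v: "v \<in> M" for v
  proof (rule ccontr)
    assume nv: "v \<notin> S \<psi>"
    have vc: "v \<in> carrier G" using v Mc by blast
    obtain \<phi> z where \<phi>: "\<phi> \<in> carrier_vec D" "\<phi> \<noteq> 0\<^sub>v D" "W v *\<^sub>v \<phi> = z \<cdot>\<^sub>v \<phi>"
      "\<And>h t. h \<in> carrier G \<Longrightarrow> chi h v = 1 \<Longrightarrow> W h *\<^sub>v \<psi> = t \<cdot>\<^sub>v \<psi> \<Longrightarrow> W h *\<^sub>v \<phi> = t \<cdot>\<^sub>v \<phi>"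
      using adjoin_eigenvector[OF vc, of \<psi>] \<psi>(1) unfolding ok_def by blast
    have "insert v (S \<psi>) \<subseteq> S \<phi>"
    proof
      fix h assume h: "h \<in> insert v (S \<psi>)"
      show "h \<in> S \<phi>"
      proof (cases "h = v")
        case True
        then show ?thesis using v \<phi>(3) by (auto simp: S_def)
      next
        case False
        then obtain t where ht: "h \<in> M" "W h *\<^sub>v \<psi> = t \<cdot>\<^sub>v \<psi>" using h by (auto simp: S_def)
        have "chi h v = 1" by (rule perpD[OF subsetD[OF M(2) v] ht(1)])
        then show ?thesis using \<phi>(4)[of h t] ht Mc by (auto simp: S_def)
      qed
    qed
    then have "card (insert v (S \<psi>)) \<le> card (S \<phi>)" by (rule card_mono[OF fS(1)])
    then have "card (S \<psi>) < card (S \<phi>)" using nv fS(1) by simp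
    then show False using \<psi>(2)[of \<phi>] \<phi> by (simp add: ok_def)
  qed
  then have "\<forall>v\<in>M. \<exists>t. W v *\<^sub>v \<psi> = t \<cdot>\<^sub>v \<psi>" by (auto simp: S_def)
  then obtain \<tau> where "\<And>v. v \<in> M \<Longrightarrow> W v *\<^sub>v \<psi> = \<tau> v \<cdot>\<^sub>v \<psi>" by metis
  then show ?thesis using stab_char_of_eigenvector[OF M(1), of \<psi> \<tau>] \<psi>(1) unfolding ok_def by blast
qed

end

section \<open>Projections and dimensions of subspaces\<close>

lemma vec_sum_Suc:
  assumes "f m \<in> carrier_vec N"
  shows "vec N (\<lambda>i. \<Sum>j<Suc m. c j * f j $ i) = vec N (\<lambda>i. \<Sum>j<m. c j * f j $ i) + c m \<cdot>\<^sub>v (f m :: complex vec)"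
  by (rule eq_vecI) (use assms in auto)

lemma csubspace_vec_sum_mem:
  fixes m :: nat
  assumes C: "csubspace N C" and f: "\<And>j. j < m \<Longrightarrow> f j \<in> C"
  shows "vec N (\<lambda>i. \<Sum>j<m. c j * f j $ i) \<in> C"
  using f
proof (induction m)
  case 0
  have "vec N (\<lambda>i. \<Sum>j<0. c j * f j $ i) = 0\<^sub>v N" by (rule eq_vecI) simp_all
  then show ?case using C by (simp add: csubspace_def)
next
  case (Suc m)
  have m: "f m \<in> C" by (rule Suc.prems) simp
  then have "f m \<in> carrier_vec N" using C unfolding csubspace_def by blast
  then have "vec N (\<lambda>i. \<Sum>j<Suc m. c j * f j $ i) = vec N (\<lambda>i. \<Sum>j<m. c j * f j $ i) + c m \<cdot>\<^sub>v f m"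
    by (rule vec_sum_Suc)
  also have "\<dots> \<in> C" using C m Suc unfolding csubspace_def by simp
  finally show ?case .
qed

lemma cinner_vec_sum:
  assumes "u \<in> carrier_vec N"
  shows "cinner u (vec N (\<lambda>i. \<Sum>j<m. c j * f j $ i)) = (\<Sum>j<m. c j * cinner u (f j))"
proof -
  have "cinner u (vec N (\<lambda>i. \<Sum>j<m. c j * f j $ i)) = (\<Sum>i<N. \<Sum>j<m. c j * (cnj (u $ i) * f j $ i))"
    using assms by (simp add: cinner_def sum_distrib_left mult.left_commute)
  also have "\<dots> = (\<Sum>j<m. \<Sum>i<N. c j * (cnj (u $ i) * f j $ i))" by (rule sum.swap)
  finally show ?thesis using assms by (simp add: cinner_def sum_distrib_left)
qed

lemma unit_multiple_exists:
  assumes v: "v \<in> carrier_vec n" "v \<noteq> 0\<^sub>v n"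
  shows "\<exists>c. cinner (c \<cdot>\<^sub>v v) (c \<cdot>\<^sub>v v) = 1"
proof -
  define s where "s = (\<Sum>i<dim_vec v. (cmod (v $ i))\<^sup>2)"
  have vs: "cinner v v = of_real s" by (simp add: cinner_self s_def)
  have "s \<noteq> 0" using v(2) cinner_self_zero_iff[OF v(1)] vs by auto
  moreover have "s \<ge> 0" unfolding s_def by (rule sum_nonneg) simp
  ultimately have s: "s > 0" by simp
  define c where "c = complex_of_real (1 / sqrt s)"
  have "cinner (c \<cdot>\<^sub>v v) (c \<cdot>\<^sub>v v) = of_real (1 / sqrt s) * (of_real (1 / sqrt s) * of_real s)"
    unfolding c_def by (simp add: cinner_smult_left cinner_smult_right vs)
  also have "\<dots> = of_real ((1 / sqrt s) * (1 / sqrt s) * s)" by (simp only: of_real_mult mult.assoc)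
  also have "(1 / sqrt s) * (1 / sqrt s) * s = 1" using s by simp
  finally show ?thesis by auto
qed

definition orthonormal :: "complex vec list \<Rightarrow> bool" where
  "orthonormal es \<longleftrightarrow> (\<forall>i<length es. \<forall>j<length es. cinner (es ! i) (es ! j) = (if i = j then 1 else 0))"

text \<open>The inner products of \<open>es\<close> with \<open>vs\<close>, multiplied by the
  coefficients of \<open>es\<close> in terms of \<open>vs\<close>, form the identity matrix. Were
  \<open>vs\<close> shorter, the first factor, padded to a square by zero columns, would be
  singular. This is the lower bound in the computation of \<open>cdim\<close>.\<close>

lemma orthonormal_length_le_span:
  assumes es: "orthonormal es" "set es \<subseteq> carrier_vec N" "set es \<subseteq> cspan N vs"
  shows "length es \<le> length vs"
proof (rule ccontr)
  assume len: "\<not> ?thesis"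
  define m where "m = length es"
  define l where "l = length vs"
  have lm: "l < m" using len by (simp add: m_def l_def)
  have "\<exists>cs. es ! k = clincomb N cs vs" if "k < m" for k
    using es(3) nth_mem[of k es] that unfolding cspan_def m_def by blast
  then obtain c where c: "\<And>k. k < m \<Longrightarrow> es ! k = clincomb N (c k) vs" by metis
  define A where "A = mat m m (\<lambda>(i, j). if j < l then cinner (es ! i) (vs ! j) else 0)"
  define B where "B = mat m m (\<lambda>(j, k). if j < l then c k ! j else 0)"
  have AB: "A \<in> carrier_mat m m" "B \<in> carrier_mat m m" by (simp_all add: A_def B_def)
  have "A * B = 1\<^sub>m m"
  proof (rule eq_matI)
    fix i k assume "i < dim_row (1\<^sub>m m :: complex mat)" "k < dim_col (1\<^sub>m m :: complex mat)"
    then have ik: "i < m" "k < m" by simp_all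
    have ei: "es ! i \<in> carrier_vec N" using es(2) ik nth_mem[of i es] unfolding m_def by blast
    have "(A * B) $$ (i, k) = (\<Sum>j<m. if j < l then c k ! j * cinner (es ! i) (vs ! j) else 0)"
      unfolding mult_index_sum[OF AB ik] using ik by (intro sum.cong refl) (simp add: A_def B_def)
    also have "\<dots> = (\<Sum>j<l. c k ! j * cinner (es ! i) (vs ! j))"
      using lm by (subst sum.mono_neutral_right[of "{..<m}" "{..<l}"]) auto
    also have "\<dots> = cinner (es ! i) (es ! k)"
      unfolding c[OF ik(2)] clincomb_def l_def by (rule cinner_vec_sum[OF ei, symmetric])
    also have "\<dots> = (1\<^sub>m m :: complex mat) $$ (i, k)"
      using es(1) ik unfolding orthonormal_def m_def by simp
    finally show "(A * B) $$ (i, k) = (1\<^sub>m m :: complex mat) $$ (i, k)" .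
  qed (simp_all add: A_def B_def)
  then have "det A * det B = 1" using det_mult[OF AB] by simp
  moreover have "det A = 0"
  proof -
    have z: "A *\<^sub>v unit_vec m l = 0\<^sub>v m"
      by (rule eq_vecI) (use lm AB in \<open>auto simp: A_def\<close>)
    have ne: "unit_vec m l $ l \<noteq> (0\<^sub>v m :: complex vec) $ l" using lm by simp
    have "unit_vec m l \<noteq> (0\<^sub>v m :: complex vec)" by (rule contrapos_nn[OF ne]) simp
    then show ?thesis unfolding det_0_iff_vec_prod_zero[OF AB(1)] using z unit_vec_carrier by blast
  qed
  ultimately show False by simp
qed

lemma orthonormal_length_le:
  assumes "orthonormal es" "set es \<subseteq> carrier_vec N"
  shows "length es \<le> N"
proof -
  have "v \<in> cspan N (map (unit_vec N) [0..<N])" if "v \<in> carrier_vec N" for v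
  proof -
    have "v = clincomb N (map (\<lambda>i. v $ i) [0..<N]) (map (unit_vec N) [0..<N])"
    proof (rule eq_vecI)
      fix i assume "i < dim_vec (clincomb N (map (\<lambda>i. v $ i) [0..<N]) (map (unit_vec N) [0..<N]))"
      then have i: "i < N" by (simp add: clincomb_def)
      have "clincomb N (map (\<lambda>i. v $ i) [0..<N]) (map (unit_vec N) [0..<N]) $ i = (\<Sum>j<N. if i = j then v $ j else 0)"
        using i unfolding clincomb_def by (simp add: unit_vec_def if_distrib[of "\<lambda>x. _ * x"] cong: if_cong)
      then show "v $ i = clincomb N (map (\<lambda>i. v $ i) [0..<N]) (map (unit_vec N) [0..<N]) $ i" using i by simp
    qed (use that in \<open>simp add: clincomb_def\<close>)
    then show ?thesis unfolding cspan_def by force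
  qed
  then show ?thesis using orthonormal_length_le_span[OF assms, of "map (unit_vec N) [0..<N]"] assms(2) by auto
qed

text \<open>A longest orthonormal list in C works: a nonzero difference between a vector and its
  expansion lies in C, is orthogonal to the list, and could be normalised and appended.\<close>

lemma orthonormal_basis_exists:
  assumes C: "csubspace N C"
  shows "\<exists>es. orthonormal es \<and> set es \<subseteq> C \<and>
    (\<forall>v\<in>C. v = vec N (\<lambda>i. \<Sum>j<length es. cinner (es ! j) v * es ! j $ i))"
proof -
  have Cc: "C \<subseteq> carrier_vec N" using C by (simp add: csubspace_def)
  define ok where "ok es \<longleftrightarrow> orthonormal es \<and> set es \<subseteq> C" for es
  have "ok []" by (simp add: ok_def orthonormal_def)
  moreover have "\<forall>es. ok es \<longrightarrow> length es < Suc N"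
    using orthonormal_length_le Cc unfolding ok_def less_Suc_eq_le by blast
  ultimately have "\<exists>es. ok es \<and> (\<forall>fs. ok fs \<longrightarrow> length fs \<le> length es)" by (rule ex_has_greatest_nat)
  then obtain es where es: "ok es" and max: "\<And>fs. ok fs \<Longrightarrow> length fs \<le> length es" by blast
  have on: "orthonormal es" and esC: "set es \<subseteq> C" using es by (auto simp: ok_def)
  have ec: "es ! i \<in> C" "es ! i \<in> carrier_vec N" if "i < length es" for i
    using nth_mem[OF that] esC Cc by blast+
  have "v = vec N (\<lambda>i. \<Sum>j<length es. cinner (es ! j) v * es ! j $ i)" if v: "v \<in> C" for v
  proof (rule ccontr)
    define p where "p = vec N (\<lambda>i. \<Sum>j<length es. cinner (es ! j) v * es ! j $ i)"
    assume "v \<noteq> vec N (\<lambda>i. \<Sum>j<length es. cinner (es ! j) v * es ! j $ i)"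
    then have vp: "v \<noteq> p" by (simp add: p_def)
    have vc: "v \<in> carrier_vec N" using v Cc by blast
    have pc: "p \<in> carrier_vec N" by (simp add: p_def)
    have pC: "p \<in> C" unfolding p_def by (rule csubspace_vec_sum_mem[OF C ec(1)])
    define r where "r = v + (-1) \<cdot>\<^sub>v p"
    have rC: "r \<in> C" using C v pC unfolding r_def csubspace_def by blast
    have rc: "r \<in> carrier_vec N" using rC Cc by blast
    have r0: "r \<noteq> 0\<^sub>v N"
    proof
      assume "r = 0\<^sub>v N"
      then have *: "(v + (-1) \<cdot>\<^sub>v p) $ i = 0" if "i < N" for i using that by (simp add: r_def)
      have "v = p"
      proof (rule eq_vecI)
        fix i assume "i < dim_vec p"
        then show "v $ i = p $ i" using *[of i] vc pc by simp
      qed (use vc pc in simp)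
      then show False using vp by simp
    qed
    have orth: "cinner (es ! k) r = 0" if k: "k < length es" for k
    proof -
      have "cinner (es ! k) p = (\<Sum>j<length es. cinner (es ! j) v * cinner (es ! k) (es ! j))"
        unfolding p_def by (rule cinner_vec_sum[OF ec(2)[OF k]])
      also have "\<dots> = (\<Sum>j<length es. if j = k then cinner (es ! k) v else 0)"
        using on k unfolding orthonormal_def by (intro sum.cong refl) auto
      also have "\<dots> = cinner (es ! k) v" using k by simp
      finally have p: "cinner (es ! k) p = cinner (es ! k) v" .
      have d: "dim_vec (es ! k) = N" "dim_vec v = N" "dim_vec p = N" using ec(2)[OF k] vc pc by auto
      have "cinner (es ! k) r = cinner (es ! k) v + cinner (es ! k) ((-1) \<cdot>\<^sub>v p)"
        unfolding r_def by (rule cinner_add_right) (simp_all add: d)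
      also have "cinner (es ! k) ((-1) \<cdot>\<^sub>v p) = - cinner (es ! k) p"
        by (subst cinner_smult_right) (simp_all add: d)
      finally show ?thesis using p by simp
    qed
    obtain c where c: "cinner (c \<cdot>\<^sub>v r) (c \<cdot>\<^sub>v r) = 1" using unit_multiple_exists[OF rc r0] by blast
    define u where "u = c \<cdot>\<^sub>v r"
    have uC: "u \<in> C" using C rC unfolding u_def csubspace_def by blast
    have uu: "cinner u u = 1" using c by (simp add: u_def)
    have eu: "cinner (es ! k) u = 0" "cinner u (es ! k) = 0" if k: "k < length es" for k
    proof -
      have d: "dim_vec (es ! k) = N" "dim_vec r = N" using ec(2)[OF k] rc by auto
      show 1: "cinner (es ! k) u = 0" unfolding u_def by (subst cinner_smult_right) (simp_all add: d orth[OF k])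
      have "cnj (cinner (es ! k) u) = cinner u (es ! k)" by (rule cinner_cnj) (simp add: u_def d)
      then show "cinner u (es ! k) = 0" using 1 by simp
    qed
    have "orthonormal (es @ [u])"
      unfolding orthonormal_def using on uu eu
      by (auto simp: orthonormal_def nth_append less_Suc_eq)
    then have "ok (es @ [u])" using esC uC by (simp add: ok_def)
    from max[OF this] show False by simp
  qed
  then show ?thesis using on esC by blast
qed

text \<open>One verified orthogonal projection settles both the definite description in
  \<open>proj\<close> and the least length in \<open>cdim\<close>. Two candidates differ on a vector
  by an element of C orthogonal to C, which is zero; and Q is the sum of the rank-one projections of
  an orthonormal basis of C, so its trace counts the basis.\<close>

lemma
  assumes C: "csubspace N C" and Q: "Q \<in> carrier_mat N N"
    and QC: "\<And>v. v \<in> carrier_vec N \<Longrightarrow> Q *\<^sub>v v \<in> C"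
    and orth: "\<And>v w. v \<in> carrier_vec N \<Longrightarrow> w \<in> C \<Longrightarrow> cinner w (v - Q *\<^sub>v v) = 0"
  shows proj_eqI: "proj N C = Q"
    and cdim_eq_mtrace: "of_nat (cdim N C) = mtrace Q"
proof -
  have Cc: "C \<subseteq> carrier_vec N" using C by (simp add: csubspace_def)
  have uniq: "R *\<^sub>v v = Q *\<^sub>v v"
    if R: "R \<in> carrier_mat N N" "R *\<^sub>v v \<in> C" "\<And>w. w \<in> C \<Longrightarrow> cinner w (v - R *\<^sub>v v) = 0"
      and v: "v \<in> carrier_vec N" for R v
  proof -
    define r where "r = R *\<^sub>v v + (-1) \<cdot>\<^sub>v (Q *\<^sub>v v)"
    have d: "dim_row R = N" "dim_row Q = N" "dim_vec v = N"
      using carrier_matD(1)[OF R(1)] carrier_matD(1)[OF Q] v by simp_all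
    have rC: "r \<in> C" using C R(2) QC[OF v] unfolding r_def csubspace_def by blast
    then have rc: "r \<in> carrier_vec N" using Cc by (rule subsetD[rotated])
    have dr: "dim_vec r = N" using rc by auto
    have "cinner r v = cinner r (R *\<^sub>v v)" "cinner r v = cinner r (Q *\<^sub>v v)"
      using R(3)[OF rC] orth[OF v rC] cinner_minus_right[of v r "R *\<^sub>v v"]
        cinner_minus_right[of v r "Q *\<^sub>v v"] d dr by simp_all
    moreover have "cinner r r = cinner r (R *\<^sub>v v) + cinner r ((-1) \<cdot>\<^sub>v (Q *\<^sub>v v))"
      by (subst (2) r_def) (rule cinner_add_right; simp add: d dr)
    moreover have "cinner r ((-1) \<cdot>\<^sub>v (Q *\<^sub>v v)) = - cinner r (Q *\<^sub>v v)"
      by (subst cinner_smult_right) (simp_all add: d dr)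
    ultimately have "cinner r r = 0" by simp
    then have r0: "r = 0\<^sub>v N" using cinner_self_zero_iff[OF rc] by simp
    show ?thesis
    proof (rule eq_vecI)
      fix i assume "i < dim_vec (Q *\<^sub>v v)"
      then have i: "i < N" using d by simp
      have "r $ i = 0" using r0 i by simp
      then show "(R *\<^sub>v v) $ i = (Q *\<^sub>v v) $ i" using i d unfolding r_def by simp
    qed (simp add: d)
  qed
  show "proj N C = Q"
    unfolding proj_def
  proof (rule the_equality)
    show "Q \<in> carrier_mat N N \<and> (\<forall>v\<in>carrier_vec N. Q *\<^sub>v v \<in> C \<and> (\<forall>w\<in>C. cinner w (v - Q *\<^sub>v v) = 0))"
      using Q QC orth by blast
    fix R assume R: "R \<in> carrier_mat N N \<and> (\<forall>v\<in>carrier_vec N. R *\<^sub>v v \<in> C \<and> (\<forall>w\<in>C. cinner w (v - R *\<^sub>v v) = 0))"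
    show "R = Q"
    proof (rule mat_eqI_mult_vec[OF _ Q])
      show "R \<in> carrier_mat N N" using R by (rule conjunct1)
      show "R *\<^sub>v v = Q *\<^sub>v v" if v: "v \<in> carrier_vec N" for v
        using R v by (intro uniq[OF _ _ _ v]) simp_all
    qed
  qed
  obtain es where on: "orthonormal es" and esC: "set es \<subseteq> C"
    and basis: "\<And>v. v \<in> C \<Longrightarrow> v = vec N (\<lambda>i. \<Sum>j<length es. cinner (es ! j) v * es ! j $ i)"
    using orthonormal_basis_exists[OF C] by blast
  have ec: "es ! i \<in> C" "es ! i \<in> carrier_vec N" if "i < length es" for i
    using nth_mem[OF that] esC Cc by blast+
  have span: "cspan N es = C"
  proof
    show "cspan N es \<subseteq> C"
      unfolding cspan_def clincomb_def using csubspace_vec_sum_mem[OF C ec(1)] by auto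
    show "C \<subseteq> cspan N es"
    proof
      fix v assume v: "v \<in> C"
      have "vec N (\<lambda>i. \<Sum>j<length es. cinner (es ! j) v * es ! j $ i) = clincomb N (map (\<lambda>e. cinner e v) es) es"
        unfolding clincomb_def by (rule eq_vecI) simp_all
      then have "v = clincomb N (map (\<lambda>e. cinner e v) es) es" using basis[OF v] by simp
      then show "v \<in> cspan N es" unfolding cspan_def by force
    qed
  qed
  have "cdim N C = length es" unfolding cdim_def
  proof (rule Least_equality)
    show "\<exists>vs. length vs = length es \<and> set vs \<subseteq> C \<and> cspan N vs = C" using span esC by blast
    fix m assume "\<exists>vs. length vs = m \<and> set vs \<subseteq> C \<and> cspan N vs = C"
    then obtain vs where "length vs = m" "cspan N vs = C" by blast
    then show "length es \<le> m" using orthonormal_length_le_span[OF on, of N vs] esC Cc by auto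
  qed
  moreover have "Q = msum N {..<length es} (\<lambda>j. outer (es ! j))"
  proof (rule mat_eqI_mult_vec[OF Q msum_carrier])
    fix v :: "complex vec" assume v: "v \<in> carrier_vec N"
    have "cinner (es ! j) (Q *\<^sub>v v) = cinner (es ! j) v" if j: "j < length es" for j
      using orth[OF v ec(1)[OF j]] cinner_minus_right[of v "es ! j" "Q *\<^sub>v v"] ec(2)[OF j] v Q by simp
    then have Qv: "Q *\<^sub>v v = vec N (\<lambda>i. \<Sum>j<length es. cinner (es ! j) v * es ! j $ i)"
      by (subst basis[OF QC[OF v]]) (intro eq_vecI, simp_all)
    show "Q *\<^sub>v v = msum N {..<length es} (\<lambda>j. outer (es ! j)) *\<^sub>v v"
    proof (rule cvec_eqI_cinner)
      fix u :: "complex vec" assume u: "u \<in> carrier_vec N"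
      have "cinner u (msum N {..<length es} (\<lambda>j. outer (es ! j)) *\<^sub>v v) = (\<Sum>j<length es. cinner u (outer (es ! j) *\<^sub>v v))"
        by (rule msum_mult_vec_cinner[OF u v]) (use ec in auto)
      also have "\<dots> = (\<Sum>j<length es. cinner (es ! j) v * cinner u (es ! j))"
      proof (rule sum.cong[OF refl])
        fix j assume "j \<in> {..<length es}"
        then have e: "es ! j \<in> carrier_vec N" using ec by simp
        show "cinner u (outer (es ! j) *\<^sub>v v) = cinner (es ! j) v * cinner u (es ! j)"
          unfolding outer_mult_vec[OF e v] by (rule cinner_smult_right) (use e u in simp)
      qed
      also have "\<dots> = cinner u (Q *\<^sub>v v)" unfolding Qv by (rule cinner_vec_sum[OF u, symmetric])
      finally show "cinner u (Q *\<^sub>v v) = cinner u (msum N {..<length es} (\<lambda>j. outer (es ! j)) *\<^sub>v v)" by simp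
    qed (use mult_mat_vec_carrier[OF Q v] mult_mat_vec_carrier[OF msum_carrier v] in simp_all)
  qed
  moreover have "mtrace (msum N {..<length es} (\<lambda>j. outer (es ! j))) = of_nat (length es)"
  proof -
    have "mtrace (msum N {..<length es} (\<lambda>j. outer (es ! j))) = (\<Sum>j<length es. mtrace (outer (es ! j)))"
      by (rule mtrace_msum) (use ec in auto)
    also have "\<dots> = (\<Sum>j<length es. 1)"
      using on unfolding orthonormal_def by (intro sum.cong refl) (simp add: mtrace_outer)
    finally show ?thesis by simp
  qed
  ultimately show "of_nat (cdim N C) = mtrace Q" by simp
qed

text \<open>Used in the contrapositive: a code of positive dimension contains a nonzero
  vector.\<close>

lemma cdim_zero_subspace: "cdim N {0\<^sub>v N} = 0"
proof -
  have "clincomb N [] [] = 0\<^sub>v N" unfolding clincomb_def by (rule eq_vecI) simp_all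
  then have "cspan N [] = {0\<^sub>v N}" unfolding cspan_def by auto
  then have "\<exists>vs. length vs = 0 \<and> set vs \<subseteq> {0\<^sub>v N} \<and> cspan N vs = {0\<^sub>v N}" by simp
  then show ?thesis unfolding cdim_def by (rule Least_eq_0)
qed

section \<open>Fidelity of Kraus maps on unitary mixtures\<close>

text \<open>Moving each Kraus operator to the left argument leaves rank-one forms, that is, squared
  moduli of amplitudes. The upper and the lower estimates of the fidelity are both made on this
  double sum.\<close>

lemma kraus_mixture_fidelity:
  assumes Ks: "set Ks \<subseteq> carrier_mat N N" and U: "\<And>x. x \<in> S \<Longrightarrow> U x \<in> carrier_mat N N"
    and \<psi>: "\<psi> \<in> carrier_vec N"
  shows "Re (cinner \<psi> (kraus_apply N Ks
      (msum N S (\<lambda>x. of_real (p x) \<cdot>\<^sub>m (U x * outer \<psi> * mat_adjoint (U x)))) *\<^sub>v \<psi>)) =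
    (\<Sum>i<length Ks. \<Sum>x\<in>S. p x * (cmod (cinner \<psi> (Ks ! i *\<^sub>v (U x *\<^sub>v \<psi>))))\<^sup>2)"
proof -
  define R where "R = msum N S (\<lambda>x. of_real (p x) \<cdot>\<^sub>m (U x * outer \<psi> * mat_adjoint (U x)))"
  have Uc: "U x *\<^sub>v \<psi> \<in> carrier_vec N" if "x \<in> S" for x by (rule mult_mat_vec_carrier[OF U[OF that] \<psi>])
  have R: "R = msum N S (\<lambda>x. of_real (p x) \<cdot>\<^sub>m outer (U x *\<^sub>v \<psi>))"
    unfolding R_def by (rule msum_cong[OF refl]) (simp only: conj_outer[OF U \<psi>])
  have Kc: "Ks ! i \<in> carrier_mat N N" if "i < length Ks" for i using Ks nth_mem[OF that] by blast
  have Rc: "R \<in> carrier_mat N N" by (simp add: R_def)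
  have main: "cinner \<psi> ((K * R * mat_adjoint K) *\<^sub>v \<psi>) =
      of_real (\<Sum>x\<in>S. p x * (cmod (cinner \<psi> (K *\<^sub>v (U x *\<^sub>v \<psi>))))\<^sup>2)" if K: "K \<in> carrier_mat N N" for K
  proof -
    have K': "mat_adjoint K \<in> carrier_mat N N" using K by simp
    have K\<psi>: "mat_adjoint K *\<^sub>v \<psi> \<in> carrier_vec N" by (rule mult_mat_vec_carrier[OF K' \<psi>])
    have KR: "K * R \<in> carrier_mat N N" by (rule mult_carrier_mat[OF K Rc])
    have "(K * R * mat_adjoint K) *\<^sub>v \<psi> = K *\<^sub>v (R *\<^sub>v (mat_adjoint K *\<^sub>v \<psi>))"
      by (simp only: assoc_mult_mat_vec[OF KR K' \<psi>] assoc_mult_mat_vec[OF K Rc K\<psi>])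
    then have "cinner \<psi> ((K * R * mat_adjoint K) *\<^sub>v \<psi>) = cinner (mat_adjoint K *\<^sub>v \<psi>) (R *\<^sub>v (mat_adjoint K *\<^sub>v \<psi>))"
      using cinner_adjoint[OF K \<psi> mult_mat_vec_carrier[OF Rc K\<psi>]] by simp
    also have "\<dots> = (\<Sum>x\<in>S. cinner (mat_adjoint K *\<^sub>v \<psi>) ((of_real (p x) \<cdot>\<^sub>m outer (U x *\<^sub>v \<psi>)) *\<^sub>v (mat_adjoint K *\<^sub>v \<psi>)))"
      unfolding R by (rule msum_mult_vec_cinner[OF K\<psi> K\<psi>]) (use Uc in auto)
    also have "\<dots> = (\<Sum>x\<in>S. of_real (p x * (cmod (cinner \<psi> (K *\<^sub>v (U x *\<^sub>v \<psi>))))\<^sup>2))"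
    proof (rule sum.cong[OF refl])
      fix x assume x: "x \<in> S"
      define u where "u = U x *\<^sub>v \<psi>"
      define k where "k = mat_adjoint K *\<^sub>v \<psi>"
      have u: "u \<in> carrier_vec N" and k: "k \<in> carrier_vec N" using Uc[OF x] K\<psi> by (simp_all add: u_def k_def)
      have ku: "cinner \<psi> (K *\<^sub>v u) = cinner k u" unfolding k_def by (rule cinner_adjoint[OF K \<psi> u])
      have "(of_real (p x) \<cdot>\<^sub>m outer u) *\<^sub>v k = (of_real (p x) * cinner u k) \<cdot>\<^sub>v u"
        using smult_mat_mult_vec[OF outer_carrier[OF u] k, of "of_real (p x)"] outer_mult_vec[OF u k]
        by (simp add: smult_smult_assoc)
      then have "cinner k ((of_real (p x) \<cdot>\<^sub>m outer u) *\<^sub>v k) = (of_real (p x) * cinner u k) * cinner k u"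
        using cinner_smult_right[of u k] u k by simp
      also have "cinner u k = cnj (cinner k u)" using cinner_cnj[of k u] u k by simp
      also have "of_real (p x) * cnj (cinner k u) * cinner k u = of_real (p x * (cmod (cinner k u))\<^sup>2)"
        unfolding of_real_mult complex_norm_square by simp
      finally show "cinner (mat_adjoint K *\<^sub>v \<psi>) ((of_real (p x) \<cdot>\<^sub>m outer (U x *\<^sub>v \<psi>)) *\<^sub>v (mat_adjoint K *\<^sub>v \<psi>)) =
        of_real (p x * (cmod (cinner \<psi> (K *\<^sub>v (U x *\<^sub>v \<psi>))))\<^sup>2)"
        unfolding u_def[symmetric] k_def[symmetric] ku .
    qed
    finally show ?thesis by simp
  qed
  have "cinner \<psi> (kraus_apply N Ks R *\<^sub>v \<psi>) = (\<Sum>i<length Ks. cinner \<psi> ((Ks ! i * R * mat_adjoint (Ks ! i)) *\<^sub>v \<psi>))"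
    unfolding kraus_apply_def
  proof (rule msum_mult_vec_cinner[OF \<psi> \<psi>])
    fix i assume "i \<in> {..<length Ks}"
    then have K: "Ks ! i \<in> carrier_mat N N" using Kc by simp
    show "Ks ! i * R * mat_adjoint (Ks ! i) \<in> carrier_mat N N"
      by (rule mult_carrier_mat[OF mult_carrier_mat[OF K Rc] mat_adjoint_carrier[OF K]])
  qed
  also have "\<dots> = of_real (\<Sum>i<length Ks. \<Sum>x\<in>S. p x * (cmod (cinner \<psi> (Ks ! i *\<^sub>v (U x *\<^sub>v \<psi>))))\<^sup>2)"
    unfolding of_real_sum by (rule sum.cong[OF refl]) (simp add: main[OF Kc])
  finally show ?thesis unfolding R_def by simp
qed

lemma kraus_tp_sum_norm:
  assumes tp: "kraus_tp N Ks" and \<phi>: "\<phi> \<in> carrier_vec N"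
  shows "(\<Sum>i<length Ks. cinner (Ks ! i *\<^sub>v \<phi>) (Ks ! i *\<^sub>v \<phi>)) = cinner \<phi> \<phi>"
proof -
  have Kc: "Ks ! i \<in> carrier_mat N N" if "i < length Ks" for i
    using tp nth_mem[OF that] unfolding kraus_tp_def by blast
  have "cinner \<phi> \<phi> = cinner \<phi> (msum N {..<length Ks} (\<lambda>i. mat_adjoint (Ks ! i) * Ks ! i) *\<^sub>v \<phi>)"
    using tp \<phi> unfolding kraus_tp_def by simp
  also have "\<dots> = (\<Sum>i<length Ks. cinner \<phi> ((mat_adjoint (Ks ! i) * Ks ! i) *\<^sub>v \<phi>))"
  proof (rule msum_mult_vec_cinner[OF \<phi> \<phi>])
    fix i assume "i \<in> {..<length Ks}"
    then show "mat_adjoint (Ks ! i) * Ks ! i \<in> carrier_mat N N"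
      using Kc by (intro mult_carrier_mat[of _ N N] mat_adjoint_carrier) simp_all
  qed
  also have "\<dots> = (\<Sum>i<length Ks. cinner (Ks ! i *\<^sub>v \<phi>) (Ks ! i *\<^sub>v \<phi>))"
  proof (rule sum.cong[OF refl])
    fix i assume "i \<in> {..<length Ks}"
    then have K: "Ks ! i \<in> carrier_mat N N" using Kc by simp
    have "(mat_adjoint (Ks ! i) * Ks ! i) *\<^sub>v \<phi> = mat_adjoint (Ks ! i) *\<^sub>v (Ks ! i *\<^sub>v \<phi>)"
      by (rule assoc_mult_mat_vec[OF mat_adjoint_carrier[OF K] K \<phi>])
    then show "cinner \<phi> ((mat_adjoint (Ks ! i) * Ks ! i) *\<^sub>v \<phi>) = cinner (Ks ! i *\<^sub>v \<phi>) (Ks ! i *\<^sub>v \<phi>)"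
      using cinner_adjoint[OF mat_adjoint_carrier[OF K] \<phi> mult_mat_vec_carrier[OF K \<phi>]] by simp
  qed
  finally show ?thesis by simp
qed

text \<open>Cauchy-Schwarz bounds each amplitude by the norm of the vector after the Kraus operator;
  trace preservation and unitarity add these squared norms to 1 for every error.\<close>

lemma kraus_mixture_fidelity_le_1:
  assumes tp: "kraus_tp N Ks" and U: "\<And>x. x \<in> S \<Longrightarrow> U x \<in> carrier_mat N N"
    and unit: "\<And>x. x \<in> S \<Longrightarrow> mat_adjoint (U x) * U x = 1\<^sub>m N"
    and p: "\<And>x. x \<in> S \<Longrightarrow> p x \<ge> 0" "(\<Sum>x\<in>S. p x) = 1"
    and \<psi>: "\<psi> \<in> carrier_vec N" "cinner \<psi> \<psi> = 1"
  shows "Re (cinner \<psi> (kraus_apply N Ks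
      (msum N S (\<lambda>x. of_real (p x) \<cdot>\<^sub>m (U x * outer \<psi> * mat_adjoint (U x)))) *\<^sub>v \<psi>)) \<le> 1"
proof -
  have Ks: "set Ks \<subseteq> carrier_mat N N" using tp by (simp add: kraus_tp_def)
  have Kc: "Ks ! i \<in> carrier_mat N N" if "i < length Ks" for i using Ks nth_mem[OF that] by blast
  have Uc: "U x *\<^sub>v \<psi> \<in> carrier_vec N" if "x \<in> S" for x by (rule mult_mat_vec_carrier[OF U[OF that] \<psi>(1)])
  have "(\<Sum>i<length Ks. \<Sum>x\<in>S. p x * (cmod (cinner \<psi> (Ks ! i *\<^sub>v (U x *\<^sub>v \<psi>))))\<^sup>2)
      \<le> (\<Sum>i<length Ks. \<Sum>x\<in>S. p x * Re (cinner (Ks ! i *\<^sub>v (U x *\<^sub>v \<psi>)) (Ks ! i *\<^sub>v (U x *\<^sub>v \<psi>))))"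
  proof (intro sum_mono mult_left_mono)
    fix i x assume ix: "i \<in> {..<length Ks}" "x \<in> S"
    have "Ks ! i *\<^sub>v (U x *\<^sub>v \<psi>) \<in> carrier_vec N"
      using ix by (intro mult_mat_vec_carrier[OF Kc Uc]) simp_all
    then show "(cmod (cinner \<psi> (Ks ! i *\<^sub>v (U x *\<^sub>v \<psi>))))\<^sup>2 \<le> Re (cinner (Ks ! i *\<^sub>v (U x *\<^sub>v \<psi>)) (Ks ! i *\<^sub>v (U x *\<^sub>v \<psi>)))"
      using cinner_Cauchy_Schwarz[of \<psi> "Ks ! i *\<^sub>v (U x *\<^sub>v \<psi>)"] \<psi> by (metis carrier_vecD mult_1 one_complex.simps(1))
  qed (use p in simp)
  also have "\<dots> = (\<Sum>x\<in>S. \<Sum>i<length Ks. p x * Re (cinner (Ks ! i *\<^sub>v (U x *\<^sub>v \<psi>)) (Ks ! i *\<^sub>v (U x *\<^sub>v \<psi>))))"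
    by (rule sum.swap)
  also have "\<dots> = (\<Sum>x\<in>S. p x * 1)"
  proof (rule sum.cong[OF refl])
    fix x assume x: "x \<in> S"
    have "(\<Sum>i<length Ks. p x * Re (cinner (Ks ! i *\<^sub>v (U x *\<^sub>v \<psi>)) (Ks ! i *\<^sub>v (U x *\<^sub>v \<psi>)))) =
        p x * Re (\<Sum>i<length Ks. cinner (Ks ! i *\<^sub>v (U x *\<^sub>v \<psi>)) (Ks ! i *\<^sub>v (U x *\<^sub>v \<psi>)))"
      by (simp add: sum_distrib_left)
    also have "\<dots> = p x * Re (cinner (U x *\<^sub>v \<psi>) (U x *\<^sub>v \<psi>))"
      by (simp only: kraus_tp_sum_norm[OF tp Uc[OF x]])
    also have "cinner (U x *\<^sub>v \<psi>) (U x *\<^sub>v \<psi>) = cinner (mat_adjoint (U x) *\<^sub>v (U x *\<^sub>v \<psi>)) \<psi>"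
      by (rule cinner_adjoint[OF U[OF x] Uc[OF x] \<psi>(1)])
    also have "mat_adjoint (U x) *\<^sub>v (U x *\<^sub>v \<psi>) = (mat_adjoint (U x) * U x) *\<^sub>v \<psi>"
      by (rule assoc_mult_mat_vec[OF mat_adjoint_carrier[OF U[OF x]] U[OF x] \<psi>(1), symmetric])
    finally show "(\<Sum>i<length Ks. p x * Re (cinner (Ks ! i *\<^sub>v (U x *\<^sub>v \<psi>)) (Ks ! i *\<^sub>v (U x *\<^sub>v \<psi>)))) = p x * 1"
      using unit[OF x] \<psi> by simp
  qed
  finally show ?thesis using p(2) by (simp add: kraus_mixture_fidelity[OF Ks U \<psi>(1)])
qed

section \<open>Stabilizer codes as subspaces\<close>

context weyl_system
begin

lemma csubspace_stab_code:
  assumes "M \<subseteq> carrier G" shows "csubspace D (stab_code M \<tau>)"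
proof -
  have W: "W g \<in> carrier_mat D D" if "g \<in> M" for g using that assms by (intro W_carrier) blast
  show ?thesis unfolding csubspace_def stab_code_def
  proof (intro conjI ballI allI)
    show "0\<^sub>v D \<in> {\<psi> \<in> carrier_vec D. \<forall>g\<in>M. W g *\<^sub>v \<psi> = \<tau> g \<cdot>\<^sub>v \<psi>}"
    proof (simp, intro ballI)
      fix g assume "g \<in> M"
      show "W g *\<^sub>v 0\<^sub>v D = \<tau> g \<cdot>\<^sub>v 0\<^sub>v D"
        by (rule eq_vecI) (use W[OF \<open>g \<in> M\<close>] in auto)
    qed
  next
    fix v w
    assume "v \<in> {\<psi> \<in> carrier_vec D. \<forall>g\<in>M. W g *\<^sub>v \<psi> = \<tau> g \<cdot>\<^sub>v \<psi>}" "w \<in> {\<psi> \<in> carrier_vec D. \<forall>g\<in>M. W g *\<^sub>v \<psi> = \<tau> g \<cdot>\<^sub>v \<psi>}"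
    then have vw: "v \<in> carrier_vec D" "w \<in> carrier_vec D"
      "\<And>g. g \<in> M \<Longrightarrow> W g *\<^sub>v v = \<tau> g \<cdot>\<^sub>v v" "\<And>g. g \<in> M \<Longrightarrow> W g *\<^sub>v w = \<tau> g \<cdot>\<^sub>v w" by auto
    have "W g *\<^sub>v (v + w) = \<tau> g \<cdot>\<^sub>v (v + w)" if g: "g \<in> M" for g
      using mult_add_distrib_mat_vec[OF W[OF g] vw(1,2)] vw(3,4)[OF g] smult_add_distrib_vec[OF vw(1,2)] by simp
    then show "v + w \<in> {\<psi> \<in> carrier_vec D. \<forall>g\<in>M. W g *\<^sub>v \<psi> = \<tau> g \<cdot>\<^sub>v \<psi>}" using vw by simp
  next
    fix c v
    assume "v \<in> {\<psi> \<in> carrier_vec D. \<forall>g\<in>M. W g *\<^sub>v \<psi> = \<tau> g \<cdot>\<^sub>v \<psi>}"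
    then have v: "v \<in> carrier_vec D" "\<And>g. g \<in> M \<Longrightarrow> W g *\<^sub>v v = \<tau> g \<cdot>\<^sub>v v" by auto
    have "W g *\<^sub>v (c \<cdot>\<^sub>v v) = \<tau> g \<cdot>\<^sub>v (c \<cdot>\<^sub>v v)" if g: "g \<in> M" for g
      using mult_mat_vec[OF W[OF g] v(1), of c] v(2)[OF g] by (simp add: smult_smult_assoc mult.commute)
    then show "c \<cdot>\<^sub>v v \<in> {\<psi> \<in> carrier_vec D. \<forall>g\<in>M. W g *\<^sub>v \<psi> = \<tau> g \<cdot>\<^sub>v \<psi>}" using v by simp
  qed auto
qed

lemma stab_proj_fixes_code:
  assumes "stab_char M \<tau>" "\<psi> \<in> stab_code M \<tau>"
  shows "stab_proj M \<tau> *\<^sub>v \<psi> = \<psi>"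
proof -
  note D = stab_charD[OF assms(1)]
  have \<psi>: "\<psi> \<in> carrier_vec D" and e: "\<And>g. g \<in> M \<Longrightarrow> W g *\<^sub>v \<psi> = \<tau> g \<cdot>\<^sub>v \<psi>"
    using assms(2) by (auto simp: stab_code_def)
  have W: "W g \<in> carrier_mat D D" if "g \<in> M" for g using that D(2) by (intro W_carrier) blast
  show ?thesis
  proof (rule cvec_eqI_cinner[OF mult_mat_vec_carrier[OF stab_proj_carrier \<psi>] \<psi>])
    fix u :: "complex vec" assume u: "u \<in> carrier_vec D"
    have "cinner u (msum D M (\<lambda>g. cnj (\<tau> g) \<cdot>\<^sub>m W g) *\<^sub>v \<psi>) = (\<Sum>g\<in>M. cinner u ((cnj (\<tau> g) \<cdot>\<^sub>m W g) *\<^sub>v \<psi>))"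
      by (rule msum_mult_vec_cinner[OF u \<psi>]) (use W in simp)
    also have "\<dots> = (\<Sum>g\<in>M. cinner u \<psi>)"
    proof (rule sum.cong[OF refl])
      fix g assume g: "g \<in> M"
      have "(cnj (\<tau> g) \<cdot>\<^sub>m W g) *\<^sub>v \<psi> = (\<tau> g * cnj (\<tau> g)) \<cdot>\<^sub>v \<psi>"
        using smult_mat_mult_vec[OF W[OF g] \<psi>] e[OF g] by (simp add: smult_smult_assoc mult.commute)
      then show "cinner u ((cnj (\<tau> g) \<cdot>\<^sub>m W g) *\<^sub>v \<psi>) = cinner u \<psi>" using D(7)[OF g] by simp
    qed
    finally have s: "cinner u (msum D M (\<lambda>g. cnj (\<tau> g) \<cdot>\<^sub>m W g) *\<^sub>v \<psi>) = of_nat (card M) * cinner u \<psi>" by simp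
    have "stab_proj M \<tau> *\<^sub>v \<psi> = (1 / of_nat (card M)) \<cdot>\<^sub>v (msum D M (\<lambda>g. cnj (\<tau> g) \<cdot>\<^sub>m W g) *\<^sub>v \<psi>)"
      unfolding stab_proj_def by (rule smult_mat_mult_vec[OF msum_carrier \<psi>])
    then have "cinner u (stab_proj M \<tau> *\<^sub>v \<psi>) = (1 / of_nat (card M)) * cinner u (msum D M (\<lambda>g. cnj (\<tau> g) \<cdot>\<^sub>m W g) *\<^sub>v \<psi>)"
      using cinner_smult_right[of "msum D M (\<lambda>g. cnj (\<tau> g) \<cdot>\<^sub>m W g) *\<^sub>v \<psi>" u] u by simp
    then show "cinner u (stab_proj M \<tau> *\<^sub>v \<psi>) = cinner u \<psi>" unfolding s using D(4) by simp
  qed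
qed

text \<open>The Fourier average maps into the code, fixes it and is self-adjoint, so it satisfies
  the characterisation of the orthogonal projection; its trace is then the dimension.\<close>

lemma
  assumes "stab_char M \<tau>"
  shows proj_stab_code: "proj D (stab_code M \<tau>) = stab_proj M \<tau>"
    and cdim_stab_code: "of_nat (cdim D (stab_code M \<tau>)) = (of_nat D / of_nat (card M) :: complex)"
proof -
  note D = stab_charD[OF assms]
  let ?P = "stab_proj M \<tau>"
  have W: "W g \<in> carrier_mat D D" if "g \<in> M" for g using that D(2) by (intro W_carrier) blast
  have C: "csubspace D (stab_code M \<tau>)" by (rule csubspace_stab_code[OF D(2)])
  have mem: "?P *\<^sub>v v \<in> stab_code M \<tau>" if v: "v \<in> carrier_vec D" for v
    unfolding stab_code_def
  proof (intro CollectI conjI ballI)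
    show "?P *\<^sub>v v \<in> carrier_vec D" by (rule mult_mat_vec_carrier[OF stab_proj_carrier v])
    fix g assume g: "g \<in> M"
    have "W g *\<^sub>v (?P *\<^sub>v v) = (W g * ?P) *\<^sub>v v"
      by (rule assoc_mult_mat_vec[OF W[OF g] stab_proj_carrier v, symmetric])
    then show "W g *\<^sub>v (?P *\<^sub>v v) = \<tau> g \<cdot>\<^sub>v (?P *\<^sub>v v)"
      unfolding W_stab_proj(1)[OF assms g] by (simp only: smult_mat_mult_vec[OF stab_proj_carrier v])
  qed
  have orth: "cinner w (v - ?P *\<^sub>v v) = 0" if v: "v \<in> carrier_vec D" and w: "w \<in> stab_code M \<tau>" for v w
  proof -
    have wc: "w \<in> carrier_vec D" using w by (simp add: stab_code_def)
    have Pv: "?P *\<^sub>v v \<in> carrier_vec D" by (rule mult_mat_vec_carrier[OF stab_proj_carrier v])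
    have "cinner w (?P *\<^sub>v v) = cinner (mat_adjoint ?P *\<^sub>v w) v" by (rule cinner_adjoint[OF stab_proj_carrier wc v])
    also have "\<dots> = cinner w v" by (simp only: stab_proj_adjoint[OF assms] stab_proj_fixes_code[OF assms w])
    finally show ?thesis using cinner_minus_right[of v w "?P *\<^sub>v v"] carrier_vecD[OF v] carrier_vecD[OF wc] carrier_vecD[OF Pv] by simp
  qed
  show "proj D (stab_code M \<tau>) = ?P" by (rule proj_eqI[OF C stab_proj_carrier mem orth])
  show "of_nat (cdim D (stab_code M \<tau>)) = (of_nat D / of_nat (card M) :: complex)"
    using cdim_eq_mtrace[OF C stab_proj_carrier mem orth] mtrace_stab_proj[OF assms] by simp
qed

end

section \<open>Decoding and one-shot codes\<close>

context weyl_system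
begin

text \<open>Errors in the same coset of \<open>perp M\<close> have the same syndrome and so move the
  code to the same subspace.\<close>

lemma stab_proj_translate_eq:
  assumes st: "stab_char M \<tau>" and x: "x \<in> carrier G" "y \<in> carrier G" and xy: "inv x \<otimes> y \<in> perp M"
  shows "stab_proj M (\<lambda>g. \<tau> g * chi g y) = stab_proj M (\<lambda>g. \<tau> g * chi g x)"
proof (rule stab_proj_cong)
  fix g assume g: "g \<in> M"
  then have gc: "g \<in> carrier G" using stab_charD(2)[OF st] by blast
  have "y = x \<otimes> (inv x \<otimes> y)" using x by (simp add: m_assoc[symmetric])
  then have "chi g y = chi g x * chi g (inv x \<otimes> y)" using chi_mult_right[of g x "inv x \<otimes> y"] x gc by simp
  then show "\<tau> g * chi g y = \<tau> g * chi g x" using perpD[OF xy g] by simp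
qed

(* The Kraus operators are indexed by all errors x rather than by syndromes, each syndrome being
   counted card (perp M) times; this avoids choosing coset representatives. *)
lemma recovery_from_decoder:
  assumes st: "stab_char M \<tau>" and p: "\<And>x. x \<in> carrier G \<Longrightarrow> p x \<ge> 0"
    and r: "\<And>x. x \<in> carrier G \<Longrightarrow> r x \<in> carrier G"
    and rx: "\<And>x. x \<in> carrier G \<Longrightarrow> inv x \<otimes> r x \<in> perp M"
    and rc: "\<And>x y. x \<in> carrier G \<Longrightarrow> y \<in> carrier G \<Longrightarrow> inv x \<otimes> y \<in> perp M \<Longrightarrow> r y = r x"
  shows "\<exists>Ks. kraus_tp D Ks \<and> (\<forall>\<psi>\<in>stab_code M \<tau>. cinner \<psi> \<psi> = 1 \<longrightarrow>
    (\<Sum>e\<in>{e\<in>carrier G. inv e \<otimes> r e \<in> M}. p e) \<le> Re (cinner \<psi> (kraus_apply D Ks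
      (msum D (carrier G) (\<lambda>x. of_real (p x) \<cdot>\<^sub>m (W x * outer \<psi> * mat_adjoint (W x)))) *\<^sub>v \<psi>)))"
proof -
  note Dd = stab_charD[OF st]
  let ?P = "stab_proj M \<tau>"
  \<comment> \<open>By \<open>card_perp\<close>, s squared is the inverse of
    \<open>card (perp M)\<close>, compensating the multiplicity with which each syndrome is
    counted.\<close>
  define s where "s = sqrt (real (card M) / real (card (carrier G)))"
  have G0: "card (carrier G) > 0" using fin one_closed by (auto simp: card_gt_0_iff)
  have ss: "s * s = real (card M) / real (card (carrier G))" by (simp add: s_def)
  \<comment> \<open>Undo the guessed error \<open>r x\<close>, then project onto the code. As
    \<open>r x\<close> has the syndrome of x, this first tests for that syndrome: K adjoint times K
    is a multiple of the syndrome projection.\<close>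
  define K where "K x = of_real s \<cdot>\<^sub>m (?P * mat_adjoint (W (r x)))" for x
  obtain xs where xs: "set xs = carrier G" "distinct xs" using finite_distinct_list[OF fin] by blast
  define Ks where "Ks = map K xs"
  have bij: "bij_betw (\<lambda>i. xs ! i) {..<length Ks} (carrier G)"
    unfolding Ks_def using bij_betw_nth[OF xs(2), of "{..<length xs}" "carrier G"] xs(1) by simp
  have nth: "Ks ! i = K (xs ! i)" if "i < length Ks" for i using that by (simp add: Ks_def)
  have Wr: "W (r x) \<in> carrier_mat D D" "mat_adjoint (W (r x)) \<in> carrier_mat D D" if "x \<in> carrier G" for x
    using r[OF that] by simp_all
  have Kc: "K x \<in> carrier_mat D D" if "x \<in> carrier G" for x
    unfolding K_def using Wr[OF that] by (simp add: square_mat_simps)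
  have Ksc: "set Ks \<subseteq> carrier_mat D D" unfolding Ks_def using Kc xs(1) by auto
  have PP: "?P * ?P = ?P" using stab_proj_mult[OF st st] by simp
  have KK: "mat_adjoint (K x) * K x = of_real (s * s) \<cdot>\<^sub>m stab_proj M (\<lambda>g. \<tau> g * chi g x)" if x: "x \<in> carrier G" for x
  proof -
    have "mat_adjoint (K x) = of_real s \<cdot>\<^sub>m (W (r x) * ?P)"
      unfolding K_def mat_adjoint_smult
      using mat_adjoint_mult[OF stab_proj_carrier Wr(2)[OF x]] stab_proj_adjoint[OF st] by simp
    then have "mat_adjoint (K x) * K x = of_real (s * s) \<cdot>\<^sub>m (W (r x) * (?P * ?P) * mat_adjoint (W (r x)))"
      unfolding K_def using Wr[OF x] by (simp add: square_mat_simps smult_smult_mat)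
    also have "\<dots> = of_real (s * s) \<cdot>\<^sub>m stab_proj M (\<lambda>g. \<tau> g * chi g (r x))"
      unfolding PP stab_proj_conj[OF st r[OF x]] ..
    also have "stab_proj M (\<lambda>g. \<tau> g * chi g (r x)) = stab_proj M (\<lambda>g. \<tau> g * chi g x)"
      by (rule stab_proj_translate_eq[OF st x r[OF x] rx[OF x]])
    finally show ?thesis .
  qed
  have "msum D {..<length Ks} (\<lambda>i. mat_adjoint (Ks ! i) * Ks ! i) =
      msum D {..<length Ks} (\<lambda>i. mat_adjoint (K (xs ! i)) * K (xs ! i))"
    by (rule msum_cong[OF refl]) (simp add: nth)
  also have "\<dots> = msum D (carrier G) (\<lambda>x. mat_adjoint (K x) * K x)"
    by (rule msum_reindex_bij[OF bij])
  also have "\<dots> = msum D (carrier G) (\<lambda>x. of_real (s * s) \<cdot>\<^sub>m stab_proj M (\<lambda>g. \<tau> g * chi g x))"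
    by (rule msum_cong[OF refl KK])
  also have "\<dots> = of_real (s * s) \<cdot>\<^sub>m msum D (carrier G) (\<lambda>x. stab_proj M (\<lambda>g. \<tau> g * chi g x))"
    by (rule smult_msum[symmetric]) simp
  also have "\<dots> = 1\<^sub>m D"
    unfolding sum_stab_proj_translates[OF st] ss using G0 Dd(4) by (simp add: smult_smult_mat)
  finally have tp: "kraus_tp D Ks" using Ksc by (simp add: kraus_tp_def)
  have "(\<Sum>e\<in>{e\<in>carrier G. inv e \<otimes> r e \<in> M}. p e) \<le>
      (\<Sum>i<length Ks. \<Sum>x\<in>carrier G. p x * (cmod (cinner \<psi> (Ks ! i *\<^sub>v (W x *\<^sub>v \<psi>))))\<^sup>2)"
    if \<psi>: "\<psi> \<in> stab_code M \<tau>" "cinner \<psi> \<psi> = 1" for \<psi>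
  proof -
    have \<psi>c: "\<psi> \<in> carrier_vec D" and eig: "\<And>g. g \<in> M \<Longrightarrow> W g *\<^sub>v \<psi> = \<tau> g \<cdot>\<^sub>v \<psi>"
      using \<psi>(1) by (auto simp: stab_code_def)
    define F where "F x e = p e * (cmod (cinner \<psi> (K x *\<^sub>v (W e *\<^sub>v \<psi>))))\<^sup>2" for x e
    have F0: "F x e \<ge> 0" if "e \<in> carrier G" for x e using p[OF that] by (simp add: F_def)
    define good where "good = {e\<in>carrier G. inv e \<otimes> r e \<in> M}"
    define cos where "cos e = (\<lambda>w. e \<otimes> w) ` perp M" for e
    \<comment> \<open>For a correctly decoded e, the guess differs from e by an element of M, which
      acts on the code as a phase. Hence every Kraus operator with the syndrome of e returns \<psi>
      with an amplitude of modulus s.\<close>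
    have val: "F x e = p e * (s * s)" if e: "e \<in> good" and x: "x \<in> cos e" for e x
    proof -
      have ec: "e \<in> carrier G" and gM: "inv e \<otimes> r e \<in> M" using e by (auto simp: good_def)
      from x obtain w where w: "w \<in> perp M" "x = e \<otimes> w" by (auto simp: cos_def)
      have wc: "w \<in> carrier G" by (rule perp_mem_carrier[OF w(1)])
      have xc: "x \<in> carrier G" using w ec wc by simp
      have "inv e \<otimes> x = w" using w(2) ec wc by (simp add: m_assoc[symmetric])
      then have rr: "r x = r e" using rc[OF ec xc] w(1) by simp
      define g where "g = inv e \<otimes> r e"
      have gc: "g \<in> carrier G" using ec r[OF ec] by (simp add: g_def)
      have re: "r e = e \<otimes> g" using ec r[OF ec] by (simp add: g_def m_assoc[symmetric])
      have gM': "g \<in> M" using gM by (simp add: g_def)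
      define a where "a = \<beta> e g / \<tau> g"
      have a1: "cmod a = 1" using \<beta>_unit[OF ec gc] Dd(5)[OF gM'] by (simp add: a_def norm_divide)
      have We: "W e *\<^sub>v \<psi> \<in> carrier_vec D" by (rule mult_mat_vec_carrier[OF W_carrier[OF ec] \<psi>c])
      have Wre: "W (r e) *\<^sub>v \<psi> \<in> carrier_vec D" by (rule mult_mat_vec_carrier[OF Wr(1)[OF ec] \<psi>c])
      have "\<tau> g \<cdot>\<^sub>v (W e *\<^sub>v \<psi>) = W e *\<^sub>v (W g *\<^sub>v \<psi>)"
        unfolding eig[OF gM'] by (rule mult_mat_vec[OF W_carrier[OF ec] \<psi>c, symmetric])
      also have "\<dots> = (W e * W g) *\<^sub>v \<psi>"
        by (rule assoc_mult_mat_vec[OF W_carrier[OF ec] W_carrier[OF gc] \<psi>c, symmetric])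
      also have "\<dots> = \<beta> e g \<cdot>\<^sub>v (W (r e) *\<^sub>v \<psi>)"
        unfolding W_mult[OF ec gc] re[symmetric] by (rule smult_mat_mult_vec[OF Wr(1)[OF ec] \<psi>c])
      finally have 1: "\<tau> g \<cdot>\<^sub>v (W e *\<^sub>v \<psi>) = \<beta> e g \<cdot>\<^sub>v (W (r e) *\<^sub>v \<psi>)" .
      have "W e *\<^sub>v \<psi> = (1 / \<tau> g) \<cdot>\<^sub>v (\<tau> g \<cdot>\<^sub>v (W e *\<^sub>v \<psi>))"
        using Dd(6)[OF gM'] by (simp add: smult_smult_assoc)
      also have "\<dots> = a \<cdot>\<^sub>v (W (r e) *\<^sub>v \<psi>)" unfolding 1 by (simp add: smult_smult_assoc a_def)
      finally have We_eq: "W e *\<^sub>v \<psi> = a \<cdot>\<^sub>v (W (r e) *\<^sub>v \<psi>)" .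
      have "mat_adjoint (W (r e)) *\<^sub>v (W e *\<^sub>v \<psi>) = a \<cdot>\<^sub>v (mat_adjoint (W (r e)) *\<^sub>v (W (r e) *\<^sub>v \<psi>))"
        unfolding We_eq by (rule mult_mat_vec[OF Wr(2)[OF ec] Wre])
      also have "mat_adjoint (W (r e)) *\<^sub>v (W (r e) *\<^sub>v \<psi>) = (mat_adjoint (W (r e)) * W (r e)) *\<^sub>v \<psi>"
        by (rule assoc_mult_mat_vec[OF Wr(2)[OF ec] Wr(1)[OF ec] \<psi>c, symmetric])
      also have "\<dots> = \<psi>" using W_unitary[OF r[OF ec]] \<psi>c by simp
      finally have 2: "mat_adjoint (W (r e)) *\<^sub>v (W e *\<^sub>v \<psi>) = a \<cdot>\<^sub>v \<psi>" .
      have "K x *\<^sub>v (W e *\<^sub>v \<psi>) = of_real s \<cdot>\<^sub>v ((?P * mat_adjoint (W (r e))) *\<^sub>v (W e *\<^sub>v \<psi>))"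
        unfolding K_def rr using Wr[OF ec] by (intro smult_mat_mult_vec[of _ D D] We) (simp add: square_mat_simps)
      also have "(?P * mat_adjoint (W (r e))) *\<^sub>v (W e *\<^sub>v \<psi>) = ?P *\<^sub>v (mat_adjoint (W (r e)) *\<^sub>v (W e *\<^sub>v \<psi>))"
        by (rule assoc_mult_mat_vec[OF stab_proj_carrier Wr(2)[OF ec] We])
      also have "\<dots> = a \<cdot>\<^sub>v \<psi>"
        unfolding 2 mult_mat_vec[OF stab_proj_carrier \<psi>c] stab_proj_fixes_code[OF st \<psi>(1)] ..
      finally have "cinner \<psi> (K x *\<^sub>v (W e *\<^sub>v \<psi>)) = of_real s * a"
        using cinner_smult_right[of \<psi> \<psi> "of_real s * a"] \<psi>(2) by (simp add: smult_smult_assoc)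
      then have "(cmod (cinner \<psi> (K x *\<^sub>v (W e *\<^sub>v \<psi>))))\<^sup>2 = s * s"
        using a1 by (simp add: norm_mult power2_eq_square)
      then show ?thesis by (simp add: F_def)
    qed
    have cosc: "cos e \<subseteq> carrier G" "card (cos e) = card (perp M)" if "e \<in> carrier G" for e
    proof -
      show "cos e \<subseteq> carrier G" unfolding cos_def using that perp_carrier by auto
      have "inj_on (\<lambda>w. e \<otimes> w) (perp M)"
        by (rule inj_onI) (use that perp_mem_carrier in simp)
      then show "card (cos e) = card (perp M)" unfolding cos_def by (rule card_image)
    qed
    \<comment> \<open>The \<open>card (perp M)\<close> operators sharing the syndrome of e
      contribute the square of s each, in total 1. All remaining pairs of errors and operators have
      nonnegative contributions and are discarded.\<close>
    have "(\<Sum>e\<in>good. p e) = (\<Sum>e\<in>good. \<Sum>x\<in>cos e. F x e)"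
    proof (rule sum.cong[OF refl])
      fix e assume e: "e \<in> good"
      then have ec: "e \<in> carrier G" by (simp add: good_def)
      have "(\<Sum>x\<in>cos e. F x e) = (\<Sum>x\<in>cos e. p e * (s * s))" by (rule sum.cong[OF refl]) (rule val[OF e])
      also have "\<dots> = p e * (real (card M * card (perp M)) / real (card (carrier G)))"
        unfolding ss by (simp add: cosc(2)[OF ec])
      also have "\<dots> = p e" unfolding card_perp[OF Dd(1)] using G0 by simp
      finally show "p e = (\<Sum>x\<in>cos e. F x e)" by simp
    qed
    also have "\<dots> \<le> (\<Sum>e\<in>good. \<Sum>x\<in>carrier G. F x e)"
      by (intro sum_mono sum_mono2 fin cosc(1) F0) (simp_all add: good_def)
    also have "\<dots> \<le> (\<Sum>e\<in>carrier G. \<Sum>x\<in>carrier G. F x e)"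
      by (intro sum_mono2 fin sum_nonneg F0) (auto simp: good_def)
    also have "\<dots> = (\<Sum>x\<in>carrier G. \<Sum>e\<in>carrier G. F x e)" by (rule sum.swap)
    also have "\<dots> = (\<Sum>i<length Ks. \<Sum>e\<in>carrier G. F (xs ! i) e)"
      by (rule sum.reindex_bij_betw[OF bij, symmetric])
    also have "\<dots> = (\<Sum>i<length Ks. \<Sum>x\<in>carrier G. p x * (cmod (cinner \<psi> (Ks ! i *\<^sub>v (W x *\<^sub>v \<psi>))))\<^sup>2)"
      by (rule sum.cong[OF refl]) (simp add: F_def nth)
    finally show ?thesis unfolding good_def .
  qed
  moreover have "\<psi> \<in> carrier_vec D" if "\<psi> \<in> stab_code M \<tau>" for \<psi> using that by (simp add: stab_code_def)
  ultimately show ?thesis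
    by (intro exI[of _ Ks] conjI tp ballI impI) (simp only: kraus_mixture_fidelity[OF Ksc W_carrier])
qed

text \<open>A decoder may depend only on the syndrome. The maximiser is therefore chosen from the
  coset as a set: equal cosets yield the same choice, which makes r constant on each of
  them.\<close>

lemma coset_maximizer_exists:
  fixes q :: "'a \<Rightarrow> real"
  assumes M: "M \<subseteq> carrier G"
  shows "\<exists>r. \<forall>x\<in>carrier G. r x \<in> carrier G \<and> inv x \<otimes> r x \<in> perp M \<and> q x \<le> q (r x) \<and>
    (\<forall>y\<in>carrier G. inv x \<otimes> y \<in> perp M \<longrightarrow> r y = r x)"
proof -
  have P: "subgroup (perp M) G" by (rule subgroup_perp[OF M])
  define cos where "cos x = {y \<in> carrier G. inv x \<otimes> y \<in> perp M}" for x
  define r where "r x = (SOME y. y \<in> cos x \<and> (\<forall>z\<in>cos x. q z \<le> q y))" for x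
  have self: "x \<in> cos x" if "x \<in> carrier G" for x
    using that subgroup.one_closed[OF P] by (simp add: cos_def)
  have ex: "\<exists>y. y \<in> cos x \<and> (\<forall>z\<in>cos x. q z \<le> q y)" if x: "x \<in> carrier G" for x
  proof -
    have f: "finite (q ` cos x)" "q ` cos x \<noteq> {}" using fin self[OF x] by (auto simp: cos_def)
    obtain y where "y \<in> cos x" "q y = Max (q ` cos x)" using Max_in[OF f] by (metis imageE)
    then show ?thesis using Max_ge[OF f(1)] by (intro exI[of _ y]) simp
  qed
  have rr: "r x \<in> cos x" "\<And>z. z \<in> cos x \<Longrightarrow> q z \<le> q (r x)" if "x \<in> carrier G" for x
    using someI_ex[OF ex[OF that]] unfolding r_def by blast+
  have coseq: "cos y = cos x" if x: "x \<in> carrier G" and y: "y \<in> carrier G" and xy: "inv x \<otimes> y \<in> perp M" for x y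
  proof -
    have "inv y \<otimes> z = inv (inv x \<otimes> y) \<otimes> (inv x \<otimes> z)" "inv x \<otimes> z = (inv x \<otimes> y) \<otimes> (inv y \<otimes> z)"
      if z: "z \<in> carrier G" for z
    proof -
      have "inv (inv x \<otimes> y) = inv y \<otimes> x" using x y by (simp add: inv_mult_group)
      then have "inv (inv x \<otimes> y) \<otimes> (inv x \<otimes> z) = inv y \<otimes> (x \<otimes> inv x) \<otimes> z"
        using x y z by (simp only: m_assoc inv_closed m_closed)
      then show "inv y \<otimes> z = inv (inv x \<otimes> y) \<otimes> (inv x \<otimes> z)" using x y z by simp
      have "(inv x \<otimes> y) \<otimes> (inv y \<otimes> z) = inv x \<otimes> (y \<otimes> inv y) \<otimes> z"
        using x y z by (simp only: m_assoc inv_closed m_closed)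
      then show "inv x \<otimes> z = (inv x \<otimes> y) \<otimes> (inv y \<otimes> z)" using x y z by simp
    qed
    then have "inv y \<otimes> z \<in> perp M \<longleftrightarrow> inv x \<otimes> z \<in> perp M" if "z \<in> carrier G" for z
      using that subgroup.m_closed[OF P] subgroup.m_inv_closed[OF P] xy by metis
    then show ?thesis unfolding cos_def by (intro Collect_cong) (meson)
  qed
  show ?thesis
  proof (intro exI[of _ r] ballI conjI impI)
    fix x assume x: "x \<in> carrier G"
    show "r x \<in> carrier G" "inv x \<otimes> r x \<in> perp M" using rr(1)[OF x] by (simp_all add: cos_def)
    show "q x \<le> q (r x)" by (rule rr(2)[OF x self[OF x]])
    show "r y = r x" if "y \<in> carrier G" "inv x \<otimes> y \<in> perp M" for y
      unfolding r_def coseq[OF x that] ..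
  qed
qed

(* Decode to the coset of L that is most likely given the syndrome.  A decoding failure at e
   produces card L elements w of perp M - M with q (e \<otimes> w) \<ge> q e; as M was chosen by averaging,
   the expected number of such w shrinks by d^j when passing from L to M. *)
lemma one_shot_code:
  fixes p :: "'a \<Rightarrow> real" and B :: real
  assumes L: "subgroup L G" "L \<subseteq> perp L"
    and p: "\<And>x. x \<in> carrier G \<Longrightarrow> p x \<ge> 0" "(\<Sum>x\<in>carrier G. p x) = 1"
    and j: "(d ^ j * card L) ^ 2 \<le> card (carrier G)" and B: "B \<ge> 0"
  shows "\<exists>C Ks. csubspace D C \<and> kraus_tp D Ks \<and> real D \<le> real (cdim D C) * real (d ^ j * card L) \<and>
    (\<forall>\<psi>\<in>C. cinner \<psi> \<psi> = 1 \<longrightarrow>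
      1 - (\<Sum>e\<in>{e\<in>carrier G. B * (\<Sum>l\<in>L. p (e \<otimes> l)) < (\<Sum>w\<in>perp L. p (e \<otimes> w))}. p e) - B / real d ^ j
      \<le> Re (cinner \<psi> (kraus_apply D Ks
        (msum D (carrier G) (\<lambda>x. of_real (p x) \<cdot>\<^sub>m (W x * outer \<psi> * mat_adjoint (W x)))) *\<^sub>v \<psi>)))"
proof -
  have Lc: "L \<subseteq> carrier G" by (rule subgroup.subset[OF L(1)])
  have fL: "finite L" by (rule finite_subset[OF Lc fin])
  have L0: "card L > 0" by (rule subgroup.finite_imp_card_positive[OF L(1) fin])
  have PL: "subgroup (perp L) G" by (rule subgroup_perp[OF Lc])
  have fP: "finite (perp N)" for N by (rule finite_subset[OF perp_carrier fin])
  define q where "q x = (\<Sum>l\<in>L. p (x \<otimes> l))" for x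
  define Q where "Q x = (\<Sum>w\<in>perp L. p (x \<otimes> w))" for x
  \<comment> \<open>The typical errors: given the syndrome with respect to L, the class of e modulo
    L has conditional probability at least 1 / B.\<close>
  define A where "A = {e\<in>carrier G. Q e \<le> B * q e}"
  have Ac: "A \<subseteq> carrier G" by (auto simp: A_def)
  have fA: "finite A" by (rule finite_subset[OF Ac fin])
  \<comment> \<open>The expected number of competing classes to which w leads from a typical error.
    Division by \<open>card L\<close> accounts for the elements of one coset of L all giving the
    same class.\<close>
  define c where "c w = (\<Sum>e\<in>A. p e * (of_bool (q e \<le> q (e \<otimes> w)) / real (card L)))" for w
  have c0: "c w \<ge> 0" for w unfolding c_def using p(1) Ac by (intro sum_nonneg mult_nonneg_nonneg) auto
  obtain M where *: "subgroup M G \<and> L \<subseteq> M \<and> M \<subseteq> perp M \<and> card M \<le> d ^ j * card L \<and>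
    real d ^ j * (\<Sum>w\<in>perp M - M. c w) \<le> (\<Sum>w\<in>perp L - L. c w)"
    by (rule exE[OF isotropic_extension[where L = L and c = c, OF L c0 j]])
  note M = *[THEN conjunct1] *[THEN conjunct2, THEN conjunct1] *[THEN conjunct2, THEN conjunct2, THEN conjunct1]
    *[THEN conjunct2, THEN conjunct2, THEN conjunct2, THEN conjunct1]
  note Msum = *[THEN conjunct2, THEN conjunct2, THEN conjunct2, THEN conjunct2]
  have Mc: "M \<subseteq> carrier G" by (rule subgroup.subset[OF M(1)])
  obtain \<tau> where st: "stab_char M \<tau>" using isotropic_stab_char_exists[OF M(1,3)] by metis
  obtain r where r: "\<And>x. x \<in> carrier G \<Longrightarrow> r x \<in> carrier G" "\<And>x. x \<in> carrier G \<Longrightarrow> inv x \<otimes> r x \<in> perp M"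
    "\<And>x. x \<in> carrier G \<Longrightarrow> q x \<le> q (r x)"
    "\<And>x y. x \<in> carrier G \<Longrightarrow> y \<in> carrier G \<Longrightarrow> inv x \<otimes> y \<in> perp M \<Longrightarrow> r y = r x"
    using coset_maximizer_exists[OF Mc, of q] by metis
  have q_inv: "q (x \<otimes> l) = q x" if x: "x \<in> carrier G" and l: "l \<in> L" for x l
  proof -
    have lc: "l \<in> carrier G" using l Lc by blast
    have "q (x \<otimes> l) = (\<Sum>k\<in>L. p (x \<otimes> (l \<otimes> k)))"
      unfolding q_def by (rule sum.cong[OF refl]) (use x lc Lc m_assoc in \<open>simp add: subset_iff\<close>)
    also have "\<dots> = q x" unfolding q_def
      by (rule sum.reindex_bij_betw[OF subgroup_translate_bij[OF L(1) l], of "\<lambda>k. p (x \<otimes> k)"])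
    finally show ?thesis .
  qed
  \<comment> \<open>Every competing class has mass at least \<open>q e\<close>, and all classes with
    this syndrome together have mass \<open>Q e\<close>, at most B times \<open>q e\<close>; so
    there are at most B of them. The factor \<open>p e\<close> disposes of the case in which
    \<open>q e\<close> might vanish.\<close>
  have count_bound: "p e * (real (card {w\<in>perp L. q e \<le> q (e \<otimes> w)}) / real (card L)) \<le> p e * B" if e: "e \<in> A" for e
  proof (cases "p e = 0")
    case False
    have ec: "e \<in> carrier G" and eA: "Q e \<le> B * q e" using e by (auto simp: A_def)
    have pe: "p e > 0" using p(1)[OF ec] False by simp
    have "p (e \<otimes> \<one>) \<le> q e" unfolding q_def
      by (rule member_le_sum[of \<one> L "\<lambda>l. p (e \<otimes> l)"]) (use subgroup.one_closed[OF L(1)] p(1) ec Lc fL in auto)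
    then have q0: "q e > 0" using pe ec by simp
    let ?S = "{w\<in>perp L. q e \<le> q (e \<otimes> w)}"
    have "real (card ?S) * q e = (\<Sum>w\<in>?S. q e)" by simp
    also have "\<dots> \<le> (\<Sum>w\<in>?S. q (e \<otimes> w))" by (rule sum_mono) simp
    also have "\<dots> \<le> (\<Sum>w\<in>perp L. q (e \<otimes> w))"
    proof (rule sum_mono2[OF fP])
      fix w assume "w \<in> perp L - ?S"
      then have "w \<in> carrier G" using perp_mem_carrier by blast
      then show "0 \<le> q (e \<otimes> w)" unfolding q_def using p(1) ec Lc by (intro sum_nonneg) auto
    qed simp
    also have "\<dots> = (\<Sum>l\<in>L. \<Sum>w\<in>perp L. p (e \<otimes> w \<otimes> l))" unfolding q_def by (rule sum.swap)
    also have "\<dots> = (\<Sum>l\<in>L. Q e)"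
    proof (rule sum.cong[OF refl])
      fix l assume l: "l \<in> L"
      have lP: "l \<in> perp L" using L(2) l by (rule subsetD)
      have lc: "l \<in> carrier G" using l Lc by blast
      have "(\<Sum>w\<in>perp L. p (e \<otimes> w \<otimes> l)) = (\<Sum>w\<in>perp L. p (e \<otimes> (l \<otimes> w)))"
      proof (rule sum.cong[OF refl])
        fix w assume "w \<in> perp L"
        then have wc: "w \<in> carrier G" by (rule perp_mem_carrier)
        show "p (e \<otimes> w \<otimes> l) = p (e \<otimes> (l \<otimes> w))" using m_assoc[OF ec wc lc] m_comm[OF wc lc] by simp
      qed
      also have "\<dots> = Q e" unfolding Q_def
        by (rule sum.reindex_bij_betw[OF subgroup_translate_bij[OF PL lP], of "\<lambda>w. p (e \<otimes> w)"])
      finally show "(\<Sum>w\<in>perp L. p (e \<otimes> w \<otimes> l)) = Q e" .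
    qed
    also have "\<dots> = real (card L) * Q e" by simp
    also have "\<dots> \<le> real (card L) * (B * q e)" by (rule mult_left_mono[OF eA]) simp
    finally have "real (card ?S) * q e \<le> (real (card L) * B) * q e" by (simp add: mult.assoc)
    then have "real (card ?S) \<le> real (card L) * B" using q0 by simp
    then have "real (card ?S) / real (card L) \<le> B" using L0 by (simp add: divide_le_eq mult.commute)
    then show ?thesis using pe by (intro mult_left_mono) simp_all
  qed simp
  have cL: "(\<Sum>w\<in>perp L - L. c w) \<le> B"
  proof -
    have "(\<Sum>w\<in>perp L - L. c w) \<le> (\<Sum>w\<in>perp L. c w)"
      by (rule sum_mono2[OF fP]) (use c0 in auto)
    also have "\<dots> = (\<Sum>e\<in>A. \<Sum>w\<in>perp L. p e * (of_bool (q e \<le> q (e \<otimes> w)) / real (card L)))"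
      unfolding c_def by (rule sum.swap)
    also have "\<dots> = (\<Sum>e\<in>A. p e * (real (card {w\<in>perp L. q e \<le> q (e \<otimes> w)}) / real (card L)))"
    proof (rule sum.cong[OF refl])
      fix e
      have "(\<Sum>w\<in>perp L. of_bool (q e \<le> q (e \<otimes> w))) = real (card {w\<in>perp L. q e \<le> q (e \<otimes> w)})"
        using fP[of L] by (simp add: of_bool_def sum.inter_filter[symmetric])
      then show "(\<Sum>w\<in>perp L. p e * (of_bool (q e \<le> q (e \<otimes> w)) / real (card L))) =
        p e * (real (card {w\<in>perp L. q e \<le> q (e \<otimes> w)}) / real (card L))"
        by (simp only: sum_distrib_left[symmetric] sum_divide_distrib[symmetric])
    qed
    also have "\<dots> \<le> (\<Sum>e\<in>A. p e * B)" by (rule sum_mono[OF count_bound])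
    also have "\<dots> \<le> (\<Sum>e\<in>carrier G. p e * B)"
      by (rule sum_mono2[OF fin Ac]) (use p(1) B in auto)
    also have "\<dots> = B" using p(2) by (simp add: sum_distrib_right[symmetric])
    finally show ?thesis .
  qed
  define good where "good = {e\<in>carrier G. inv e \<otimes> r e \<in> M}"
  have badcount: "1 \<le> real (card {w\<in>perp M - M. q e \<le> q (e \<otimes> w)}) / real (card L)"
    if e: "e \<in> carrier G" "e \<notin> good" for e
  proof -
    define w0 where "w0 = inv e \<otimes> r e"
    have w0: "w0 \<in> perp M" "w0 \<notin> M" using r(2)[OF e(1)] e by (auto simp: w0_def good_def)
    have w0c: "w0 \<in> carrier G" by (rule perp_mem_carrier[OF w0(1)])
    have ew0: "e \<otimes> w0 = r e" using e(1) r(1)[OF e(1)] by (simp add: w0_def m_assoc[symmetric])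
    have "(\<lambda>l. w0 \<otimes> l) ` L \<subseteq> {w\<in>perp M - M. q e \<le> q (e \<otimes> w)}"
    proof (rule image_subsetI)
      fix l assume l: "l \<in> L"
      then have lM: "l \<in> M" and lc: "l \<in> carrier G" using M(2) Lc by auto
      have 1: "w0 \<otimes> l \<in> perp M"
        by (rule subgroup.m_closed[OF subgroup_perp[OF Mc] w0(1) subsetD[OF M(3) lM]])
      have 2: "w0 \<otimes> l \<notin> M"
      proof
        assume "w0 \<otimes> l \<in> M"
        then have "(w0 \<otimes> l) \<otimes> inv l \<in> M" by (rule subgroup.m_closed[OF M(1) _ subgroup.m_inv_closed[OF M(1) lM]])
        then show False using w0(2) w0c lc by (simp add: m_assoc)
      qed
      have "q (e \<otimes> (w0 \<otimes> l)) = q (r e)"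
        using q_inv[OF r(1)[OF e(1)] l] m_assoc[OF e(1) w0c lc] ew0 by simp
      then have "q e \<le> q (e \<otimes> (w0 \<otimes> l))" using r(3)[OF e(1)] by simp
      then show "w0 \<otimes> l \<in> {w\<in>perp M - M. q e \<le> q (e \<otimes> w)}" using 1 2 by simp
    qed
    moreover have "inj_on (\<lambda>l. w0 \<otimes> l) L" by (rule inj_onI) (use w0c Lc in \<open>simp add: subset_iff\<close>)
    ultimately have "card L \<le> card {w\<in>perp M - M. q e \<le> q (e \<otimes> w)}"
      using card_mono[of "{w\<in>perp M - M. q e \<le> q (e \<otimes> w)}" "(\<lambda>l. w0 \<otimes> l) ` L"] fP[of M] card_image by fastforce
    then show ?thesis using L0 by simp
  qed
  have bad: "(\<Sum>e\<in>A - good. p e) \<le> B / real d ^ j"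
  proof -
    have "(\<Sum>e\<in>A - good. p e) \<le> (\<Sum>e\<in>A - good. p e * (real (card {w\<in>perp M - M. q e \<le> q (e \<otimes> w)}) / real (card L)))"
    proof (rule sum_mono)
      fix e assume e: "e \<in> A - good"
      then have "p e * 1 \<le> p e * (real (card {w\<in>perp M - M. q e \<le> q (e \<otimes> w)}) / real (card L))"
        using Ac p(1) by (intro mult_left_mono badcount) auto
      then show "p e \<le> p e * (real (card {w\<in>perp M - M. q e \<le> q (e \<otimes> w)}) / real (card L))" by simp
    qed
    also have "\<dots> \<le> (\<Sum>e\<in>A. p e * (real (card {w\<in>perp M - M. q e \<le> q (e \<otimes> w)}) / real (card L)))"
      by (rule sum_mono2[OF fA]) (use Ac p(1) in auto)
    also have "\<dots> = (\<Sum>e\<in>A. \<Sum>w\<in>perp M - M. p e * (of_bool (q e \<le> q (e \<otimes> w)) / real (card L)))"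
    proof (rule sum.cong[OF refl])
      fix e
      have "(\<Sum>w\<in>perp M - M. of_bool (q e \<le> q (e \<otimes> w))) = real (card {w\<in>perp M - M. q e \<le> q (e \<otimes> w)})"
        using sum.inter_filter[of "perp M - M" "\<lambda>_. 1 :: real" "\<lambda>w. q e \<le> q (e \<otimes> w)"] fP[of M]
        by (simp add: of_bool_def)
      then show "p e * (real (card {w\<in>perp M - M. q e \<le> q (e \<otimes> w)}) / real (card L)) =
        (\<Sum>w\<in>perp M - M. p e * (of_bool (q e \<le> q (e \<otimes> w)) / real (card L)))"
        by (simp only: sum_distrib_left[symmetric] sum_divide_distrib[symmetric])
    qed
    also have "\<dots> = (\<Sum>w\<in>perp M - M. c w)" unfolding c_def by (rule sum.swap)
    also have "\<dots> \<le> B / real d ^ j"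
      using order.trans[OF Msum cL] d_gt_1 by (simp add: le_divide_eq mult.commute)
    finally show ?thesis .
  qed
  have "1 - (\<Sum>e\<in>carrier G - A. p e) - B / real d ^ j \<le> (\<Sum>e\<in>good. p e)"
  proof -
    have "(\<Sum>e\<in>carrier G. p e) = (\<Sum>e\<in>carrier G \<inter> A. p e) + (\<Sum>e\<in>carrier G - A. p e)"
      by (rule sum.Int_Diff[OF fin])
    also have "carrier G \<inter> A = A" using Ac by blast
    also have "(\<Sum>e\<in>A. p e) = (\<Sum>e\<in>A \<inter> good. p e) + (\<Sum>e\<in>A - good. p e)"
      by (rule sum.Int_Diff[OF fA])
    finally have "(\<Sum>e\<in>carrier G. p e) = (\<Sum>e\<in>A \<inter> good. p e) + (\<Sum>e\<in>A - good. p e) + (\<Sum>e\<in>carrier G - A. p e)" .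
    moreover have "(\<Sum>e\<in>A \<inter> good. p e) \<le> (\<Sum>e\<in>good. p e)"
      by (rule sum_mono2) (use fin p(1) in \<open>auto simp: good_def\<close>)
    ultimately show ?thesis using bad p(2) by linarith
  qed
  moreover have "carrier G - A = {e\<in>carrier G. B * (\<Sum>l\<in>L. p (e \<otimes> l)) < (\<Sum>w\<in>perp L. p (e \<otimes> w))}"
    by (auto simp: A_def q_def Q_def)
  ultimately have final: "1 - (\<Sum>e\<in>{e\<in>carrier G. B * (\<Sum>l\<in>L. p (e \<otimes> l)) < (\<Sum>w\<in>perp L. p (e \<otimes> w))}. p e) - B / real d ^ j
      \<le> (\<Sum>e\<in>{e\<in>carrier G. inv e \<otimes> r e \<in> M}. p e)" by (simp add: good_def)
  obtain Ks where K: "kraus_tp D Ks \<and> (\<forall>\<psi>\<in>stab_code M \<tau>. cinner \<psi> \<psi> = 1 \<longrightarrow>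
    (\<Sum>e\<in>{e\<in>carrier G. inv e \<otimes> r e \<in> M}. p e) \<le> Re (cinner \<psi> (kraus_apply D Ks
      (msum D (carrier G) (\<lambda>x. of_real (p x) \<cdot>\<^sub>m (W x * outer \<psi> * mat_adjoint (W x)))) *\<^sub>v \<psi>)))"
    by (rule exE[OF recovery_from_decoder[OF st p(1) r(1,2,4)]])
  note tp = K[THEN conjunct1] and Ks = K[THEN conjunct2, rule_format]
  have "(of_nat (cdim D (stab_code M \<tau>) * card M) :: complex) = of_nat D"
    using cdim_stab_code[OF st] stab_charD(4)[OF st] by simp
  then have "cdim D (stab_code M \<tau>) * card M = D" using of_nat_eq_iff by blast
  then have "real D = real (cdim D (stab_code M \<tau>)) * real (card M)" by (metis of_nat_mult)
  also have "\<dots> \<le> real (cdim D (stab_code M \<tau>)) * real (d ^ j * card L)"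
    using M(4) by (intro mult_left_mono of_nat_mono) simp_all
  finally have "real D \<le> real (cdim D (stab_code M \<tau>)) * real (d ^ j * card L)" .
  then show ?thesis
    using csubspace_stab_code[OF Mc] tp Ks final
    by (intro exI[of _ "stab_code M \<tau>"] exI[of _ Ks] conjI ballI impI) (auto intro: order.trans)
qed

text \<open>If M equals its complement, errors with the same syndrome differ by an element of M, so
  any guess with the right syndrome is correct and the recovery never fails.\<close>

lemma perfect_one_dimensional_code:
  fixes p :: "'a \<Rightarrow> real"
  assumes p: "\<And>x. x \<in> carrier G \<Longrightarrow> p x \<ge> 0" "(\<Sum>x\<in>carrier G. p x) = 1"
  shows "\<exists>C Ks. csubspace D C \<and> kraus_tp D Ks \<and> cdim D C \<ge> 1 \<and>
    (\<forall>\<psi>\<in>C. cinner \<psi> \<psi> = 1 \<longrightarrow> 1 \<le> Re (cinner \<psi> (kraus_apply D Ks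
        (msum D (carrier G) (\<lambda>x. of_real (p x) \<cdot>\<^sub>m (W x * outer \<psi> * mat_adjoint (W x)))) *\<^sub>v \<psi>)))"
proof -
  obtain M where *: "subgroup M G \<and> M = perp M" by (rule exE[OF maximal_isotropic_exists])
  note M = *[THEN conjunct1] and MP = *[THEN conjunct2]
  have Mc: "M \<subseteq> carrier G" by (rule subgroup.subset[OF M])
  have PM: "perp M \<subseteq> M" and MP': "M \<subseteq> perp M" using MP by (rule equalityD2, rule equalityD1)
  obtain \<tau> where st: "stab_char M \<tau>" using isotropic_stab_char_exists[OF M MP'] by metis
  obtain r where r: "\<And>x. x \<in> carrier G \<Longrightarrow> r x \<in> carrier G" "\<And>x. x \<in> carrier G \<Longrightarrow> inv x \<otimes> r x \<in> perp M"
    "\<And>x y. x \<in> carrier G \<Longrightarrow> y \<in> carrier G \<Longrightarrow> inv x \<otimes> y \<in> perp M \<Longrightarrow> r y = r x"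
    using coset_maximizer_exists[OF Mc, of "\<lambda>_. 0"] by metis
  obtain Ks where K: "kraus_tp D Ks \<and> (\<forall>\<psi>\<in>stab_code M \<tau>. cinner \<psi> \<psi> = 1 \<longrightarrow>
    (\<Sum>e\<in>{e\<in>carrier G. inv e \<otimes> r e \<in> M}. p e) \<le> Re (cinner \<psi> (kraus_apply D Ks
      (msum D (carrier G) (\<lambda>x. of_real (p x) \<cdot>\<^sub>m (W x * outer \<psi> * mat_adjoint (W x)))) *\<^sub>v \<psi>)))"
    by (rule exE[OF recovery_from_decoder[OF st p(1) r]])
  note tp = K[THEN conjunct1] and Ks = K[THEN conjunct2, rule_format]
  have "{e\<in>carrier G. inv e \<otimes> r e \<in> M} = carrier G"
    using subsetD[OF PM r(2)] by (intro equalityI subsetI) simp_all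
  then have sum1: "(\<Sum>e\<in>{e\<in>carrier G. inv e \<otimes> r e \<in> M}. p e) = 1" using p(2) by simp
  have "(of_nat (cdim D (stab_code M \<tau>)) :: complex) \<noteq> 0"
    using cdim_stab_code[OF st] stab_charD(4)[OF st] D_pos by simp
  then have "cdim D (stab_code M \<tau>) \<ge> 1" by (metis One_nat_def Suc_leI gr0I of_nat_0)
  then show ?thesis
    using csubspace_stab_code[OF Mc] tp Ks unfolding sum1
    by (intro exI[of _ "stab_code M \<tau>"] exI[of _ Ks] conjI ballI impI) auto
qed

end

section \<open>Coherent information of stabilizer codes\<close>

lemma index_bound:
  assumes "r < m" "a < n" shows "r * n + a < m * (n :: nat)"
proof -
  have "r * n + a < Suc r * n" using assms(2) by simp
  also have "\<dots> \<le> m * n" using assms(1) by (intro mult_le_mono1) simp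
  finally show ?thesis .
qed

lemma kron_carrier [simp]:
  "A \<in> carrier_mat m n \<Longrightarrow> B \<in> carrier_mat m' n' \<Longrightarrow> kron A B \<in> carrier_mat (m * m') (n * n')"
  by (auto simp: kron_def)

lemma kron_index:
  assumes "A \<in> carrier_mat m n" "B \<in> carrier_mat m' n'" "r < m" "a < m'" "s < n" "b < n'"
  shows "kron A B $$ (r * m' + a, s * n' + b) = A $$ (r, s) * B $$ (a, b)"
proof -
  have "r * m' + a < m * m'" by (rule index_bound[OF assms(3,4)])
  moreover have "s * n' + b < n * n'" by (rule index_bound[OF assms(5,6)])
  ultimately show ?thesis using assms by (simp add: kron_def)
qed

lemma product_index_cases:
  assumes "i < m * (n :: nat)"
  obtains r a where "r < m" "a < n" "i = r * n + a"
proof -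
  have "n > 0" using assms by (cases n) auto
  then show ?thesis using that[of "i div n" "i mod n"] assms by (simp add: less_mult_imp_div_less)
qed

lemma sum_lessThan_mult:
  fixes f :: "nat \<Rightarrow> 'b :: comm_monoid_add"
  shows "(\<Sum>i<m * n. f i) = (\<Sum>r<m. \<Sum>a<n. f (r * n + a))"
proof (induction m)
  case (Suc m)
  have plus: "(\<Sum>i<a + b. f i) = (\<Sum>i<a. f i) + (\<Sum>i<b. f (a + i))" for a b
    by (induction b) (simp_all add: add.assoc)
  have "Suc m * n = m * n + n" by simp
  then show ?case using plus[of "m * n" n] Suc by (simp only: sum.lessThan_Suc)
qed simp

text \<open>Comparing entries at indices already written as r * m' + a keeps division and remainder
  out of the product computations.\<close>

lemma kron_eqI:
  assumes "X \<in> carrier_mat (m * m') (n * n')" "Y \<in> carrier_mat (m * m') (n * n')"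
    and "\<And>r a s b. r < m \<Longrightarrow> a < m' \<Longrightarrow> s < n \<Longrightarrow> b < n' \<Longrightarrow> X $$ (r * m' + a, s * n' + b) = Y $$ (r * m' + a, s * n' + b)"
  shows "X = (Y :: complex mat)"
proof (rule eq_matI)
  fix i j assume "i < dim_row Y" "j < dim_col Y"
  then have "i < m * m'" "j < n * n'" using assms(2) by auto
  then show "X $$ (i, j) = Y $$ (i, j)" using assms(3) by (metis product_index_cases)
qed (use assms(1,2) in auto)

lemma kron_mult:
  assumes A: "A \<in> carrier_mat m n" and B: "B \<in> carrier_mat m' n'" and C: "C \<in> carrier_mat n l" and E: "E \<in> carrier_mat n' l'"
  shows "kron A B * kron C E = kron (A * C) (B * E)"
proof (rule kron_eqI[of _ m m' l l'])
  fix r a s b assume h: "r < m" "a < m'" "s < l" "b < l'"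
  have "(kron A B * kron C E) $$ (r * m' + a, s * l' + b) =
      (\<Sum>t<n. \<Sum>c<n'. kron A B $$ (r * m' + a, t * n' + c) * kron C E $$ (t * n' + c, s * l' + b))"
    by (subst mult_index_sum[OF kron_carrier[OF A B] kron_carrier[OF C E] index_bound[OF h(1,2)] index_bound[OF h(3,4)]])
      (rule sum_lessThan_mult)
  also have "\<dots> = (\<Sum>t<n. \<Sum>c<n'. (A $$ (r, t) * C $$ (t, s)) * (B $$ (a, c) * E $$ (c, b)))"
    using h by (intro sum.cong refl) (simp add: kron_index[OF A B] kron_index[OF C E])
  also have "\<dots> = (A * C) $$ (r, s) * (B * E) $$ (a, b)"
    unfolding mult_index_sum[OF A C h(1,3)] mult_index_sum[OF B E h(2,4)] by (simp only: sum_product)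
  also have "\<dots> = kron (A * C) (B * E) $$ (r * m' + a, s * l' + b)"
    by (rule kron_index[OF mult_carrier_mat[OF A C] mult_carrier_mat[OF B E] h, symmetric])
  finally show "(kron A B * kron C E) $$ (r * m' + a, s * l' + b) = kron (A * C) (B * E) $$ (r * m' + a, s * l' + b)" .
qed (use mult_carrier_mat[OF kron_carrier[OF A B] kron_carrier[OF C E]]
    kron_carrier[OF mult_carrier_mat[OF A C] mult_carrier_mat[OF B E]] in simp_all)

lemma kron_adjoint:
  assumes A: "A \<in> carrier_mat m n" and B: "B \<in> carrier_mat m' n'"
  shows "mat_adjoint (kron A B) = kron (mat_adjoint A) (mat_adjoint B)"
proof (rule kron_eqI[of _ n n' m m'])
  fix r a s b assume h: "r < n" "a < n'" "s < m" "b < m'"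
  have "mat_adjoint (kron A B) $$ (r * n' + a, s * m' + b) = cnj (kron A B $$ (s * m' + b, r * n' + a))"
    using kron_carrier[OF A B] index_bound[OF h(1,2)] index_bound[OF h(3,4)] by (intro mat_adjoint_index) auto
  also have "\<dots> = mat_adjoint A $$ (r, s) * mat_adjoint B $$ (a, b)"
    using A B h by (simp add: kron_index[OF A B])
  finally show "mat_adjoint (kron A B) $$ (r * n' + a, s * m' + b) = kron (mat_adjoint A) (mat_adjoint B) $$ (r * n' + a, s * m' + b)"
    using kron_index[OF mat_adjoint_carrier[OF A] mat_adjoint_carrier[OF B] h] by simp
qed (use mat_adjoint_carrier[OF kron_carrier[OF A B]] kron_carrier[OF mat_adjoint_carrier[OF A] mat_adjoint_carrier[OF B]] in simp_all)

lemma kron_one: "kron (1\<^sub>m m) (1\<^sub>m n) = 1\<^sub>m (m * n)"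
proof (rule kron_eqI[of _ m n m n])
  fix r a s b assume h: "r < m" "a < n" "s < m" "b < n"
  have "r * n + a = s * n + b \<longleftrightarrow> r = s \<and> a = b"
    using h by (metis add.commute add_diff_cancel_left' div_mult_self1_is_m div_mult_self3 div_less mod_less mod_mult_self3 add_0 gr_implies_not0)
  then show "kron (1\<^sub>m m) (1\<^sub>m n) $$ (r * n + a, s * n + b) = 1\<^sub>m (m * n) $$ (r * n + a, s * n + b)"
    using h index_bound[OF h(1,2)] index_bound[OF h(3,4)] by (auto simp: kron_index[of _ m m _ n n])
qed (use kron_carrier[of "1\<^sub>m m" m m "1\<^sub>m n" n n] in simp_all)

lemma mtrace_kron:
  assumes A: "A \<in> carrier_mat m m" and B: "B \<in> carrier_mat n n"
  shows "mtrace (kron A B) = mtrace A * mtrace B"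
proof -
  have "mtrace (kron A B) = (\<Sum>r<m. \<Sum>a<n. kron A B $$ (r * n + a, r * n + a))"
    using kron_carrier[OF A B] by (simp add: mtrace_def sum_lessThan_mult)
  also have "\<dots> = (\<Sum>r<m. \<Sum>a<n. A $$ (r, r) * B $$ (a, a))"
    by (intro sum.cong refl) (simp add: kron_index[OF A B])
  also have "\<dots> = mtrace A * mtrace B" using A B by (simp add: mtrace_def sum_product)
  finally show ?thesis .
qed

text \<open>An operator acting on one factor sees the vector only through its partial trace. This
  makes the inner products of the purified error vectors independent of the purification
  chosen.\<close>

lemma cinner_kron_one_eq_mtrace:
  assumes \<Psi>: "\<Psi> \<in> carrier_vec (R * D)" and A: "A \<in> carrier_mat D D"
  shows "cinner \<Psi> (kron (1\<^sub>m R) A *\<^sub>v \<Psi>) = mtrace (A * ptrace1 R D (outer \<Psi>))"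
proof -
  have K: "kron (1\<^sub>m R) A \<in> carrier_mat (R * D) (R * D)" using kron_carrier[of "1\<^sub>m R" R R A D D] A by simp
  have Pc: "ptrace1 R D (outer \<Psi>) \<in> carrier_mat D D" by (simp add: ptrace1_def)
  have P: "ptrace1 R D (outer \<Psi>) $$ (b, a) = (\<Sum>r<R. \<Psi> $ (r * D + b) * cnj (\<Psi> $ (r * D + a)))" if "a < D" "b < D" for a b
    using that \<Psi> index_bound[of _ R _ D] by (auto simp: ptrace1_def outer_def intro!: sum.cong)
  have Kv: "(kron (1\<^sub>m R) A *\<^sub>v \<Psi>) $ (r * D + a) = (\<Sum>b<D. A $$ (a, b) * \<Psi> $ (r * D + b))" if r: "r < R" "a < D" for r a
  proof -
    have "(kron (1\<^sub>m R) A *\<^sub>v \<Psi>) $ (r * D + a) = (\<Sum>s<R. \<Sum>b<D. kron (1\<^sub>m R) A $$ (r * D + a, s * D + b) * \<Psi> $ (s * D + b))"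
      by (subst mult_vec_index_sum[OF K \<Psi> index_bound[OF r]]) (rule sum_lessThan_mult)
    also have "\<dots> = (\<Sum>s<R. if s = r then (\<Sum>b<D. A $$ (a, b) * \<Psi> $ (r * D + b)) else 0)"
      using r A by (intro sum.cong refl) (auto simp: kron_index[of _ R R _ D D])
    also have "\<dots> = (\<Sum>b<D. A $$ (a, b) * \<Psi> $ (r * D + b))" using r by simp
    finally show ?thesis .
  qed
  have "cinner \<Psi> (kron (1\<^sub>m R) A *\<^sub>v \<Psi>) = (\<Sum>r<R. \<Sum>a<D. cnj (\<Psi> $ (r * D + a)) * (kron (1\<^sub>m R) A *\<^sub>v \<Psi>) $ (r * D + a))"
    using \<Psi> by (simp only: cinner_def carrier_vecD sum_lessThan_mult)
  also have "\<dots> = (\<Sum>r<R. \<Sum>a<D. \<Sum>b<D. A $$ (a, b) * (\<Psi> $ (r * D + b) * cnj (\<Psi> $ (r * D + a))))"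
    by (intro sum.cong refl) (simp add: Kv sum_distrib_left mult.left_commute mult.commute del: index_mult_mat_vec)
  also have "\<dots> = (\<Sum>a<D. \<Sum>r<R. \<Sum>b<D. A $$ (a, b) * (\<Psi> $ (r * D + b) * cnj (\<Psi> $ (r * D + a))))"
    by (rule sum.swap)
  also have "\<dots> = (\<Sum>a<D. \<Sum>b<D. \<Sum>r<R. A $$ (a, b) * (\<Psi> $ (r * D + b) * cnj (\<Psi> $ (r * D + a))))"
    by (rule sum.cong[OF refl]) (rule sum.swap)
  also have "\<dots> = (\<Sum>a<D. \<Sum>b<D. A $$ (a, b) * ptrace1 R D (outer \<Psi>) $$ (b, a))"
    by (intro sum.cong refl) (simp add: P sum_distrib_left)
  also have "\<dots> = (\<Sum>a<D. (A * ptrace1 R D (outer \<Psi>)) $$ (a, a))"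
    by (intro sum.cong refl) (simp only: mult_index_sum[OF A Pc] lessThan_iff)
  also have "\<dots> = mtrace (A * ptrace1 R D (outer \<Psi>))" using A by (simp add: mtrace_def)
  finally show ?thesis .
qed

text \<open>The equality case of Cauchy-Schwarz: v minus \<open>cinner u v\<close> times u has norm
  zero, and a phase does not change the rank-one operator.\<close>

lemma unit_vectors_collinear:
  assumes u: "u \<in> carrier_vec n" "cinner u u = 1" and v: "v \<in> carrier_vec n" "cinner v v = 1"
    and c: "cmod (cinner u v) = 1"
  shows "outer v = outer u"
proof -
  define k where "k = cinner u v"
  have kk: "k * cnj k = 1" using c complex_norm_square[of k] by (simp add: k_def)
  define w where "w = k \<cdot>\<^sub>v u"
  have d: "dim_vec u = n" "dim_vec v = n" "dim_vec w = n" using u v by (auto simp: w_def)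
  have vu: "cinner v u = cnj k" using cinner_cnj[of u v] d by (simp add: k_def)
  have wv: "cinner w v = 1" unfolding w_def cinner_smult_left k_def[symmetric] using kk by (simp add: mult.commute)
  have vw: "cinner v w = 1" unfolding w_def using cinner_smult_right[of u v k] d vu kk by simp
  have ww: "cinner w w = 1"
    unfolding w_def cinner_smult_left using cinner_smult_right[of u u k] u kk by (simp add: mult.commute)
  have "cinner (v - w) (v - w) = cinner (v - w) v - cinner (v - w) w" by (rule cinner_minus_right) (simp_all add: d)
  also have "cinner (v - w) v = cinner v v - cinner w v" by (rule cinner_minus_left) (simp_all add: d)
  also have "cinner (v - w) w = cinner v w - cinner w w" by (rule cinner_minus_left) (simp_all add: d)
  finally have "cinner (v - w) (v - w) = 0" using v wv vw ww by simp
  moreover have "v - w \<in> carrier_vec n" using d by (intro carrier_vecI) simp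
  ultimately have 0: "v - w = 0\<^sub>v n" using cinner_self_zero_iff by blast
  have "v = w"
  proof (rule eq_vecI)
    fix i assume "i < dim_vec w"
    then have "(v - w) $ i = v $ i - w $ i" "i < n" using d by simp_all
    then show "v $ i = w $ i" unfolding 0 by simp
  qed (simp add: d)
  then show ?thesis unfolding w_def using outer_smult[of k u] c by (simp add: k_def)
qed

lemma outer_mult_outer:
  assumes u: "u \<in> carrier_vec n" and v: "v \<in> carrier_vec n"
  shows "cinner u v = 0 \<Longrightarrow> outer u * outer v = 0\<^sub>m n n"
    and "cinner u u = 1 \<Longrightarrow> outer u * outer u = outer u"
proof -
  have uv: "(outer u * outer v) *\<^sub>v w = (cinner v w * cinner u v) \<cdot>\<^sub>v u"
    if v: "v \<in> carrier_vec n" and w: "w \<in> carrier_vec n" for v w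
  proof -
    have "(outer u * outer v) *\<^sub>v w = outer u *\<^sub>v (outer v *\<^sub>v w)"
      by (rule assoc_mult_mat_vec[OF outer_carrier[OF u] outer_carrier[OF v] w])
    also have "outer v *\<^sub>v w = cinner v w \<cdot>\<^sub>v v" by (rule outer_mult_vec[OF v w])
    also have "outer u *\<^sub>v (cinner v w \<cdot>\<^sub>v v) = cinner v w \<cdot>\<^sub>v (outer u *\<^sub>v v)"
      by (rule mult_mat_vec[OF outer_carrier[OF u] v])
    also have "outer u *\<^sub>v v = cinner u v \<cdot>\<^sub>v u" by (rule outer_mult_vec[OF u v])
    finally show ?thesis by (simp add: smult_smult_assoc)
  qed
  show "outer u * outer v = 0\<^sub>m n n" if "cinner u v = 0"
  proof (rule mat_eqI_mult_vec[of _ n n])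
    fix w :: "complex vec" assume w: "w \<in> carrier_vec n"
    show "(outer u * outer v) *\<^sub>v w = 0\<^sub>m n n *\<^sub>v w"
      unfolding uv[OF v w] that by (rule eq_vecI) (use u w in \<open>auto simp: scalar_prod_def\<close>)
  qed (use mult_carrier_mat[OF outer_carrier[OF u] outer_carrier[OF v]] in simp_all)
  show "outer u * outer u = outer u" if "cinner u u = 1"
  proof (rule mat_eqI_mult_vec[of _ n n])
    fix w :: "complex vec" assume w: "w \<in> carrier_vec n"
    show "(outer u * outer u) *\<^sub>v w = outer u *\<^sub>v w"
      unfolding uv[OF u w] outer_mult_vec[OF u w] that by simp
  qed (use mult_carrier_mat[OF outer_carrier[OF u] outer_carrier[OF u]] u in simp_all)
qed

section \<open>Entropies of the two channel outputs\<close>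

context weyl_system
begin

lemma coset_sum:
  fixes p :: "'a \<Rightarrow> real"
  assumes H: "H \<subseteq> carrier G" and x: "x \<in> carrier G"
  shows "(\<Sum>y\<in>{y\<in>carrier G. inv x \<otimes> y \<in> H}. p y) = (\<Sum>h\<in>H. p (x \<otimes> h))"
proof (rule sum.reindex_bij_betw[symmetric])
  show "bij_betw (\<lambda>h. x \<otimes> h) H {y\<in>carrier G. inv x \<otimes> y \<in> H}"
    by (rule bij_betw_byWitness[where f' = "\<lambda>y. inv x \<otimes> y"])
      (use x H in \<open>auto simp: m_assoc[symmetric] subset_iff\<close>)
qed

lemma translate_eq_iff:
  assumes L: "stab_char L \<tau>" and x: "x \<in> carrier G" and y: "y \<in> carrier G"
  shows "(\<forall>g\<in>L. \<tau> g * chi g x = \<tau> g * chi g y) \<longleftrightarrow> inv x \<otimes> y \<in> perp L"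
proof -
  have "\<tau> g * chi g x = \<tau> g * chi g y \<longleftrightarrow> chi g (inv x \<otimes> y) = 1" if g: "g \<in> L" for g
  proof -
    have gc: "g \<in> carrier G" using g stab_charD(2)[OF L] by blast
    have "chi g (inv x \<otimes> y) = inverse (chi g x) * chi g y"
      using x y gc by (simp add: chi_mult_right chi_inv_right)
    then show ?thesis using stab_charD(6)[OF L g] chi_nonzero[OF gc x] by (auto simp: field_simps)
  qed
  then show ?thesis using x y by (auto simp: perp_def)
qed

text \<open>The block relation is equality of the translated characters, which by
  \<open>translate_eq_iff\<close> is the coset relation of \<open>perp L\<close>. Each translate has
  trace k, cancelling the factor 1 / k of the normalised projection except inside the
  logarithm.\<close>

lemma vnS_channel_output:
  assumes L: "stab_char L \<tau>" and p: "\<And>x. x \<in> carrier G \<Longrightarrow> p x \<ge> 0"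
    and k: "k * card L = D"
  shows "vnS b (msum D (carrier G) (\<lambda>x. of_real (p x) \<cdot>\<^sub>m
      (W x * ((1 / of_nat k) \<cdot>\<^sub>m stab_proj L \<tau>) * mat_adjoint (W x)))) =
    - (\<Sum>x\<in>carrier G. p x * log (real b) ((\<Sum>w\<in>perp L. p (x \<otimes> w)) / real k))"
proof -
  note Dd = stab_charD[OF L]
  have k0: "k > 0" using k D_pos by (cases k) auto
  define Q where "Q x = stab_proj L (\<lambda>g. \<tau> g * chi g x)" for x
  define r where "r x y \<longleftrightarrow> (\<forall>g\<in>L. \<tau> g * chi g x = \<tau> g * chi g y)" for x y
  have eq: "of_real (p x) \<cdot>\<^sub>m (W x * ((1 / of_nat k) \<cdot>\<^sub>m stab_proj L \<tau>) * mat_adjoint (W x)) =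
      of_real (p x / real k) \<cdot>\<^sub>m Q x" if x: "x \<in> carrier G" for x
  proof -
    have "W x * ((1 / of_nat k) \<cdot>\<^sub>m stab_proj L \<tau>) * mat_adjoint (W x) =
        (1 / of_nat k) \<cdot>\<^sub>m (W x * stab_proj L \<tau> * mat_adjoint (W x))"
      using x by (simp add: square_mat_simps)
    then show ?thesis unfolding Q_def stab_proj_conj[OF L x] by (simp add: smult_smult_mat)
  qed
  have "vnS b (msum D (carrier G) (\<lambda>x. of_real (p x / real k) \<cdot>\<^sub>m Q x)) =
      - (\<Sum>x\<in>carrier G. p x / real k * log (real b) (\<Sum>y\<in>{y\<in>carrier G. r x y}. p y / real k) * real k)"
  proof (rule vnS_block_decomposition[OF fin])
    fix x y assume xy: "x \<in> carrier G" "y \<in> carrier G"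
    show "Q x * Q y = (if r x y then Q x else 0\<^sub>m D D)"
      unfolding Q_def r_def by (rule stab_proj_mult[OF stab_char_translate[OF L xy(1)] stab_char_translate[OF L xy(2)]])
  next
    fix x assume x: "x \<in> carrier G"
    have "mtrace (Q x) = of_nat D / of_nat (card L)"
      unfolding Q_def by (rule mtrace_stab_proj[OF stab_char_translate[OF L x]])
    also have "\<dots> = of_real (real k)" unfolding k[symmetric] using Dd(4) by simp
    finally show "mtrace (Q x) = of_real (real k)" .
  qed (use p in \<open>auto simp: Q_def r_def\<close>)
  also have "\<dots> = - (\<Sum>x\<in>carrier G. p x * log (real b) ((\<Sum>w\<in>perp L. p (x \<otimes> w)) / real k))"
  proof -
    have "(\<Sum>y\<in>{y\<in>carrier G. r x y}. p y / real k) = (\<Sum>w\<in>perp L. p (x \<otimes> w)) / real k" if x: "x \<in> carrier G" for x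
    proof -
      have "{y\<in>carrier G. r x y} = {y\<in>carrier G. inv x \<otimes> y \<in> perp L}"
        using translate_eq_iff[OF L x] unfolding r_def by blast
      then show ?thesis using coset_sum[OF perp_carrier x] by (simp add: sum_divide_distrib)
    qed
    then show ?thesis using k0 by simp
  qed
  finally show ?thesis using msum_cong[OF refl eq, of "carrier G" "\<lambda>x. x" D] by (simp add: eq cong: msum_cong)
qed

text \<open>The overlap of the vectors of two errors x and y is a phase times the trace of
  \<open>W (inv x \<otimes> y)\<close> on the normalised projection: of modulus 1 if x and y agree
  modulo L, and 0 otherwise. So the rank-one operators coincide or are orthogonal. An arbitrary
  purification is allowed because \<open>coh_info\<close> selects one by choice.\<close>

lemma vnS_purified_output:
  assumes L: "stab_char L \<tau>" and p: "\<And>x. x \<in> carrier G \<Longrightarrow> p x \<ge> 0"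
    and k: "k * card L = D" and \<Psi>: "purification D ((1 / of_nat k) \<cdot>\<^sub>m stab_proj L \<tau>) \<Psi>"
  shows "vnS b (msum (D * D) (carrier G) (\<lambda>x. of_real (p x) \<cdot>\<^sub>m
      (kron (1\<^sub>m D) (W x) * outer \<Psi> * mat_adjoint (kron (1\<^sub>m D) (W x))))) =
    - (\<Sum>x\<in>carrier G. p x * log (real b) (\<Sum>l\<in>L. p (x \<otimes> l)))"
proof -
  note Dd = stab_charD[OF L]
  have k0: "k > 0" using k D_pos by (cases k) auto
  have \<Psi>c: "\<Psi> \<in> carrier_vec (D * D)" and pt: "ptrace1 D D (outer \<Psi>) = (1 / of_nat k) \<cdot>\<^sub>m stab_proj L \<tau>"
    using \<Psi> by (simp_all add: purification_def)
  define X where "X x = kron (1\<^sub>m D) (W x)" for x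
  have Xc: "X x \<in> carrier_mat (D * D) (D * D)" if "x \<in> carrier G" for x
    unfolding X_def by (rule kron_carrier[OF one_carrier_mat W_carrier[OF that]])
  define \<phi> where "\<phi> x = X x *\<^sub>v \<Psi>" for x
  have \<phi>c: "\<phi> x \<in> carrier_vec (D * D)" if "x \<in> carrier G" for x
    unfolding \<phi>_def by (rule mult_mat_vec_carrier[OF Xc[OF that] \<Psi>c])
  have ip: "cinner (\<phi> x) (\<phi> y) = (1 / of_nat k) * mtrace (mat_adjoint (W x) * W y * stab_proj L \<tau>)"
    if x: "x \<in> carrier G" and y: "y \<in> carrier G" for x y
  proof -
    have Wx: "mat_adjoint (W x) \<in> carrier_mat D D" using x by simp
    have Xx: "mat_adjoint (X x) \<in> carrier_mat (D * D) (D * D)" using Xc[OF x] by simp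
    have prod: "mat_adjoint (X x) * X y = kron (1\<^sub>m D) (mat_adjoint (W x) * W y)"
      unfolding X_def kron_adjoint[OF one_carrier_mat W_carrier[OF x]] mat_adjoint_one
        kron_mult[OF one_carrier_mat Wx one_carrier_mat W_carrier[OF y]] by simp
    have "cinner \<Psi> (mat_adjoint (X x) *\<^sub>v \<phi> y) = cinner (mat_adjoint (mat_adjoint (X x)) *\<^sub>v \<Psi>) (\<phi> y)"
      by (rule cinner_adjoint[OF Xx \<Psi>c \<phi>c[OF y]])
    then have "cinner (\<phi> x) (\<phi> y) = cinner \<Psi> (mat_adjoint (X x) *\<^sub>v \<phi> y)" by (simp add: \<phi>_def)
    also have "mat_adjoint (X x) *\<^sub>v \<phi> y = kron (1\<^sub>m D) (mat_adjoint (W x) * W y) *\<^sub>v \<Psi>"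
      unfolding \<phi>_def prod[symmetric] by (rule assoc_mult_mat_vec[OF Xx Xc[OF y] \<Psi>c, symmetric])
    also have "cinner \<Psi> \<dots> = mtrace (mat_adjoint (W x) * W y * ((1 / of_nat k) \<cdot>\<^sub>m stab_proj L \<tau>))"
      unfolding pt[symmetric] by (rule cinner_kron_one_eq_mtrace[OF \<Psi>c mult_carrier_mat[OF Wx W_carrier[OF y]]])
    also have "\<dots> = (1 / of_nat k) * mtrace (mat_adjoint (W x) * W y * stab_proj L \<tau>)"
      using x y by (simp add: square_mat_simps mtrace_smult[of _ D])
    finally show ?thesis .
  qed
  have norm1: "cinner (\<phi> x) (\<phi> x) = 1" if x: "x \<in> carrier G" for x
  proof -
    have "cinner (\<phi> x) (\<phi> x) = (1 / of_nat k) * (of_nat D / of_nat (card L))"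
      unfolding ip[OF x x] W_unitary[OF x] by (simp add: square_mat_simps mtrace_stab_proj[OF L])
    then show ?thesis unfolding k[symmetric] using k0 Dd(4) by simp
  qed
  have ip2: "cinner (\<phi> x) (\<phi> y) = (if inv x \<otimes> y \<in> L then \<beta> (inv x) y / \<beta> x (inv x) * \<tau> (inv x \<otimes> y) else 0)"
    if x: "x \<in> carrier G" and y: "y \<in> carrier G" for x y
  proof -
    have b0: "\<beta> x (inv x) \<noteq> 0" using x by (intro \<beta>_nonzero) simp_all
    have "mat_adjoint (W x) = (1 / \<beta> x (inv x)) \<cdot>\<^sub>m W (inv x)"
      unfolding W_inv[OF x] smult_smult_mat using b0 by simp
    then have "mat_adjoint (W x) * W y = (1 / \<beta> x (inv x)) \<cdot>\<^sub>m (\<beta> (inv x) y \<cdot>\<^sub>m W (inv x \<otimes> y))"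
      using x y by (simp add: square_mat_simps W_mult)
    then have e: "mat_adjoint (W x) * W y * stab_proj L \<tau> =
        (\<beta> (inv x) y / \<beta> x (inv x)) \<cdot>\<^sub>m (W (inv x \<otimes> y) * stab_proj L \<tau>)"
      using x y by (simp add: square_mat_simps smult_smult_mat)
    have c: "W (inv x \<otimes> y) * stab_proj L \<tau> \<in> carrier_mat D D" using x y by (simp add: square_mat_simps)
    have "mtrace (mat_adjoint (W x) * W y * stab_proj L \<tau>) = \<beta> (inv x) y / \<beta> x (inv x) *
        (if inv x \<otimes> y \<in> L then \<tau> (inv x \<otimes> y) * of_nat D / of_nat (card L) else 0)"
      unfolding e mtrace_smult[OF c] using mtrace_W_stab_proj[OF L, of "inv x \<otimes> y"] x y by simp
    then show ?thesis unfolding ip[OF x y] k[symmetric] using k0 Dd(4) by simp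
  qed
  have "vnS b (msum (D * D) (carrier G) (\<lambda>x. of_real (p x) \<cdot>\<^sub>m outer (\<phi> x))) =
      - (\<Sum>x\<in>carrier G. p x * log (real b) (\<Sum>y\<in>{y\<in>carrier G. inv x \<otimes> y \<in> L}. p y) * 1)"
  proof (rule vnS_block_decomposition[OF fin])
    fix x assume x: "x \<in> carrier G"
    show "outer (\<phi> x) \<in> carrier_mat (D * D) (D * D)" by (rule outer_carrier[OF \<phi>c[OF x]])
    show "inv x \<otimes> x \<in> L" using x subgroup.one_closed[OF Dd(1)] by simp
    show "mtrace (outer (\<phi> x)) = of_real 1" by (simp add: mtrace_outer norm1[OF x])
    fix y assume y: "y \<in> carrier G"
    show "outer (\<phi> x) * outer (\<phi> y) = (if inv x \<otimes> y \<in> L then outer (\<phi> x) else 0\<^sub>m (D * D) (D * D))"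
    proof (cases "inv x \<otimes> y \<in> L")
      case True
      have "cmod (cinner (\<phi> x) (\<phi> y)) = 1"
        using ip2[OF x y] True \<beta>_unit[of "inv x" y] \<beta>_unit[of x "inv x"] x y Dd(5)[OF True]
        by (simp add: norm_mult norm_divide)
      then have "outer (\<phi> y) = outer (\<phi> x)"
        by (rule unit_vectors_collinear[OF \<phi>c[OF x] norm1[OF x] \<phi>c[OF y] norm1[OF y]])
      then show ?thesis using True outer_mult_outer(2)[OF \<phi>c[OF x] \<phi>c[OF x] norm1[OF x]] by simp
    next
      case False
      then have "cinner (\<phi> x) (\<phi> y) = 0" using ip2[OF x y] by simp
      then show ?thesis using False outer_mult_outer(1)[OF \<phi>c[OF x] \<phi>c[OF y]] by simp
    qed
  qed (rule p)
  also have "\<dots> = - (\<Sum>x\<in>carrier G. p x * log (real b) (\<Sum>l\<in>L. p (x \<otimes> l)))"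
    using coset_sum[OF Dd(2)] by simp
  finally show ?thesis
    using conj_outer[OF Xc \<Psi>c] by (simp add: X_def[symmetric] \<phi>_def cong: msum_cong)
qed

lemma purification_exists:
  assumes L: "stab_char L \<tau>"
  shows "\<exists>\<Psi>. purification D ((1 / of_nat k) \<cdot>\<^sub>m stab_proj L \<tau>) \<Psi>"
proof -
  let ?P = "stab_proj L \<tau>"
  define s where "s = 1 / sqrt (real k)"
  have ss: "s * s = 1 / real k" by (simp add: s_def)
  \<comment> \<open>The vectorisation of s times the projection, column by column; tracing out the
    column index gives the projection times its adjoint, scaled by s squared, which is 1 /
    k.\<close>
  define \<Psi> where "\<Psi> = vec (D * D) (\<lambda>i. of_real s * ?P $$ (i mod D, i div D))"
  have \<Psi>: "\<Psi> $ (r * D + a) = of_real s * ?P $$ (a, r)" if "r < D" "a < D" for r a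
    using that index_bound[OF that] by (simp add: \<Psi>_def)
  have "ptrace1 D D (outer \<Psi>) = (1 / of_nat k) \<cdot>\<^sub>m ?P"
  proof (rule eq_matI)
    fix a b assume "a < dim_row ((1 / of_nat k) \<cdot>\<^sub>m ?P)" "b < dim_col ((1 / of_nat k) \<cdot>\<^sub>m ?P)"
    then have ab: "a < D" "b < D" using carrier_matD[OF stab_proj_carrier[of L \<tau>]] by simp_all
    have "ptrace1 D D (outer \<Psi>) $$ (a, b) = (\<Sum>r<D. \<Psi> $ (r * D + a) * cnj (\<Psi> $ (r * D + b)))"
      using ab index_bound[of _ D _ D] by (auto simp: ptrace1_def outer_def \<Psi>_def intro!: sum.cong)
    also have "\<dots> = (\<Sum>r<D. of_real (s * s) * (?P $$ (a, r) * mat_adjoint ?P $$ (r, b)))"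
      using ab carrier_matD[OF stab_proj_carrier[of L \<tau>]] by (intro sum.cong refl) (simp add: \<Psi>)
    also have "\<dots> = of_real (s * s) * (?P * mat_adjoint ?P) $$ (a, b)"
      unfolding mult_index_sum[OF stab_proj_carrier mat_adjoint_carrier[OF stab_proj_carrier] ab] by (rule sum_distrib_left[symmetric])
    also have "?P * mat_adjoint ?P = ?P" unfolding stab_proj_adjoint[OF L] using stab_proj_mult[OF L L] by simp
    finally show "ptrace1 D D (outer \<Psi>) $$ (a, b) = ((1 / of_nat k) \<cdot>\<^sub>m ?P) $$ (a, b)"
      using ab carrier_matD[OF stab_proj_carrier[of L \<tau>]] by (simp add: ss)
  qed (use carrier_matD[OF stab_proj_carrier[of L \<tau>]] in \<open>simp_all add: ptrace1_def\<close>)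
  then show ?thesis unfolding purification_def by (intro exI[of _ \<Psi>]) (simp add: \<Psi>_def)
qed

end

section \<open>Pauli operators\<close>

definition string_group :: "nat \<Rightarrow> nat \<Rightarrow> (nat \<times> nat) list monoid" where
  "string_group d n = \<lparr>carrier = strings d n, monoid.mult = fadd d, one = fzero n\<rparr>"

lemma string_group_simps [simp]:
  "carrier (string_group d n) = strings d n" "monoid.mult (string_group d n) = fadd d"
  "one (string_group d n) = fzero n"
  by (simp_all add: string_group_def)

text \<open>One of the two sums in the symplectic form, unreduced modulo d: it counts the factors of
  inverse \<omega> produced when the Z part of \<open>xs\<close> moves past the X part of
  \<open>ys\<close>.\<close>

definition half_dot :: "(nat \<times> nat) list \<Rightarrow> (nat \<times> nat) list \<Rightarrow> nat" where
  "half_dot xs ys = sum_list (map2 (\<lambda>a b. snd a * fst b) xs ys)"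

(* Z X = \<omega>^(-1) X Z, and \<omega>^(d-1) stands for \<omega>^(-1). *)
definition weyl_phase :: "nat \<Rightarrow> complex \<Rightarrow> (nat \<times> nat) list \<Rightarrow> (nat \<times> nat) list \<Rightarrow> complex" where
  "weyl_phase d \<omega> xs ys = \<omega> ^ ((d - 1) * half_dot xs ys)"

lemma half_dot_simps [simp]:
  "half_dot [] ys = 0" "half_dot xs [] = 0"
  "half_dot (a # xs) (b # ys) = snd a * fst b + half_dot xs ys"
  by (simp_all add: half_dot_def)

lemma half_dot_append:
  "length xs = length xs' \<Longrightarrow> half_dot (xs @ ys) (xs' @ ys') = half_dot xs xs' + half_dot ys ys'"
  by (simp add: half_dot_def)

lemma half_dot_sum: "length xs = length ys \<Longrightarrow> half_dot xs ys = (\<Sum>i<length xs. snd (xs ! i) * fst (ys ! i))"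
  by (induction xs ys rule: list_induct2) (simp_all add: sum.lessThan_Suc_shift del: sum.lessThan_Suc)

lemma strings_0 [simp]: "strings d 0 = {[]}"
  by (auto simp: strings_def)

lemma strings_Cons: "x # xs \<in> strings d (Suc n) \<longleftrightarrow> x \<in> pts d \<and> xs \<in> strings d n"
  by (auto simp: strings_def)

lemma strings_length: "xs \<in> strings d n \<Longrightarrow> length xs = n"
  by (simp add: strings_def)

lemma strings_Suc_cases:
  assumes "xs \<in> strings d (Suc n)"
  obtains x ys where "xs = x # ys" "x \<in> pts d" "ys \<in> strings d n"
  using assms by (cases xs) (auto simp: strings_def)

lemma strings_nth: "xs \<in> strings d n \<Longrightarrow> i < n \<Longrightarrow> fst (xs ! i) < d \<and> snd (xs ! i) < d"
  using nth_mem[of i xs] unfolding strings_def pts_def by blast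

lemma stringsI: "length xs = n \<Longrightarrow> (\<And>i. i < n \<Longrightarrow> fst (xs ! i) < d \<and> snd (xs ! i) < d) \<Longrightarrow> xs \<in> strings d n"
  by (auto simp: strings_def pts_def in_set_conv_nth) (metis fst_conv snd_conv)+

lemma pts_eq: "pts d = {..<d} \<times> {..<d}"
  by (auto simp: pts_def)

lemma finite_strings: "finite (strings d n)" and card_strings: "card (strings d n) = (d ^ n)\<^sup>2"
proof -
  have eq: "strings d n = {xs. set xs \<subseteq> pts d \<and> length xs = n}" by (auto simp: strings_def)
  have f: "finite (pts d)" by (simp add: pts_eq)
  show "finite (strings d n)" unfolding eq by (rule finite_lists_length_eq[OF f])
  show "card (strings d n) = (d ^ n)\<^sup>2" unfolding eq card_lists_length_eq[OF f]
    by (simp add: pts_eq card_cartesian_product power_mult_distrib power2_eq_square)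
qed

lemma fadd_length [simp]: "length xs = length ys \<Longrightarrow> length (fadd d xs ys) = length ys"
  by (simp add: fadd_def)

lemma fadd_nth: "i < length xs \<Longrightarrow> i < length ys \<Longrightarrow>
    fadd d xs ys ! i = ((fst (xs ! i) + fst (ys ! i)) mod d, (snd (xs ! i) + snd (ys ! i)) mod d)"
  by (simp add: fadd_def)

lemma fadd_Cons: "fadd d (a # xs) (b # ys) = ((fst a + fst b) mod d, (snd a + snd b) mod d) # fadd d xs ys"
  by (simp add: fadd_def)

lemma fadd_Nil [simp]: "fadd d [] [] = []"
  by (simp add: fadd_def)

lemma fadd_append: "length xs = length xs' \<Longrightarrow> fadd d (xs @ ys) (xs' @ ys') = fadd d xs xs' @ fadd d ys ys'"
  by (simp add: fadd_def)

lemma fzero_simps [simp]: "fzero 0 = []" "fzero (Suc n) = (0, 0) # fzero n" "length (fzero n) = n"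
  by (simp_all add: fzero_def)

lemma fzero_nth [simp]: "i < n \<Longrightarrow> fzero n ! i = (0, 0)"
  by (simp add: fzero_def)

lemma fzero_mem: "d > 0 \<Longrightarrow> fzero n \<in> strings d n"
  by (rule stringsI) simp_all

lemma fadd_mem: "d > 0 \<Longrightarrow> xs \<in> strings d n \<Longrightarrow> ys \<in> strings d n \<Longrightarrow> fadd d xs ys \<in> strings d n"
  by (rule stringsI) (simp_all add: strings_length fadd_nth)

lemma string_group_comm_group:
  assumes "d > 0" shows "comm_group (string_group d n)"
proof (rule comm_groupI; unfold string_group_simps)
  fix x y z assume x: "x \<in> strings d n" and y: "y \<in> strings d n" and z: "z \<in> strings d n"
  note l = strings_length[OF x] strings_length[OF y] strings_length[OF z]
  show "fadd d (fadd d x y) z = fadd d x (fadd d y z)"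
    by (rule nth_equalityI) (simp_all add: l fadd_nth mod_simps add.assoc)
next
  fix x y assume x: "x \<in> strings d n" and y: "y \<in> strings d n"
  note l = strings_length[OF x] strings_length[OF y]
  show "fadd d x y \<in> strings d n" by (rule fadd_mem[OF assms x y])
  show "fadd d x y = fadd d y x"
    by (rule nth_equalityI) (simp_all add: l fadd_nth add.commute)
next
  fix x assume x: "x \<in> strings d n"
  note l = strings_length[OF x]
  show "fadd d (fzero n) x = x"
  proof (rule nth_equalityI)
    fix i assume "i < length (fadd d (fzero n) x)"
    then have i: "i < n" by (simp add: l)
    show "fadd d (fzero n) x ! i = x ! i"
      using strings_nth[OF x i] i by (simp add: fadd_nth l)
  qed (simp add: l)
  \<comment> \<open>The reduction modulo d matters at entries equal to 0, whose negative would
    otherwise be the inadmissible value d.\<close>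
  define y where "y = map (\<lambda>a. ((d - fst a) mod d, (d - snd a) mod d)) x"
  have y: "y \<in> strings d n" by (rule stringsI) (use assms in \<open>simp_all add: y_def l\<close>)
  have "fadd d y x = fzero n"
  proof (rule nth_equalityI)
    fix i assume "i < length (fadd d y x)"
    then have i: "i < n" using l by (simp add: y_def)
    have m: "((d - a) mod d + a) mod d = 0" if "a < d" for a using that by (simp add: mod_add_left_eq)
    show "fadd d y x ! i = fzero n ! i"
      using strings_nth[OF x i] i m by (simp add: fadd_nth l y_def)
  qed (simp add: y_def l)
  then show "\<exists>y\<in>strings d n. fadd d y x = fzero n" using y by blast
qed (rule fzero_mem[OF assms])

lemma string_group_pow:
  assumes "x \<in> strings d n"
  shows "x [^]\<^bsub>string_group d n\<^esub> (k :: nat) = fscale d k x"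
proof (induction k)
  case 0
  show ?case unfolding nat_pow_def
    by (rule nth_equalityI) (simp_all add: fscale_def strings_length[OF assms])
next
  case (Suc k)
  have "x [^]\<^bsub>string_group d n\<^esub> Suc k = fadd d (fscale d k x) x"
    using Suc by (simp add: nat_pow_def)
  also have "\<dots> = fscale d (Suc k) x"
    by (rule nth_equalityI) (simp_all add: fscale_def fadd_nth mod_simps algebra_simps)
  finally show ?case .
qed

section \<open>Pauli matrices on a single site\<close>

locale primitive_root =
  fixes d :: nat and \<omega> :: complex
  assumes d_prime: "prime d" and root: "\<omega> ^ d = 1"
    and primitive: "\<And>j. 0 < j \<Longrightarrow> j < d \<Longrightarrow> \<omega> ^ j \<noteq> 1"
begin

lemma d_pos: "d > 0" using d_prime by (simp add: prime_gt_0_nat)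

lemma d_gt1: "d > 1" using d_prime by (rule prime_gt_1_nat)

lemma \<omega>_mod: "\<omega> ^ (m mod d) = \<omega> ^ m"
proof -
  have "\<omega> ^ m = \<omega> ^ (d * (m div d) + m mod d)" by simp
  also have "\<dots> = \<omega> ^ (m mod d)" unfolding power_add power_mult root by simp
  finally show ?thesis by simp
qed

lemma \<omega>_cong: "m mod d = n mod d \<Longrightarrow> \<omega> ^ m = \<omega> ^ n"
  using \<omega>_mod[of m] \<omega>_mod[of n] by simp

lemma \<omega>_norm: "cmod \<omega> = 1"
proof -
  have "cmod \<omega> ^ d = 1 ^ d" using root by (simp add: norm_power[symmetric])
  then show ?thesis by (rule power_eq_imp_eq_base) (use d_pos in simp_all)
qed

lemma phase_power_ne_1:
  assumes "0 < j" "j < d" shows "\<omega> ^ ((d - 1) * j) \<noteq> 1"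
proof
  assume "\<omega> ^ ((d - 1) * j) = 1"
  then have "\<omega> ^ j = \<omega> ^ ((d - 1) * j + j)" by (simp add: power_add)
  also have "(d - 1) * j + j = d * j" using d_pos by (cases d) simp_all
  also have "\<omega> ^ (d * j) = 1" by (simp add: power_mult root)
  finally show False using primitive[OF assms] by simp
qed

text \<open>The column is written as a function of the row, so that each row of a product has a
  single nonzero term.\<close>

lemma Xmat_pow:
  "Xmat d ^\<^sub>m u = mat d d (\<lambda>(a, b). if b = (a + u) mod d then 1 else 0)"
proof (induction u)
  case 0
  show ?case by (rule eq_matI) (simp_all add: Xmat_def)
next
  case (Suc u)
  have X: "Xmat d \<in> carrier_mat d d" by (simp add: Xmat_def)
  show ?case
  proof (rule eq_matI)
    fix a c assume "a < dim_row (mat d d (\<lambda>(a, b). if b = (a + Suc u) mod d then 1 else 0 :: complex))"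
      "c < dim_col (mat d d (\<lambda>(a, b). if b = (a + Suc u) mod d then 1 else 0 :: complex))"
    then have ac: "a < d" "c < d" by simp_all
    have inv: "b = (c + d - 1) mod d \<longleftrightarrow> c = (b + 1) mod d" if "b < d" for b
    proof
      assume "b = (c + d - 1) mod d"
      then have "(b + 1) mod d = (c + d - 1 + 1) mod d" by (simp only: mod_add_left_eq)
      also have "\<dots> = c" using ac d_pos by simp
      finally show "c = (b + 1) mod d" by simp
    next
      assume "c = (b + 1) mod d"
      then have "(c + (d - 1)) mod d = (b + 1 + (d - 1)) mod d" by (simp only: mod_add_left_eq)
      also have "\<dots> = b" using that d_pos by simp
      finally show "b = (c + d - 1) mod d" using d_pos by simp
    qed
    have "(Xmat d ^\<^sub>m Suc u) $$ (a, c) = (\<Sum>b<d. (Xmat d ^\<^sub>m u) $$ (a, b) * Xmat d $$ (b, c))"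
      using mult_index_sum[OF pow_carrier_mat[OF X] X ac, of u] by simp
    also have "\<dots> = (\<Sum>b<d. if b = (a + u) mod d then (if c = (b + 1) mod d then 1 else 0) else 0)"
    proof (rule sum.cong[OF refl])
      fix b assume "b \<in> {..<d}"
      then have b: "b < d" by simp
      have "Xmat d $$ (b, c) = (if b = (c + d - 1) mod d then 1 else 0)" using b ac by (simp add: Xmat_def)
      then show "(Xmat d ^\<^sub>m u) $$ (a, b) * Xmat d $$ (b, c) =
          (if b = (a + u) mod d then (if c = (b + 1) mod d then 1 else 0) else 0)"
        unfolding inv[OF b] Suc using b ac by simp
    qed
    also have "\<dots> = (if c = ((a + u) mod d + 1) mod d then 1 else 0)" using d_pos by (simp add: sum.delta)
    also have "((a + u) mod d + 1) mod d = (a + Suc u) mod d" by (simp add: mod_simps)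
    finally show "(Xmat d ^\<^sub>m Suc u) $$ (a, c) = mat d d (\<lambda>(a, b). if b = (a + Suc u) mod d then 1 else 0) $$ (a, c)"
      using ac by simp
  qed (simp_all add: Xmat_def)
qed

lemma Zmat_pow: "Zmat d \<omega> ^\<^sub>m v = mat d d (\<lambda>(a, b). if a = b then \<omega> ^ (a * v) else 0)"
proof (induction v)
  case 0
  show ?case by (rule eq_matI) (simp_all add: Zmat_def)
next
  case (Suc v)
  have Z: "Zmat d \<omega> \<in> carrier_mat d d" by (simp add: Zmat_def)
  show ?case
  proof (rule eq_matI)
    fix a c assume "a < dim_row (mat d d (\<lambda>(a, b). if a = b then \<omega> ^ (a * Suc v) else 0))"
      "c < dim_col (mat d d (\<lambda>(a, b). if a = b then \<omega> ^ (a * Suc v) else 0))"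
    then have ac: "a < d" "c < d" by simp_all
    have "(Zmat d \<omega> ^\<^sub>m Suc v) $$ (a, c) = (\<Sum>b<d. (Zmat d \<omega> ^\<^sub>m v) $$ (a, b) * Zmat d \<omega> $$ (b, c))"
      using mult_index_sum[OF pow_carrier_mat[OF Z] Z ac, of v] by simp
    also have "\<dots> = (\<Sum>b<d. if b = a then (if a = c then \<omega> ^ (a * v) * \<omega> ^ a else 0) else 0)"
      unfolding Suc using ac by (intro sum.cong refl) (auto simp: Zmat_def)
    also have "\<dots> = (if a = c then \<omega> ^ (a * v) * \<omega> ^ a else 0)" using ac by simp
    finally show "(Zmat d \<omega> ^\<^sub>m Suc v) $$ (a, c) = mat d d (\<lambda>(a, b). if a = b then \<omega> ^ (a * Suc v) else 0) $$ (a, c)"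
      using ac by (simp add: power_add mult.commute)
  qed (simp_all add: Zmat_def)
qed

lemma pauli1_eq: "pauli1 d \<omega> uv = mat d d (\<lambda>(a, b). if b = (a + fst uv) mod d then \<omega> ^ (b * snd uv) else 0)"
proof (rule eq_matI)
  fix a c assume "a < dim_row (mat d d (\<lambda>(a, b). if b = (a + fst uv) mod d then \<omega> ^ (b * snd uv) else 0))"
    "c < dim_col (mat d d (\<lambda>(a, b). if b = (a + fst uv) mod d then \<omega> ^ (b * snd uv) else 0))"
  then have ac: "a < d" "c < d" by simp_all
  have "pauli1 d \<omega> uv $$ (a, c) = (\<Sum>b<d. (Xmat d ^\<^sub>m fst uv) $$ (a, b) * (Zmat d \<omega> ^\<^sub>m snd uv) $$ (b, c))"
    unfolding pauli1_def using ac by (intro mult_index_sum[of _ d d _ d]) (simp_all add: Xmat_pow Zmat_pow)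
  also have "\<dots> = (\<Sum>b<d. if b = c then (if c = (a + fst uv) mod d then \<omega> ^ (c * snd uv) else 0) else 0)"
    unfolding Xmat_pow Zmat_pow using ac by (intro sum.cong refl) auto
  also have "\<dots> = (if c = (a + fst uv) mod d then \<omega> ^ (c * snd uv) else 0)" using ac by simp
  finally show "pauli1 d \<omega> uv $$ (a, c) = mat d d (\<lambda>(a, b). if b = (a + fst uv) mod d then \<omega> ^ (b * snd uv) else 0) $$ (a, c)"
    using ac by simp
qed (simp_all add: pauli1_def Xmat_pow Zmat_pow)

lemma pauli1_carrier [simp]: "pauli1 d \<omega> uv \<in> carrier_mat d d"
  by (simp add: pauli1_eq)

lemma pauli1_mult:
  "pauli1 d \<omega> x * pauli1 d \<omega> y =
    \<omega> ^ ((d - 1) * (snd x * fst y)) \<cdot>\<^sub>m pauli1 d \<omega> ((fst x + fst y) mod d, (snd x + snd y) mod d)"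
proof (rule eq_matI)
  obtain u v u' v' where xy: "x = (u, v)" "y = (u', v')" by (cases x, cases y) auto
  fix a c assume "a < dim_row (\<omega> ^ ((d - 1) * (snd x * fst y)) \<cdot>\<^sub>m pauli1 d \<omega> ((fst x + fst y) mod d, (snd x + snd y) mod d))"
    "c < dim_col (\<omega> ^ ((d - 1) * (snd x * fst y)) \<cdot>\<^sub>m pauli1 d \<omega> ((fst x + fst y) mod d, (snd x + snd y) mod d))"
  then have ac: "a < d" "c < d" by (simp_all add: pauli1_eq)
  define b where "b = (a + u) mod d"
  have b: "b < d" using d_pos by (simp add: b_def)
  have "(pauli1 d \<omega> x * pauli1 d \<omega> y) $$ (a, c) = (\<Sum>k<d. pauli1 d \<omega> x $$ (a, k) * pauli1 d \<omega> y $$ (k, c))"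
    by (rule mult_index_sum[OF pauli1_carrier pauli1_carrier ac])
  also have "\<dots> = (\<Sum>k<d. if k = b then \<omega> ^ (b * v) * (if c = (b + u') mod d then \<omega> ^ (c * v') else 0) else 0)"
    unfolding pauli1_eq xy using ac by (intro sum.cong refl) (auto simp: b_def)
  also have "\<dots> = \<omega> ^ (b * v) * (if c = (b + u') mod d then \<omega> ^ (c * v') else 0)" using b by simp
  also have "\<dots> = \<omega> ^ ((d - 1) * (v * u')) * (if c = (a + (u + u') mod d) mod d then \<omega> ^ (c * ((v + v') mod d)) else 0)"
  proof -
    have e: "(b + u') mod d = (a + (u + u') mod d) mod d" unfolding b_def by (simp add: mod_simps add.assoc)
    show ?thesis
    proof (cases "c = (b + u') mod d")
      case True
      \<comment> \<open>Modulo d the term (d - 1) v u' cancels the cross term v u' in (b + u') (v +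
        v'), leaving b v + c v', the exponent of the product on the left.\<close>
      have "((d - 1) * (v * u') + c * ((v + v') mod d)) mod d = ((d - 1) * (v * u') + c * (v + v')) mod d"
        by (metis mod_add_right_eq mod_mult_right_eq)
      also have "\<dots> = ((d - 1) * (v * u') + (b + u') * (v + v')) mod d"
        unfolding True by (metis mod_add_right_eq mod_mult_left_eq)
      also have "(d - 1) * (v * u') + (b + u') * (v + v') = d * (v * u') + (b * v + (b + u') * v')"
        using d_pos by (cases d) (simp_all add: algebra_simps)
      also have "\<dots> mod d = (b * v + (b + u') * v') mod d" by simp
      also have "\<dots> = (b * v + c * v') mod d" unfolding True by (metis mod_add_right_eq mod_mult_left_eq)
      finally have "\<omega> ^ ((d - 1) * (v * u') + c * ((v + v') mod d)) = \<omega> ^ (b * v + c * v')" by (rule \<omega>_cong)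
      then show ?thesis using True e by (simp add: power_add)
    qed (simp add: e)
  qed
  finally show "(pauli1 d \<omega> x * pauli1 d \<omega> y) $$ (a, c) =
      (\<omega> ^ ((d - 1) * (snd x * fst y)) \<cdot>\<^sub>m pauli1 d \<omega> ((fst x + fst y) mod d, (snd x + snd y) mod d)) $$ (a, c)"
    using ac unfolding xy by (simp add: pauli1_eq)
qed (simp_all add: pauli1_eq)

lemma pauli1_unitary: "mat_adjoint (pauli1 d \<omega> x) * pauli1 d \<omega> x = 1\<^sub>m d"
proof (rule eq_matI)
  fix b c assume "b < dim_row (1\<^sub>m d :: complex mat)" "c < dim_col (1\<^sub>m d :: complex mat)"
  then have bc: "b < d" "c < d" by simp_all
  \<comment> \<open>The nonzero entries lie on the graph of this permutation, so exactly one row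
    \<open>a0\<close> meets column b.\<close>
  define s where "s a = (a + fst x) mod d" for a
  have inj: "inj_on s {..<d}"
  proof (rule inj_onI)
    fix a a' assume a: "a \<in> {..<d}" "a' \<in> {..<d}" and eq: "s a = s a'"
    have "int a mod int d = int a' mod int d"
    proof -
      have "(int a + int (fst x)) mod int d = (int a' + int (fst x)) mod int d"
        using eq unfolding s_def by (metis of_nat_add of_nat_mod)
      then have "((int a + int (fst x)) - int (fst x)) mod int d = ((int a' + int (fst x)) - int (fst x)) mod int d"
        by (metis mod_diff_left_eq)
      then show ?thesis by simp
    qed
    then show "a = a'" using a by simp
  qed
  have "s ` {..<d} \<subseteq> {..<d}" using d_pos by (auto simp: s_def)
  then have surj: "s ` {..<d} = {..<d}" using inj by (simp add: endo_inj_surj)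
  then obtain a0 where a0: "a0 < d" "s a0 = b" using bc(1) by (metis imageE lessThan_iff)
  have uniq: "s a = b \<longleftrightarrow> a = a0" if "a < d" for a using inj a0 that by (metis inj_onD lessThan_iff)
  have "(mat_adjoint (pauli1 d \<omega> x) * pauli1 d \<omega> x) $$ (b, c) = (\<Sum>a<d. mat_adjoint (pauli1 d \<omega> x) $$ (b, a) * pauli1 d \<omega> x $$ (a, c))"
    by (rule mult_index_sum[OF mat_adjoint_carrier[OF pauli1_carrier] pauli1_carrier bc])
  also have "\<dots> = (\<Sum>a<d. if a = a0 then (if b = c then 1 else 0) else 0)"
  proof (intro sum.cong refl)
    fix a assume "a \<in> {..<d}"
    then have a: "a < d" by simp
    have "mat_adjoint (pauli1 d \<omega> x) $$ (b, a) = cnj (pauli1 d \<omega> x $$ (a, b))"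
      using a bc carrier_matD[OF pauli1_carrier[of x]] by simp
    then have "mat_adjoint (pauli1 d \<omega> x) $$ (b, a) * pauli1 d \<omega> x $$ (a, c) =
        (if s a = b \<and> s a = c then cnj (\<omega> ^ (b * snd x)) * \<omega> ^ (b * snd x) else 0)"
      using a bc by (auto simp: pauli1_eq s_def)
    also have "cnj (\<omega> ^ (b * snd x)) * \<omega> ^ (b * snd x) = 1"
      using complex_norm_square[of "\<omega> ^ (b * snd x)"] by (simp add: norm_power \<omega>_norm mult.commute)
    finally show "mat_adjoint (pauli1 d \<omega> x) $$ (b, a) * pauli1 d \<omega> x $$ (a, c) = (if a = a0 then (if b = c then 1 else 0) else 0)"
      using uniq[OF a] by auto
  qed
  also have "\<dots> = (1\<^sub>m d :: complex mat) $$ (b, c)" using a0 bc by simp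
  finally show "(mat_adjoint (pauli1 d \<omega> x) * pauli1 d \<omega> x) $$ (b, c) = (1\<^sub>m d :: complex mat) $$ (b, c)" .
qed (simp_all add: pauli1_eq)

lemma pauli1_zero: "pauli1 d \<omega> (0, 0) = 1\<^sub>m d"
  unfolding pauli1_eq by (rule eq_matI) auto

text \<open>A nonzero shift u leaves no entry on the diagonal; for u = 0 the trace is a full
  geometric sum with ratio \<omega>^v, which is a d-th root of unity other than 1.\<close>

lemma pauli1_trace:
  assumes "x \<in> pts d" "x \<noteq> (0, 0)" shows "mtrace (pauli1 d \<omega> x) = 0"
proof -
  obtain u v where x: "x = (u, v)" "u < d" "v < d" using assms(1) by (cases x) (simp add: pts_def)
  have tr: "mtrace (pauli1 d \<omega> x) = (\<Sum>a<d. if a = (a + u) mod d then \<omega> ^ (a * v) else 0)"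
    unfolding mtrace_def pauli1_eq x(1) by (simp cong: if_cong)
  show ?thesis
  proof (cases "u = 0")
    case True
    then have v: "0 < v" using assms(2) x by simp
    have "(\<Sum>a<d. (\<omega> ^ v) ^ a) = ((\<omega> ^ v) ^ d - 1) / (\<omega> ^ v - 1)"
      by (rule geometric_sum) (rule primitive[OF v x(3)])
    also have "(\<omega> ^ v) ^ d = 1" by (metis power_mult mult.commute root power_one)
    finally have "(\<Sum>a<d. (\<omega> ^ v) ^ a) = 0" by simp
    then show ?thesis unfolding tr True by (simp add: power_mult[symmetric] mult.commute)
  next
    case False
    have "a \<noteq> (a + u) mod d" if "a < d" for a
      using False x that by (cases "a + u < d") (auto simp: mod_if)
    then show ?thesis unfolding tr by simp
  qed
qed

section \<open>Tensor products of Pauli matrices\<close>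

lemma pauli_Nil: "pauli d \<omega> [] = 1\<^sub>m 1" and pauli_Cons: "pauli d \<omega> (x # xs) = kron (pauli1 d \<omega> x) (pauli d \<omega> xs)"
  by (simp_all add: pauli_def)

lemma pauli_carrier: "length xs = n \<Longrightarrow> pauli d \<omega> xs \<in> carrier_mat (d ^ n) (d ^ n)"
proof (induction xs arbitrary: n)
  case (Cons x xs)
  then obtain m where m: "n = Suc m" "length xs = m" by auto
  show ?case unfolding pauli_Cons m(1) power_Suc by (rule kron_carrier[OF pauli1_carrier Cons.IH[OF m(2)]])
qed (simp add: pauli_Nil)

lemma pauli_mult:
  "length xs = length ys \<Longrightarrow> pauli d \<omega> xs * pauli d \<omega> ys = weyl_phase d \<omega> xs ys \<cdot>\<^sub>m pauli d \<omega> (fadd d xs ys)"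
proof (induction xs ys rule: list_induct2)
  case Nil
  show ?case by (simp add: pauli_Nil weyl_phase_def)
next
  case (Cons x xs y ys)
  define n where "n = length ys"
  have xc: "pauli d \<omega> xs \<in> carrier_mat (d ^ n) (d ^ n)" and yc: "pauli d \<omega> ys \<in> carrier_mat (d ^ n) (d ^ n)"
    and fc: "pauli d \<omega> (fadd d xs ys) \<in> carrier_mat (d ^ n) (d ^ n)"
    using Cons.hyps by (intro pauli_carrier; simp add: n_def)+
  have ks: "kron (a \<cdot>\<^sub>m A) (b \<cdot>\<^sub>m B) = (a * b) \<cdot>\<^sub>m kron A B"
    if A: "A \<in> carrier_mat d d" and B: "B \<in> carrier_mat (d ^ n) (d ^ n)" for a b A B
  proof (rule kron_eqI[of _ d "d ^ n" d "d ^ n"])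
    fix r i s j assume h: "r < d" "i < d ^ n" "s < d" "j < d ^ n"
    have "kron (a \<cdot>\<^sub>m A) (b \<cdot>\<^sub>m B) $$ (r * d ^ n + i, s * d ^ n + j) = (a \<cdot>\<^sub>m A) $$ (r, s) * (b \<cdot>\<^sub>m B) $$ (i, j)"
      by (rule kron_index[of _ d d _ "d ^ n" "d ^ n"]) (use A B h in simp_all)
    moreover have "kron A B $$ (r * d ^ n + i, s * d ^ n + j) = A $$ (r, s) * B $$ (i, j)"
      by (rule kron_index[OF A B h])
    ultimately show "kron (a \<cdot>\<^sub>m A) (b \<cdot>\<^sub>m B) $$ (r * d ^ n + i, s * d ^ n + j) = ((a * b) \<cdot>\<^sub>m kron A B) $$ (r * d ^ n + i, s * d ^ n + j)"
      using h A B carrier_matD[OF kron_carrier[OF A B]] index_bound[OF h(1,2)] index_bound[OF h(3,4)] by simp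
  qed (use kron_carrier[of "a \<cdot>\<^sub>m A" d d "b \<cdot>\<^sub>m B" "d ^ n" "d ^ n"] kron_carrier[OF A B] A B in simp_all)
  have "pauli d \<omega> (x # xs) * pauli d \<omega> (y # ys) = kron (pauli1 d \<omega> x * pauli1 d \<omega> y) (pauli d \<omega> xs * pauli d \<omega> ys)"
    unfolding pauli_Cons by (rule kron_mult[OF pauli1_carrier xc pauli1_carrier yc])
  also have "\<dots> = (\<omega> ^ ((d - 1) * (snd x * fst y)) * weyl_phase d \<omega> xs ys) \<cdot>\<^sub>m pauli d \<omega> (fadd d (x # xs) (y # ys))"
    unfolding Cons.IH pauli1_mult fadd_Cons pauli_Cons by (rule ks[OF pauli1_carrier fc])
  finally show ?case by (simp add: weyl_phase_def power_add algebra_simps)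
qed

lemma pauli_fzero: "pauli d \<omega> (fzero n) = 1\<^sub>m (d ^ n)"
  by (induction n) (simp_all add: pauli_Nil pauli_Cons pauli1_zero kron_one)

lemma pauli_unitary: "length xs = n \<Longrightarrow> mat_adjoint (pauli d \<omega> xs) * pauli d \<omega> xs = 1\<^sub>m (d ^ n)"
proof (induction xs arbitrary: n)
  case (Cons x xs)
  then obtain m where m: "n = Suc m" "length xs = m" by auto
  note c = pauli_carrier[OF m(2)]
  show ?case unfolding pauli_Cons kron_adjoint[OF pauli1_carrier c]
      kron_mult[OF mat_adjoint_carrier[OF pauli1_carrier] mat_adjoint_carrier[OF c] pauli1_carrier c]
      pauli1_unitary Cons.IH[OF m(2)] kron_one m(1) by simp
qed (simp add: pauli_Nil)

lemma pauli_trace: "xs \<in> strings d n \<Longrightarrow> xs \<noteq> fzero n \<Longrightarrow> mtrace (pauli d \<omega> xs) = 0"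
proof (induction n arbitrary: xs)
  case (Suc n)
  obtain x ys where x: "xs = x # ys" "x \<in> pts d" "ys \<in> strings d n" by (rule strings_Suc_cases[OF Suc.prems(1)])
  have tr: "mtrace (pauli d \<omega> xs) = mtrace (pauli1 d \<omega> x) * mtrace (pauli d \<omega> ys)"
    unfolding x(1) pauli_Cons by (rule mtrace_kron[OF pauli1_carrier pauli_carrier[OF strings_length[OF x(3)]]])
  show ?case
  proof (cases "x = (0, 0)")
    case True
    then have "ys \<noteq> fzero n" using Suc.prems(2) x by simp
    then show ?thesis using Suc.IH[OF x(3)] tr by simp
  next
    case False
    then show ?thesis using pauli1_trace[OF x(2)] tr by simp
  qed
qed simp

section \<open>The phase as a nondegenerate bicharacter\<close>

lemma half_dot_fadd_left:
  "length xs = length ys \<Longrightarrow> length ys = length zs \<Longrightarrow>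
    half_dot (fadd d xs ys) zs mod d = (half_dot xs zs + half_dot ys zs) mod d"
proof (induction xs ys zs rule: list_induct3)
  case (Cons x xs y ys z zs)
  have "half_dot (fadd d (x # xs) (y # ys)) (z # zs) mod d =
      ((snd x + snd y) mod d * fst z + half_dot (fadd d xs ys) zs) mod d" by (simp add: fadd_Cons)
  also have "\<dots> = ((snd x + snd y) * fst z + (half_dot xs zs + half_dot ys zs)) mod d"
    using Cons.IH by (metis mod_add_eq mod_mult_left_eq)
  finally show ?case by (simp add: algebra_simps)
qed simp

lemma half_dot_fadd_right:
  "length xs = length ys \<Longrightarrow> length ys = length zs \<Longrightarrow>
    half_dot xs (fadd d ys zs) mod d = (half_dot xs ys + half_dot xs zs) mod d"
proof (induction xs ys zs rule: list_induct3)
  case (Cons x xs y ys z zs)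
  have "half_dot (x # xs) (fadd d (y # ys) (z # zs)) mod d =
      (snd x * ((fst y + fst z) mod d) + half_dot xs (fadd d ys zs)) mod d" by (simp add: fadd_Cons)
  also have "\<dots> = (snd x * (fst y + fst z) + (half_dot xs ys + half_dot xs zs)) mod d"
    using Cons.IH by (metis mod_add_eq mod_mult_right_eq)
  finally show ?case by (simp add: algebra_simps)
qed simp

lemma weyl_phase_cong: "half_dot xs ys mod d = k mod d \<Longrightarrow> weyl_phase d \<omega> xs ys = \<omega> ^ ((d - 1) * k)"
  unfolding weyl_phase_def by (rule \<omega>_cong) (metis mod_mult_right_eq)

lemma half_dot_fzero [simp]: "half_dot xs (fzero n) = 0" "half_dot (fzero n) xs = 0"
proof -
  show "half_dot xs (fzero n) = 0"
  proof (induction n arbitrary: xs)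
    case (Suc n)
    show ?case by (cases xs) (simp_all add: Suc)
  qed simp
  show "half_dot (fzero n) xs = 0"
  proof (induction n arbitrary: xs)
    case (Suc n)
    show ?case by (cases xs) (simp_all add: Suc)
  qed simp
qed

text \<open>At the first nonzero site test with (0, 1) if its Z exponent vanishes and with (1, 0)
  otherwise, and with zero elsewhere: exactly one of the two half products is nonzero, and it is an
  exponent below d.\<close>

lemma weyl_phase_nondegenerate:
  "xs \<in> strings d n \<Longrightarrow> xs \<noteq> fzero n \<Longrightarrow> \<exists>ys\<in>strings d n. weyl_phase d \<omega> xs ys \<noteq> weyl_phase d \<omega> ys xs"
proof (induction n arbitrary: xs)
  case (Suc n)
  obtain x zs where x: "xs = x # zs" "x \<in> pts d" "zs \<in> strings d n" by (rule strings_Suc_cases[OF Suc.prems(1)])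
  obtain u v where uv: "x = (u, v)" "u < d" "v < d" using x(2) by (cases x) (simp add: pts_def)
  have mem: "b # fzero n \<in> strings d (Suc n)" if "b \<in> pts d" for b
    using that fzero_mem[OF d_pos] by (simp add: strings_Cons)
  show ?case
  proof (cases "x = (0, 0)")
    case True
    then have "zs \<noteq> fzero n" using Suc.prems(2) x by simp
    from Suc.IH[OF x(3) this] obtain ys where ys: "ys \<in> strings d n" "weyl_phase d \<omega> zs ys \<noteq> weyl_phase d \<omega> ys zs" by blast
    have "(0, 0) # ys \<in> strings d (Suc n)" using ys(1) d_pos by (simp add: strings_Cons pts_def)
    moreover have "weyl_phase d \<omega> xs ((0, 0) # ys) \<noteq> weyl_phase d \<omega> ((0, 0) # ys) xs"
      using ys(2) unfolding x(1) True weyl_phase_def by simp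
    ultimately show ?thesis by blast
  next
    case False
    show ?thesis
    proof (cases "v = 0")
      case True
      then have "0 < u" using False uv by simp
      then have "weyl_phase d \<omega> xs ((0, 1) # fzero n) \<noteq> weyl_phase d \<omega> ((0, 1) # fzero n) xs"
        using phase_power_ne_1[of u] uv(2) unfolding x(1) uv(1) True weyl_phase_def by simp
      moreover have "(0, 1) # fzero n \<in> strings d (Suc n)" by (rule mem) (use d_gt1 in \<open>simp add: pts_def\<close>)
      ultimately show ?thesis by blast
    next
      case v: False
      then have "weyl_phase d \<omega> xs ((1, 0) # fzero n) \<noteq> weyl_phase d \<omega> ((1, 0) # fzero n) xs"
        using phase_power_ne_1[of v] uv(3) unfolding x(1) uv(1) weyl_phase_def by simp
      moreover have "(1, 0) # fzero n \<in> strings d (Suc n)" by (rule mem) (use d_gt1 in \<open>simp add: pts_def\<close>)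
      ultimately show ?thesis by blast
    qed
  qed
qed simp

text \<open>The symplectic form is the difference of the two half products, so its vanishing modulo
  d makes the two powers of \<omega> equal.\<close>

lemma weyl_phase_commute_of_sympl:
  assumes "length xs = length ys" "sympl d xs ys = 0"
  shows "weyl_phase d \<omega> xs ys = weyl_phase d \<omega> ys xs"
proof -
  have "(\<Sum>i<length xs. int (fst (xs ! i)) * int (snd (ys ! i)) - int (snd (xs ! i)) * int (fst (ys ! i))) =
      int (half_dot ys xs) - int (half_dot xs ys)"
    unfolding half_dot_sum[OF assms(1)] half_dot_sum[OF assms(1)[symmetric]] assms(1)[symmetric]
    by (simp add: sum_subtractf mult.commute)
  then have "(int (half_dot ys xs) - int (half_dot xs ys)) mod int d = 0"
    using assms(2) unfolding sympl_def by simp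
  then have "int (half_dot ys xs) mod int d = int (half_dot xs ys) mod int d"
    by (simp add: mod_eq_dvd_iff mod_eq_0_iff_dvd)
  then have "half_dot xs ys mod d = half_dot ys xs mod d" by (metis of_nat_mod of_nat_eq_iff)
  from weyl_phase_cong[OF this] show ?thesis by (simp add: weyl_phase_def)
qed

lemma weyl_system_strings: "weyl_system (string_group d n) (d ^ n) d (pauli d \<omega>) (weyl_phase d \<omega>)"
proof -
  interpret comm_group "string_group d n" by (rule string_group_comm_group[OF d_pos])
  have len: "length x = length y" if "x \<in> strings d n" "y \<in> strings d n" for x y
    using that by (simp add: strings_length)
  show ?thesis
  proof (unfold_locales, unfold string_group_simps)
    show "finite (strings d n)" by (rule finite_strings)
    show "prime d" by (rule d_prime)
    show "0 < d ^ n" using d_pos by simp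
  next
    fix x assume x: "x \<in> strings d n"
    show "pauli d \<omega> x \<in> carrier_mat (d ^ n) (d ^ n)" by (rule pauli_carrier[OF strings_length[OF x]])
    show "mat_adjoint (pauli d \<omega> x) * pauli d \<omega> x = 1\<^sub>m (d ^ n)" by (rule pauli_unitary[OF strings_length[OF x]])
    show "x [^]\<^bsub>string_group d n\<^esub> d = fzero n"
      unfolding string_group_pow[OF x] by (rule nth_equalityI) (simp_all add: fscale_def strings_length[OF x])
    show "mtrace (pauli d \<omega> x) = 0" if "x \<noteq> fzero n" by (rule pauli_trace[OF x that])
    show "\<exists>y\<in>strings d n. weyl_phase d \<omega> x y \<noteq> weyl_phase d \<omega> y x" if "x \<noteq> fzero n"
      by (rule weyl_phase_nondegenerate[OF x that])
    fix y assume y: "y \<in> strings d n"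
    show "pauli d \<omega> x * pauli d \<omega> y = weyl_phase d \<omega> x y \<cdot>\<^sub>m pauli d \<omega> (fadd d x y)"
      by (rule pauli_mult[OF len[OF x y]])
    show "cmod (weyl_phase d \<omega> x y) = 1" by (simp add: weyl_phase_def norm_power \<omega>_norm)
    fix z assume z: "z \<in> strings d n"
    show "weyl_phase d \<omega> (fadd d x y) z = weyl_phase d \<omega> x z * weyl_phase d \<omega> y z"
      using weyl_phase_cong[OF half_dot_fadd_left[OF len[OF x y] len[OF y z]]]
      by (simp add: weyl_phase_def distrib_left power_add)
    show "weyl_phase d \<omega> x (fadd d y z) = weyl_phase d \<omega> x y * weyl_phase d \<omega> x z"
      using weyl_phase_cong[OF half_dot_fadd_right[OF len[OF x y] len[OF y z]]]
      by (simp add: weyl_phase_def distrib_left power_add)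
  qed (rule pauli_fzero)
qed

end

section \<open>Blocks of independent errors\<close>

primrec blocks :: "'a list set \<Rightarrow> nat \<Rightarrow> 'a list set" where
  "blocks K 0 = {[]}"
| "blocks K (Suc m) = (\<lambda>(x, y). x @ y) ` (K \<times> blocks K m)"

lemma inj_on_append:
  assumes "\<And>x. x \<in> A \<Longrightarrow> length x = n"
  shows "inj_on (\<lambda>(x, y). x @ y) (A \<times> B)"
  by (rule inj_onI) (use assms in fastforce)

lemma sum_append_image:
  assumes "\<And>x. x \<in> A \<Longrightarrow> length x = n"
  shows "(\<Sum>z\<in>(\<lambda>(x, y). x @ y) ` (A \<times> B). f z) = (\<Sum>x\<in>A. \<Sum>y\<in>B. f (x @ y) :: real)"
  by (subst sum.reindex[OF inj_on_append[OF assms]]) (simp_all add: sum.cartesian_product case_prod_beta)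

lemma card_blocks:
  assumes "\<And>x. x \<in> K \<Longrightarrow> length x = n"
  shows "card (blocks K m) = card K ^ m"
proof (induction m)
  case (Suc m)
  show ?case by (simp add: card_image[OF inj_on_append[OF assms]] card_cartesian_product Suc)
qed simp

lemma blocks_mono: "K \<subseteq> H \<Longrightarrow> blocks K m \<subseteq> blocks H m"
proof (induction m)
  case (Suc m)
  show ?case unfolding blocks.simps by (intro image_mono Sigma_mono Suc)
qed simp

lemma append_strings: "(\<lambda>(x, y). x @ y) ` (strings d n \<times> strings d m) = strings d (n + m)"
proof
  show "(\<lambda>(x, y). x @ y) ` (strings d n \<times> strings d m) \<subseteq> strings d (n + m)"
    by (auto simp: strings_def)
  show "strings d (n + m) \<subseteq> (\<lambda>(x, y). x @ y) ` (strings d n \<times> strings d m)"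
  proof
    fix z assume z: "z \<in> strings d (n + m)"
    have "take n z \<in> strings d n" "drop n z \<in> strings d m"
      using z set_take_subset[of n z] set_drop_subset[of n z] by (auto simp: strings_def)
    then show "z \<in> (\<lambda>(x, y). x @ y) ` (strings d n \<times> strings d m)"
      by (intro image_eqI[of _ _ "(take n z, drop n z)"]) simp_all
  qed
qed

lemma blocks_strings: "blocks (strings d n) m = strings d (n * m)"
  by (induction m) (simp_all add: append_strings)

lemma sum_strings_append:
  "(\<Sum>z\<in>strings d (n + m). f z) = (\<Sum>x\<in>strings d n. \<Sum>y\<in>strings d m. f (x @ y) :: real)"
  unfolding append_strings[symmetric] by (rule sum_append_image) (rule strings_length)

lemma Pn_append: "Pn P (xs @ ys) = Pn P xs * Pn P ys"
  by (simp add: Pn_def)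

primrec block_sum :: "nat \<Rightarrow> ('a list \<Rightarrow> real) \<Rightarrow> nat \<Rightarrow> 'a list \<Rightarrow> real" where
  "block_sum n f 0 e = 0"
| "block_sum n f (Suc m) e = f (take n e) + block_sum n f m (drop n e)"

text \<open>For a subgroup K this is the probability of the coset of e. With K the stabilizer it is
  the probability of the error class, with K its complement the probability of the syndrome.\<close>

definition coset_mass :: "nat \<Rightarrow> (nat \<times> nat \<Rightarrow> real) \<Rightarrow> (nat \<times> nat) list set \<Rightarrow> (nat \<times> nat) list \<Rightarrow> real" where
  "coset_mass d P K e = (\<Sum>k\<in>K. Pn P (fadd d e k))"

lemma coset_mass_append:
  assumes K: "K \<subseteq> strings d n" and x: "x \<in> strings d n"
  shows "coset_mass d P ((\<lambda>(x, y). x @ y) ` (K \<times> H)) (x @ y) = coset_mass d P K x * coset_mass d P H y"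
proof -
  have "coset_mass d P ((\<lambda>(x, y). x @ y) ` (K \<times> H)) (x @ y) = (\<Sum>k\<in>K. \<Sum>h\<in>H. Pn P (fadd d (x @ y) (k @ h)))"
    unfolding coset_mass_def by (rule sum_append_image) (use K strings_length in blast)
  also have "\<dots> = (\<Sum>k\<in>K. \<Sum>h\<in>H. Pn P (fadd d x k) * Pn P (fadd d y h))"
  proof (intro sum.cong refl)
    fix k h assume "k \<in> K"
    then have "length x = length k" using K x strings_length by (metis subsetD)
    then show "Pn P (fadd d (x @ y) (k @ h)) = Pn P (fadd d x k) * Pn P (fadd d y h)"
      by (simp add: fadd_append Pn_append)
  qed
  finally show ?thesis by (simp add: coset_mass_def sum_product)
qed

section \<open>Moments over blocks, and complements of block powers\<close>

locale pauli_channel = primitive_root +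
  fixes P :: "nat \<times> nat \<Rightarrow> real"
  assumes prob: "prob_dist d P"
begin

lemma Pn_nonneg: "xs \<in> strings d n \<Longrightarrow> Pn P xs \<ge> 0"
proof (induction n arbitrary: xs)
  case (Suc n)
  obtain x ys where x: "xs = x # ys" "x \<in> pts d" "ys \<in> strings d n" by (rule strings_Suc_cases[OF Suc.prems])
  have "P x \<ge> 0" using prob x(2) by (simp add: prob_dist_def)
  then show ?case using Suc.IH[OF x(3)] by (simp add: x(1) Pn_def)
qed (simp add: Pn_def)

lemma Pn_sum: "(\<Sum>xs\<in>strings d n. Pn P xs) = 1"
proof (induction n)
  case (Suc n)
  have s1: "strings d 1 = (\<lambda>a. [a]) ` pts d"
  proof
    show "strings d 1 \<subseteq> (\<lambda>a. [a]) ` pts d"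
    proof
      fix xs assume "xs \<in> strings d 1"
      then have "xs \<in> strings d (Suc 0)" by simp
      then obtain x ys where x: "xs = x # ys" "x \<in> pts d" "ys \<in> strings d 0" by (rule strings_Suc_cases)
      then show "xs \<in> (\<lambda>a. [a]) ` pts d" by simp
    qed
    show "(\<lambda>a. [a]) ` pts d \<subseteq> strings d 1" by (auto simp: strings_def)
  qed
  have "(\<Sum>x\<in>strings d 1. Pn P x) = (\<Sum>a\<in>pts d. P a)"
    unfolding s1 by (subst sum.reindex) (simp_all add: inj_on_def Pn_def)
  then have 1: "(\<Sum>x\<in>strings d 1. Pn P x) = 1" using prob by (simp add: prob_dist_def)
  have "(\<Sum>xs\<in>strings d (1 + n). Pn P xs) = (\<Sum>x\<in>strings d 1. \<Sum>y\<in>strings d n. Pn P x * Pn P y)"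
    unfolding sum_strings_append Pn_append ..
  also have "\<dots> = (\<Sum>x\<in>strings d 1. Pn P x) * (\<Sum>y\<in>strings d n. Pn P y)" by (rule sum_product[symmetric])
  finally show ?case using Suc 1 by simp
qed (simp add: Pn_def)

text \<open>Centred sums over independent blocks: the variance is additive because the cross term is
  a product containing a vanishing mean, which is why the mean is carried along in the
  induction.\<close>

lemma block_sum_moments:
  fixes f :: "(nat \<times> nat) list \<Rightarrow> real" and \<mu> V :: real
  assumes \<mu>: "\<mu> = (\<Sum>x\<in>strings d n. Pn P x * f x)" and V: "V = (\<Sum>x\<in>strings d n. Pn P x * (f x - \<mu>)\<^sup>2)"
  shows "(\<Sum>e\<in>strings d (n * m). Pn P e * (block_sum n f m e - real m * \<mu>)) = 0"
    and "(\<Sum>e\<in>strings d (n * m). Pn P e * (block_sum n f m e - real m * \<mu>)\<^sup>2) = real m * V"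
proof -
  let ?b = "\<lambda>m e. block_sum n f m e - real m * \<mu>"
  have a: "(\<Sum>x\<in>strings d n. Pn P x * (f x - \<mu>)) = 0"
    using Pn_sum[of n] by (simp add: right_diff_distrib sum_subtractf \<mu>[symmetric] sum_distrib_right[symmetric])
  have split: "block_sum n f (Suc m) (x @ y) - real (Suc m) * \<mu> = (f x - \<mu>) + ?b m y" if "x \<in> strings d n" for x y m
    using strings_length[OF that] by (simp add: algebra_simps)
  have "(\<Sum>e\<in>strings d (n * m). Pn P e * ?b m e) = 0 \<and> (\<Sum>e\<in>strings d (n * m). Pn P e * (?b m e)\<^sup>2) = real m * V"
  proof (induction m)
    case (Suc m)
    let ?X = "strings d n" and ?Y = "strings d (n * m)"
    have "(\<Sum>e\<in>strings d (n * Suc m). Pn P e * ?b (Suc m) e) = (\<Sum>x\<in>?X. \<Sum>y\<in>?Y. Pn P (x @ y) * ?b (Suc m) (x @ y))"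
      unfolding mult_Suc_right by (rule sum_strings_append)
    also have "\<dots> = (\<Sum>x\<in>?X. \<Sum>y\<in>?Y. (Pn P x * (f x - \<mu>)) * Pn P y + Pn P x * (Pn P y * ?b m y))"
      by (intro sum.cong refl) (simp only: split Pn_append, simp add: algebra_simps)
    also have "\<dots> = (\<Sum>x\<in>?X. Pn P x * (f x - \<mu>)) * (\<Sum>y\<in>?Y. Pn P y) + (\<Sum>x\<in>?X. Pn P x) * (\<Sum>y\<in>?Y. Pn P y * ?b m y)"
      by (simp only: sum.distrib sum_product)
    finally have 1: "(\<Sum>e\<in>strings d (n * Suc m). Pn P e * ?b (Suc m) e) = 0" using a Suc by simp
    have "(\<Sum>e\<in>strings d (n * Suc m). Pn P e * (?b (Suc m) e)\<^sup>2) = (\<Sum>x\<in>?X. \<Sum>y\<in>?Y. Pn P (x @ y) * (?b (Suc m) (x @ y))\<^sup>2)"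
      unfolding mult_Suc_right by (rule sum_strings_append)
    also have "\<dots> = (\<Sum>x\<in>?X. \<Sum>y\<in>?Y. (Pn P x * (f x - \<mu>)\<^sup>2) * Pn P y +
        ((2 * (Pn P x * (f x - \<mu>))) * (Pn P y * ?b m y) + Pn P x * (Pn P y * (?b m y)\<^sup>2)))"
      by (intro sum.cong refl) (simp only: split Pn_append, simp add: algebra_simps power2_eq_square)
    also have "\<dots> = (\<Sum>x\<in>?X. Pn P x * (f x - \<mu>)\<^sup>2) * (\<Sum>y\<in>?Y. Pn P y) +
        ((\<Sum>x\<in>?X. 2 * (Pn P x * (f x - \<mu>))) * (\<Sum>y\<in>?Y. Pn P y * ?b m y) + (\<Sum>x\<in>?X. Pn P x) * (\<Sum>y\<in>?Y. Pn P y * (?b m y)\<^sup>2))"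
      by (simp only: sum.distrib sum_product)
    finally have "(\<Sum>e\<in>strings d (n * Suc m). Pn P e * (?b (Suc m) e)\<^sup>2) = V + real m * V"
      using Suc Pn_sum V by simp
    then show ?case using 1 by (simp add: distrib_right)
  qed simp
  then show "(\<Sum>e\<in>strings d (n * m). Pn P e * ?b m e) = 0" "(\<Sum>e\<in>strings d (n * m). Pn P e * (?b m e)\<^sup>2) = real m * V"
    by blast+
qed

text \<open>Inverses come from the exponent of the group: the inverse of x is its power d - 1, an
  iterated sum of x.\<close>

lemma subgroup_of_fadd_closed:
  assumes K: "K \<subseteq> strings d n" "fzero n \<in> K" "\<And>x y. x \<in> K \<Longrightarrow> y \<in> K \<Longrightarrow> fadd d x y \<in> K"
  shows "subgroup K (string_group d n)"
proof -
  interpret G: weyl_system "string_group d n" "d ^ n" d "pauli d \<omega>" "weyl_phase d \<omega>" by (rule weyl_system_strings)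
  have pow: "x [^]\<^bsub>string_group d n\<^esub> (k :: nat) \<in> K" if x: "x \<in> K" for x k
  proof (induction k)
    case 0
    show ?case using K(2) by simp
  next
    case (Suc k)
    show ?case using K(3)[OF Suc x] by simp
  qed
  have inv: "inv\<^bsub>string_group d n\<^esub> x \<in> K" if x: "x \<in> K" for x
  proof -
    have xc: "x \<in> carrier (string_group d n)" using x K(1) by auto
    have "d - 1 + 1 = d" using d_pos by simp
    then have "x [^]\<^bsub>string_group d n\<^esub> (d - 1) \<otimes>\<^bsub>string_group d n\<^esub> x = \<one>\<^bsub>string_group d n\<^esub>"
      using G.exponent[OF xc] by (metis G.nat_pow_Suc Suc_eq_plus1)
    then have "inv\<^bsub>string_group d n\<^esub> x = x [^]\<^bsub>string_group d n\<^esub> (d - 1)"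
      using xc G.nat_pow_closed[OF xc, of "d - 1"] by (intro G.inv_equality)
    then show ?thesis using pow[OF x] by simp
  qed
  show ?thesis
    by (rule G.subgroupI) (use K inv in auto)
qed

text \<open>The complement without reference to an interpretation of the Weyl system, so that
  complements for the lengths n and n * m can be related; equality of phases replaces the quotient
  in \<open>chi\<close>.\<close>

definition sperp :: "nat \<Rightarrow> (nat \<times> nat) list set \<Rightarrow> (nat \<times> nat) list set" where
  "sperp n M = {y \<in> strings d n. \<forall>x\<in>M. weyl_phase d \<omega> x y = weyl_phase d \<omega> y x}"

lemma sperp_eq_perp:
  assumes "M \<subseteq> strings d n"
  shows "weyl_system.perp (string_group d n) (weyl_phase d \<omega>) M = sperp n M"
proof -
  interpret G: weyl_system "string_group d n" "d ^ n" d "pauli d \<omega>" "weyl_phase d \<omega>" by (rule weyl_system_strings)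
  have "G.chi x y = 1 \<longleftrightarrow> weyl_phase d \<omega> x y = weyl_phase d \<omega> y x" if "x \<in> M" "y \<in> strings d n" for x y
    using that assms G.\<beta>_nonzero[of y x] by (auto simp: G.chi_def)
  then show ?thesis unfolding G.perp_def sperp_def by auto
qed

lemma weyl_phase_append:
  "length xs = length xs' \<Longrightarrow> weyl_phase d \<omega> (xs @ ys) (xs' @ ys') = weyl_phase d \<omega> xs xs' * weyl_phase d \<omega> ys ys'"
  by (simp add: weyl_phase_def half_dot_append distrib_left power_add)

lemma weyl_phase_fzero [simp]: "weyl_phase d \<omega> (fzero n) x = 1" "weyl_phase d \<omega> x (fzero n) = 1"
  by (simp_all add: weyl_phase_def)

lemma fzero_append: "fzero (n + m) = fzero n @ fzero m"
  by (simp add: fzero_def replicate_add)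

lemma blocks_subset: "K \<subseteq> strings d n \<Longrightarrow> blocks K m \<subseteq> strings d (n * m)"
  using blocks_mono[of K "strings d n" m] by (simp add: blocks_strings)

lemma fzero_blocks: "fzero n \<in> K \<Longrightarrow> fzero (n * m) \<in> blocks K m"
proof (induction m)
  case (Suc m)
  then show ?case by (simp add: fzero_append image_iff) blast
qed simp

lemma fadd_blocks:
  assumes K: "K \<subseteq> strings d n" "\<And>x y. x \<in> K \<Longrightarrow> y \<in> K \<Longrightarrow> fadd d x y \<in> K"
  shows "x \<in> blocks K m \<Longrightarrow> y \<in> blocks K m \<Longrightarrow> fadd d x y \<in> blocks K m"
proof (induction m arbitrary: x y)
  case (Suc m)
  from Suc.prems obtain a b a' b' where h: "a \<in> K" "a' \<in> K" "b \<in> blocks K m" "b' \<in> blocks K m" "x = a @ b" "y = a' @ b'"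
    by auto
  have "length a = length a'" using h K(1) strings_length by (metis subsetD)
  then have "fadd d x y = fadd d a a' @ fadd d b b'" by (simp add: h fadd_append)
  then show ?case using K(2)[OF h(1,2)] Suc.IH[OF h(3,4)] by (auto intro!: image_eqI[of _ _ "(fadd d a a', fadd d b b')"])
qed simp

text \<open>Both L and its block powers contain zero, so testing with strings that vanish on all but
  one part separates the condition on the first block from that on the remaining ones. Conversely
  the phases multiply over the parts.\<close>

lemma sperp_blocks:
  assumes L: "L \<subseteq> strings d n" "fzero n \<in> L"
  shows "sperp (n * m) (blocks L m) = blocks (sperp n L) m"
proof (induction m)
  case 0
  show ?case by (auto simp: sperp_def)
next
  case (Suc m)
  let ?c = "\<lambda>x y. weyl_phase d \<omega> x y = weyl_phase d \<omega> y x"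
  have len: "length a = length x" if "a \<in> L" "x \<in> strings d n" for a x using that L(1) strings_length by (metis subsetD)
  have iff: "x @ y \<in> sperp (n * Suc m) (blocks L (Suc m)) \<longleftrightarrow> x \<in> sperp n L \<and> y \<in> sperp (n * m) (blocks L m)"
    if x: "x \<in> strings d n" and y: "y \<in> strings d (n * m)" for x y
  proof -
    have xy: "x @ y \<in> strings d (n * Suc m)"
      using x y append_strings[of d n "n * m"] by (simp add: image_iff) blast
    have 1: "?c (a @ b) (x @ y) \<longleftrightarrow> weyl_phase d \<omega> a x * weyl_phase d \<omega> b y = weyl_phase d \<omega> x a * weyl_phase d \<omega> y b"
      if "a \<in> L" for a b
      using weyl_phase_append[OF len[OF that x]] weyl_phase_append[OF len[OF that x, symmetric]] by simp
    have "(\<forall>a\<in>L. \<forall>b\<in>blocks L m. ?c (a @ b) (x @ y)) \<longleftrightarrow> (\<forall>a\<in>L. ?c a x) \<and> (\<forall>b\<in>blocks L m. ?c b y)"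
    proof (intro iffI conjI ballI)
      assume h: "\<forall>a\<in>L. \<forall>b\<in>blocks L m. ?c (a @ b) (x @ y)"
      show "?c a x" if "a \<in> L" for a
        using h[rule_format, OF that fzero_blocks[OF L(2), of m]] 1[OF that] by simp
      show "?c b y" if "b \<in> blocks L m" for b
        using h[rule_format, OF L(2) that] 1[OF L(2)] by simp
    next
      fix a b assume h: "(\<forall>a\<in>L. ?c a x) \<and> (\<forall>b\<in>blocks L m. ?c b y)" and ab: "a \<in> L" "b \<in> blocks L m"
      show "?c (a @ b) (x @ y)" unfolding 1[OF ab(1)] using h ab by simp
    qed
    then show ?thesis using x y xy by (simp add: sperp_def)
  qed
  show ?case
  proof (intro equalityI subsetI)
    fix z assume z: "z \<in> sperp (n * Suc m) (blocks L (Suc m))"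
    then have "z \<in> strings d (n + n * m)" by (simp add: sperp_def)
    then obtain x y where xy: "x \<in> strings d n" "y \<in> strings d (n * m)" "z = x @ y"
      unfolding append_strings[symmetric] by auto
    then have "x \<in> sperp n L \<and> y \<in> sperp (n * m) (blocks L m)" using z iff[OF xy(1,2)] by blast
    then show "z \<in> blocks (sperp n L) (Suc m)" unfolding Suc by (auto simp: xy(3))
  next
    fix z assume "z \<in> blocks (sperp n L) (Suc m)"
    then obtain x y where xy: "x \<in> sperp n L" "y \<in> blocks (sperp n L) m" "z = x @ y" by auto
    then have y: "y \<in> sperp (n * m) (blocks L m)" using Suc by simp
    have "x \<in> strings d n" "y \<in> strings d (n * m)" using xy(1) y by (simp_all add: sperp_def)
    then show "z \<in> sperp (n * Suc m) (blocks L (Suc m))" using iff xy y by blast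
  qed
qed

lemma coset_mass_pos:
  assumes K: "K \<subseteq> strings d n" "fzero n \<in> K" and e: "e \<in> strings d n" "Pn P e > 0"
  shows "coset_mass d P K e > 0"
proof -
  interpret G: weyl_system "string_group d n" "d ^ n" d "pauli d \<omega>" "weyl_phase d \<omega>" by (rule weyl_system_strings)
  have fK: "finite K" by (rule finite_subset[OF K(1) finite_strings])
  have nn: "0 \<le> Pn P (fadd d e k)" if "k \<in> K" for k
    using that K(1) e(1) by (intro Pn_nonneg[of _ n] fadd_mem[OF d_pos]) auto
  have "fadd d e (fzero n) = e" using G.r_one[of e] e(1) by simp
  then have "Pn P e \<le> coset_mass d P K e" unfolding coset_mass_def
    using member_le_sum[OF K(2) _ fK, of "\<lambda>k. Pn P (fadd d e k)"] nn by simp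
  then show ?thesis using e(2) by linarith
qed

text \<open>The ratio is the reciprocal of the conditional probability of an error class given its
  syndrome. For independent blocks it is multiplicative, so its logarithm, the information density,
  is a block sum. Positive probability of e keeps all masses positive, as the logarithm of a product
  requires.\<close>

lemma log_coset_mass_ratio_blocks:
  assumes K: "K \<subseteq> strings d n" "fzero n \<in> K" and H: "H \<subseteq> strings d n" "fzero n \<in> H"
    and e: "e \<in> strings d (n * m)" "Pn P e > 0"
  shows "log (real d) (coset_mass d P (blocks H m) e / coset_mass d P (blocks K m) e) =
    block_sum n (\<lambda>x. log (real d) (coset_mass d P H x / coset_mass d P K x)) m e"
  using e
proof (induction m arbitrary: e)
  case 0
  then show ?case by (simp add: coset_mass_def Pn_def)
next
  case (Suc m)
  from Suc.prems(1) have "e \<in> strings d (n + n * m)" by simp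
  then obtain x y where xy: "x \<in> strings d n" "y \<in> strings d (n * m)" "e = x @ y"
    unfolding append_strings[symmetric] by auto
  have "Pn P x * Pn P y > 0" using Suc.prems(2) by (simp add: xy Pn_append)
  then have p: "Pn P x > 0" "Pn P y > 0"
    using Pn_nonneg[OF xy(1)] Pn_nonneg[OF xy(2)] by (auto simp: zero_less_mult_iff)
  have pos: "coset_mass d P K x > 0" "coset_mass d P H x > 0"
    "coset_mass d P (blocks K m) y > 0" "coset_mass d P (blocks H m) y > 0"
    by (rule coset_mass_pos[OF K xy(1) p(1)], rule coset_mass_pos[OF H xy(1) p(1)],
      rule coset_mass_pos[OF blocks_subset[OF K(1)] fzero_blocks[OF K(2)] xy(2) p(2)],
      rule coset_mass_pos[OF blocks_subset[OF H(1)] fzero_blocks[OF H(2)] xy(2) p(2)])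
  have "coset_mass d P (blocks H (Suc m)) e / coset_mass d P (blocks K (Suc m)) e =
      (coset_mass d P H x / coset_mass d P K x) * (coset_mass d P (blocks H m) y / coset_mass d P (blocks K m) y)"
    unfolding blocks.simps xy(3) coset_mass_append[OF K(1) xy(1)] coset_mass_append[OF H(1) xy(1)] by simp
  also have "log (real d) \<dots> = log (real d) (coset_mass d P H x / coset_mass d P K x) +
      log (real d) (coset_mass d P (blocks H m) y / coset_mass d P (blocks K m) y)"
    by (subst log_mult) (use pos in simp_all)
  also have "log (real d) (coset_mass d P (blocks H m) y / coset_mass d P (blocks K m) y) =
      block_sum n (\<lambda>x. log (real d) (coset_mass d P H x / coset_mass d P K x)) m y"
    by (rule Suc.IH[OF xy(2) p(2)])
  finally show ?case using strings_length[OF xy(1)] by (simp add: xy(3))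
qed

end

section \<open>Achievable rates\<close>

context pauli_channel
begin

text \<open>The fidelity is an infimum over unit vectors of the code and would be infinite for the
  zero space; positive dimension supplies a unit vector at which the mixture bound applies.\<close>

lemma fidelity_le_1:
  assumes C: "csubspace (d ^ n) C" and tp: "kraus_tp (d ^ n) Rs" and dim: "cdim (d ^ n) C \<ge> 1"
  shows "fidelity d \<omega> P n C Rs \<le> 1"
proof -
  have Cc: "C \<subseteq> carrier_vec (d ^ n)" and C0: "0\<^sub>v (d ^ n) \<in> C" using C by (simp_all add: csubspace_def)
  have "C \<noteq> {0\<^sub>v (d ^ n)}" using dim cdim_zero_subspace[of "d ^ n"] by auto
  then obtain v where v: "v \<in> C" "v \<noteq> 0\<^sub>v (d ^ n)" using C0 by blast
  have vc: "v \<in> carrier_vec (d ^ n)" using v Cc by blast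
  obtain c where c: "cinner (c \<cdot>\<^sub>v v) (c \<cdot>\<^sub>v v) = 1" using unit_multiple_exists[OF vc v(2)] by blast
  define u where "u = c \<cdot>\<^sub>v v"
  have uC: "u \<in> C" using C v unfolding u_def csubspace_def by blast
  have uu: "cinner u u = 1" using c by (simp add: u_def)
  have uc: "u \<in> carrier_vec (d ^ n)" using uC Cc by blast
  have "fidelity d \<omega> P n C Rs \<le> ereal (Re (cinner u (kraus_apply (d ^ n) Rs (chan d \<omega> P n (outer u)) *\<^sub>v u)))"
    unfolding fidelity_def by (rule INF_lower) (use uC uu in simp)
  also have "\<dots> \<le> ereal 1"
    unfolding chan_def ereal_less_eq
  proof (rule kraus_mixture_fidelity_le_1[OF tp])
    show "pauli d \<omega> x \<in> carrier_mat (d ^ n) (d ^ n)" if "x \<in> strings d n" for x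
      by (rule pauli_carrier[OF strings_length[OF that]])
    show "mat_adjoint (pauli d \<omega> x) * pauli d \<omega> x = 1\<^sub>m (d ^ n)" if "x \<in> strings d n" for x
      by (rule pauli_unitary[OF strings_length[OF that]])
  qed (use Pn_nonneg Pn_sum uc uu in simp_all)
  finally show ?thesis by (simp add: one_ereal_def)
qed

lemma Fstar_le_1:
  assumes "k \<ge> 0" shows "Fstar d \<omega> P n k \<le> 1"
  unfolding Fstar_def
proof (rule SUP_least)
  fix CR assume "CR \<in> {(C, Rs). csubspace (d ^ n) C \<and> kraus_tp (d ^ n) Rs \<and> real d powr k \<le> real (cdim (d ^ n) C)}"
  then have h: "csubspace (d ^ n) (fst CR)" "kraus_tp (d ^ n) (snd CR)" "real d powr k \<le> real (cdim (d ^ n) (fst CR))"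
    by (auto simp: case_prod_beta)
  have "1 \<le> real d powr k" using d_gt1 assms by (intro ge_one_powr_ge_zero) simp_all
  then have "1 \<le> cdim (d ^ n) (fst CR)" using h(3) by linarith
  then show "fidelity d \<omega> P n (fst CR) (snd CR) \<le> 1" by (rule fidelity_le_1[OF h(1,2)])
qed

lemma Fstar_ge:
  assumes "csubspace (d ^ n) C" "kraus_tp (d ^ n) Ks" "real d powr k \<le> real (cdim (d ^ n) C)"
    and f: "\<And>\<psi>. \<psi> \<in> C \<Longrightarrow> cinner \<psi> \<psi> = 1 \<Longrightarrow> a \<le> Re (cinner \<psi> (kraus_apply (d ^ n) Ks
        (msum (d ^ n) (strings d n) (\<lambda>x. of_real (Pn P x) \<cdot>\<^sub>m (pauli d \<omega> x * outer \<psi> * mat_adjoint (pauli d \<omega> x)))) *\<^sub>v \<psi>))"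
  shows "ereal a \<le> Fstar d \<omega> P n k"
proof -
  have "ereal a \<le> fidelity d \<omega> P n C Ks"
    unfolding fidelity_def chan_def
  proof (rule INF_greatest)
    fix \<psi> assume "\<psi> \<in> {\<psi> \<in> C. cinner \<psi> \<psi> = 1}"
    then have \<psi>: "\<psi> \<in> C" "cinner \<psi> \<psi> = 1" by simp_all
    show "ereal a \<le> ereal (Re (cinner \<psi> (kraus_apply (d ^ n) Ks (msum (d ^ n) (strings d n)
        (\<lambda>xs. complex_of_real (Pn P xs) \<cdot>\<^sub>m (pauli d \<omega> xs * outer \<psi> * mat_adjoint (pauli d \<omega> xs)))) *\<^sub>v \<psi>)))"
      using f[OF \<psi>] by simp
  qed
  also have "\<dots> \<le> Fstar d \<omega> P n k"
    unfolding Fstar_def using assms(1-3) by (intro SUP_upper2[of "(C, Ks)"]) simp_all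
  finally show ?thesis .
qed

lemma Fstar_zero_rate: "Fstar d \<omega> P n 0 = 1"
proof (rule antisym[OF Fstar_le_1])
  interpret G: weyl_system "string_group d n" "d ^ n" d "pauli d \<omega>" "weyl_phase d \<omega>" by (rule weyl_system_strings)
  obtain C Ks where h: "csubspace (d ^ n) C \<and> kraus_tp (d ^ n) Ks \<and> 1 \<le> cdim (d ^ n) C \<and>
    (\<forall>\<psi>\<in>C. cinner \<psi> \<psi> = 1 \<longrightarrow> 1 \<le> Re (cinner \<psi> (kraus_apply (d ^ n) Ks
        (msum (d ^ n) (carrier (string_group d n)) (\<lambda>x. of_real (Pn P x) \<cdot>\<^sub>m (pauli d \<omega> x * outer \<psi> * mat_adjoint (pauli d \<omega> x)))) *\<^sub>v \<psi>)))"
    using G.perfect_one_dimensional_code[of "Pn P"] Pn_nonneg Pn_sum by auto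
  have "ereal 1 \<le> Fstar d \<omega> P n 0"
    by (rule Fstar_ge[of n C Ks]) (use h d_pos in auto)
  then show "1 \<le> Fstar d \<omega> P n 0" by (simp add: one_ereal_def)
qed simp

text \<open>Here \<open>\<mu>\<close> is the conditional entropy of the class given the syndrome and
  V the variance of the information density. Of the slack 3 * \<delta> per block, one \<delta> is
  spent on the deviation in Chebyshev's inequality and the other two make the expected number of
  surviving competitors decay exponentially.\<close>

lemma block_code_fidelity:
  assumes L: "L \<subseteq> strings d n" "fzero n \<in> L" "\<And>x y. x \<in> L \<Longrightarrow> y \<in> L \<Longrightarrow> fadd d x y \<in> L" "L \<subseteq> sperp n L"
    and k: "d ^ k * card L = d ^ n"
    and f: "f = (\<lambda>x. log (real d) (coset_mass d P (sperp n L) x / coset_mass d P L x))"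
    and \<mu>: "\<mu> = (\<Sum>x\<in>strings d n. Pn P x * f x)" "\<mu> \<ge> 0"
    and V: "V = (\<Sum>x\<in>strings d n. Pn P x * (f x - \<mu>)\<^sup>2)"
    and R: "R \<ge> 0" and \<delta>: "\<delta> > 0" "\<mu> + 3 * \<delta> \<le> real k - R * real n" and m: "m > 0"
  shows "ereal (1 - V / (real m * \<delta>\<^sup>2) - real d powr (1 - 2 * \<delta> * real m)) \<le> Fstar d \<omega> P (n * m) (R * real (n * m))"
proof -
  interpret G: weyl_system "string_group d (n * m)" "d ^ (n * m)" d "pauli d \<omega>" "weyl_phase d \<omega>" by (rule weyl_system_strings)
  define Lm where "Lm = blocks L m"
  define H where "H = sperp n L"
  have Lms: "Lm \<subseteq> strings d (n * m)" unfolding Lm_def by (rule blocks_subset[OF L(1)])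
  have sub: "subgroup Lm (string_group d (n * m))"
    unfolding Lm_def
    by (rule subgroup_of_fadd_closed[OF blocks_subset[OF L(1)] fzero_blocks[OF L(2)]]) (rule fadd_blocks[OF L(1,3)])
  have perp: "G.perp Lm = blocks H m"
    using sperp_eq_perp[OF Lms] sperp_blocks[OF L(1,2), of m] by (simp add: H_def Lm_def)
  have iso: "Lm \<subseteq> G.perp Lm" unfolding perp unfolding Lm_def H_def by (rule blocks_mono[OF L(4)])
  have cardLm: "card Lm = card L ^ m" unfolding Lm_def by (rule card_blocks) (use L(1) strings_length in blast)
  have H: "H \<subseteq> strings d n" "fzero n \<in> H" using L(2,4) by (auto simp: H_def sperp_def)
  \<comment> \<open>The number of dimensions, in base-d logarithm, that may be given up while
    keeping the rate R; its integer part j is the number of vectors adjoined.\<close>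
  define t where "t = real m * (real k - R * real n)"
  have t0: "t \<ge> 0" unfolding t_def using \<mu>(2) \<delta> by (intro mult_nonneg_nonneg) auto
  define j where "j = nat \<lfloor>t\<rfloor>"
  have j: "real j \<le> t" "t < real j + 1" using t0 by (auto simp: j_def)
  have "t \<le> real (k * m)" unfolding t_def using R by (simp add: algebra_simps)
  then have "real j \<le> real (k * m)" using j(1) by linarith
  then have jkm: "j \<le> k * m" by (simp only: of_nat_le_iff)
  have Dm: "d ^ (k * m) * card L ^ m = d ^ (n * m)"
    using arg_cong[OF k, of "\<lambda>x. x ^ m"] by (simp add: power_mult_distrib power_mult)
  \<comment> \<open>Since R is nonnegative, j is at most k * m, so the enlarged stabilizer has size
    at most d^(n * m), the square root of the group size: this is the room required by
    \<open>isotropic_extension\<close>.\<close>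
  have "d ^ j * card Lm \<le> d ^ (k * m) * card L ^ m"
    unfolding cardLm using jkm d_pos by (intro mult_le_mono1 power_increasing) simp_all
  then have jle: "(d ^ j * card Lm) ^ 2 \<le> card (carrier (string_group d (n * m)))"
    unfolding Dm string_group_simps card_strings by (rule power_mono) simp
  \<comment> \<open>The threshold for the ratio of masses that corresponds to an information density
    exceeding its mean by \<delta> per block.\<close>
  define B where "B = real d powr (real m * (\<mu> + \<delta>))"
  have B0: "B > 0" using d_pos by (simp add: B_def)
  define bad where "bad = {e \<in> strings d (n * m). B * coset_mass d P Lm e < coset_mass d P (blocks H m) e}"
  have ex: "\<exists>C Ks. csubspace (d ^ (n * m)) C \<and> kraus_tp (d ^ (n * m)) Ks \<and>
      real (d ^ (n * m)) \<le> real (cdim (d ^ (n * m)) C) * real (d ^ j * card Lm) \<and>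
    (\<forall>\<psi>\<in>C. cinner \<psi> \<psi> = 1 \<longrightarrow> 1 - (\<Sum>e\<in>bad. Pn P e) - B / real d ^ j \<le> Re (cinner \<psi> (kraus_apply (d ^ (n * m)) Ks
        (msum (d ^ (n * m)) (strings d (n * m)) (\<lambda>x. of_real (Pn P x) \<cdot>\<^sub>m (pauli d \<omega> x * outer \<psi> * mat_adjoint (pauli d \<omega> x)))) *\<^sub>v \<psi>)))"
    using G.one_shot_code[OF sub iso _ _ jle, of "Pn P" B] Pn_nonneg Pn_sum B0
    unfolding perp string_group_simps bad_def coset_mass_def by simp
  then obtain C Ks where CK: "csubspace (d ^ (n * m)) C" "kraus_tp (d ^ (n * m)) Ks"
      and dim: "real (d ^ (n * m)) \<le> real (cdim (d ^ (n * m)) C) * real (d ^ j * card Lm)"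
      and fid: "\<And>\<psi>. \<psi> \<in> C \<Longrightarrow> cinner \<psi> \<psi> = 1 \<Longrightarrow> 1 - (\<Sum>e\<in>bad. Pn P e) - B / real d ^ j \<le> Re (cinner \<psi> (kraus_apply (d ^ (n * m)) Ks
        (msum (d ^ (n * m)) (strings d (n * m)) (\<lambda>x. of_real (Pn P x) \<cdot>\<^sub>m (pauli d \<omega> x * outer \<psi> * mat_adjoint (pauli d \<omega> x)))) *\<^sub>v \<psi>))"
    by blast
  have dr: "real d > 1" using d_gt1 by simp
  have dp: "real d powr real i = real d ^ i" for i using dr by (simp add: powr_realpow)
  have rate: "real d powr (R * real (n * m)) \<le> real (cdim (d ^ (n * m)) C)"
  proof -
    have L0: "card L > 0" using L(1,2) finite_subset[OF L(1) finite_strings] by (auto simp: card_gt_0_iff)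
    have "real d ^ (k * m) * real (card L ^ m) \<le> (real (cdim (d ^ (n * m)) C) * real d ^ j) * real (card L ^ m)"
      using dim unfolding Dm[symmetric] cardLm by (simp add: mult.assoc)
    then have "real d ^ (k * m) \<le> real (cdim (d ^ (n * m)) C) * real d ^ j"
      using L0 by (simp add: mult_le_cancel_right)
    then have "real d powr real (k * m) / real d powr real j \<le> real (cdim (d ^ (n * m)) C)"
      unfolding dp using dr by (simp add: divide_le_eq)
    then have "real d powr (real (k * m) - real j) \<le> real (cdim (d ^ (n * m)) C)" by (simp add: powr_diff)
    moreover have "R * real (n * m) \<le> real (k * m) - real j"
      using j(1) unfolding t_def by (simp add: algebra_simps)
    then have "real d powr (R * real (n * m)) \<le> real d powr (real (k * m) - real j)"
      using dr by (intro powr_mono) simp_all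
    ultimately show ?thesis by linarith
  qed
  \<comment> \<open>Rounding t down costs less than one adjoined vector, whence the 1 in the
    exponent.\<close>
  have Bj: "B / real d ^ j \<le> real d powr (1 - 2 * \<delta> * real m)"
  proof -
    have "B / real d ^ j = real d powr (real m * (\<mu> + \<delta>) - real j)"
      unfolding B_def dp[symmetric] by (simp add: powr_diff)
    also have "\<dots> \<le> real d powr (1 - 2 * \<delta> * real m)"
    proof (rule powr_mono)
      have "real m * (\<mu> + 3 * \<delta>) \<le> t" unfolding t_def using \<delta>(2) by (intro mult_left_mono) simp_all
      then show "real m * (\<mu> + \<delta>) - real j \<le> 1 - 2 * \<delta> * real m" using j(2) by (simp add: algebra_simps)
    qed (use dr in simp)
    finally show ?thesis .
  qed
  \<comment> \<open>Chebyshev's inequality: on \<open>bad\<close> the information density exceeds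
    its mean by more than m * \<delta>, so the squared deviation divided by the square of m *
    \<delta> dominates the indicator of \<open>bad\<close>.\<close>
  have badV: "(\<Sum>e\<in>bad. Pn P e) \<le> V / (real m * \<delta>\<^sup>2)"
  proof -
    have m\<delta>: "real m * \<delta> > 0" using m \<delta>(1) by simp
    have fb: "finite (strings d (n * m))" by (rule finite_strings)
    have "(\<Sum>e\<in>bad. Pn P e) \<le> (\<Sum>e\<in>bad. Pn P e * ((block_sum n f m e - real m * \<mu>)\<^sup>2 / (real m * \<delta>)\<^sup>2))"
    proof (rule sum_mono)
      fix e assume e: "e \<in> bad"
      then have ec: "e \<in> strings d (n * m)" and eb: "B * coset_mass d P Lm e < coset_mass d P (blocks H m) e"
        by (simp_all add: bad_def)
      show "Pn P e \<le> Pn P e * ((block_sum n f m e - real m * \<mu>)\<^sup>2 / (real m * \<delta>)\<^sup>2)"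
      proof (cases "Pn P e = 0")
        case False
        then have pe: "Pn P e > 0" using Pn_nonneg[OF ec] by simp
        have Lm0: "coset_mass d P Lm e > 0"
          unfolding Lm_def by (rule coset_mass_pos[OF blocks_subset[OF L(1)] fzero_blocks[OF L(2)] ec pe])
        have lr: "log (real d) (coset_mass d P (blocks H m) e / coset_mass d P Lm e) = block_sum n f m e"
          unfolding Lm_def f H_def[symmetric] by (rule log_coset_mass_ratio_blocks[OF L(1,2) H ec pe])
        have "B < coset_mass d P (blocks H m) e / coset_mass d P Lm e" using eb Lm0 by (simp add: less_divide_eq)
        then have "log (real d) B < block_sum n f m e" unfolding lr[symmetric] using dr B0 by (subst log_less_cancel_iff) auto
        then have "real m * \<delta> < block_sum n f m e - real m * \<mu>"
          unfolding B_def using dr by (simp add: algebra_simps)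
        then have "(real m * \<delta>)\<^sup>2 \<le> (block_sum n f m e - real m * \<mu>)\<^sup>2" using m\<delta> by (intro power_mono) simp_all
        then have "1 \<le> (block_sum n f m e - real m * \<mu>)\<^sup>2 / (real m * \<delta>)\<^sup>2" using m \<delta>(1) by (simp add: le_divide_eq)
        then have "Pn P e * 1 \<le> Pn P e * ((block_sum n f m e - real m * \<mu>)\<^sup>2 / (real m * \<delta>)\<^sup>2)"
          using pe by (intro mult_left_mono) simp_all
        then show ?thesis by simp
      qed simp
    qed
    also have "\<dots> \<le> (\<Sum>e\<in>strings d (n * m). Pn P e * ((block_sum n f m e - real m * \<mu>)\<^sup>2 / (real m * \<delta>)\<^sup>2))"
    proof (rule sum_mono2[OF fb])
      show "0 \<le> Pn P e * ((block_sum n f m e - real m * \<mu>)\<^sup>2 / (real m * \<delta>)\<^sup>2)" if "e \<in> strings d (n * m) - bad" for e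
        using that Pn_nonneg[of e "n * m"] by (intro mult_nonneg_nonneg) simp_all
    qed (simp add: bad_def)
    also have "\<dots> = (\<Sum>e\<in>strings d (n * m). Pn P e * (block_sum n f m e - real m * \<mu>)\<^sup>2) / (real m * \<delta>)\<^sup>2"
      by (simp add: sum_divide_distrib)
    also have "\<dots> = real m * V / (real m * \<delta>)\<^sup>2" by (simp only: block_sum_moments(2)[OF \<mu>(1) V])
    also have "\<dots> = V / (real m * \<delta>\<^sup>2)" using m by (simp add: power2_eq_square field_simps)
    finally show ?thesis .
  qed
  show ?thesis
  proof (rule Fstar_ge[OF CK rate])
    fix \<psi> assume "\<psi> \<in> C" "cinner \<psi> \<psi> = 1"
    from fid[OF this] badV Bj show "1 - V / (real m * \<delta>\<^sup>2) - real d powr (1 - 2 * \<delta> * real m) \<le>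
      Re (cinner \<psi> (kraus_apply (d ^ (n * m)) Ks (msum (d ^ (n * m)) (strings d (n * m))
        (\<lambda>x. of_real (Pn P x) \<cdot>\<^sub>m (pauli d \<omega> x * outer \<psi> * mat_adjoint (pauli d \<omega> x)))) *\<^sub>v \<psi>))"
      by linarith
  qed
qed

text \<open>Translates a code of the given definition into the hypotheses of the coding argument,
  and its coherent information into k minus the mean information density. The dimension d^k enters
  twice: it excludes the zero space and it determines the size of L.\<close>

lemma stab_code_structure:
  assumes L: "fsubspace d n L" "self_orth d L"
    and C: "C = {\<psi>\<in>carrier_vec (d ^ n). \<forall>x\<in>L. pauli d \<omega> x *\<^sub>v \<psi> = \<tau> x \<cdot>\<^sub>v \<psi>}"
    and dim: "cdim (d ^ n) C = d ^ k"
  shows "L \<subseteq> strings d n" "fzero n \<in> L" "\<And>x y. x \<in> L \<Longrightarrow> y \<in> L \<Longrightarrow> fadd d x y \<in> L" "L \<subseteq> sperp n L"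
    and "d ^ k * card L = d ^ n"
    and "coh_info d \<omega> P n ((1 / of_nat (cdim (d ^ n) C)) \<cdot>\<^sub>m proj (d ^ n) C) = real k -
      (\<Sum>x\<in>strings d n. Pn P x * log (real d) (coset_mass d P (sperp n L) x / coset_mass d P L x))"
proof -
  interpret G: weyl_system "string_group d n" "d ^ n" d "pauli d \<omega>" "weyl_phase d \<omega>" by (rule weyl_system_strings)
  show Ls: "L \<subseteq> strings d n" and L0: "fzero n \<in> L" and La: "\<And>x y. x \<in> L \<Longrightarrow> y \<in> L \<Longrightarrow> fadd d x y \<in> L"
    using L(1) by (simp_all add: fsubspace_def)
  show Lp: "L \<subseteq> sperp n L"
  proof
    fix y assume y: "y \<in> L"
    have "weyl_phase d \<omega> x y = weyl_phase d \<omega> y x" if x: "x \<in> L" for x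
    proof (rule weyl_phase_commute_of_sympl)
      have "x \<in> strings d n" "y \<in> strings d n" using x y Ls by blast+
      then show "length x = length y" by (simp add: strings_length)
      show "sympl d x y = 0" using L(2) x y by (simp add: self_orth_def)
    qed
    then show "y \<in> sperp n L" using y Ls by (auto simp: sperp_def)
  qed
  have sub: "subgroup L (string_group d n)" by (rule subgroup_of_fadd_closed[OF Ls L0 La])
  have CG: "C = G.stab_code L \<tau>" unfolding C G.stab_code_def ..
  \<comment> \<open>The dimension is positive, so there is a common eigenvector, and the otherwise
    arbitrary scalars \<open>\<tau>\<close> form a twisted character.\<close>
  have "C \<noteq> {0\<^sub>v (d ^ n)}" using dim cdim_zero_subspace[of "d ^ n"] d_pos by auto
  moreover have "0\<^sub>v (d ^ n) \<in> C"
    using G.csubspace_stab_code[of L \<tau>] Ls unfolding CG csubspace_def by simp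
  ultimately obtain \<psi> where "\<psi> \<in> C" "\<psi> \<noteq> 0\<^sub>v (d ^ n)" by blast
  then have st: "G.stab_char L \<tau>" by (intro G.stab_char_of_eigenvector[OF sub, of \<psi>]) (auto simp: C)
  note cd = G.cdim_stab_code[OF st]
  have "(of_nat (d ^ k * card L) :: complex) = of_nat (d ^ n)"
    using cd G.stab_charD(4)[OF st] unfolding CG[symmetric] dim by (simp add: field_simps)
  then show kL: "d ^ k * card L = d ^ n" by (simp only: of_nat_eq_iff)
  define \<rho> where "\<rho> = (1 / of_nat (d ^ k)) \<cdot>\<^sub>m G.stab_proj L \<tau>"
  have \<rho>: "(1 / of_nat (cdim (d ^ n) C)) \<cdot>\<^sub>m proj (d ^ n) C = \<rho>"
    unfolding \<rho>_def dim unfolding CG G.proj_stab_code[OF st] ..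
  \<comment> \<open>The same choice as in \<open>coh_info\<close>; it is a purification because one
    exists.\<close>
  define \<Psi> where "\<Psi> = (SOME \<Psi>. purification (d ^ n) \<rho> \<Psi>)"
  have \<Psi>: "purification (d ^ n) \<rho> \<Psi>"
    unfolding \<Psi>_def \<rho>_def by (rule someI_ex[OF G.purification_exists[OF st]])
  have perp: "G.perp L = sperp n L" by (rule sperp_eq_perp[OF Ls])
  have nn: "\<And>x. x \<in> carrier (string_group d n) \<Longrightarrow> Pn P x \<ge> 0" using Pn_nonneg by simp
  let ?Q = "coset_mass d P (sperp n L)" and ?q = "coset_mass d P L"
  have S1: "vnS d (chan d \<omega> P n \<rho>) = - (\<Sum>x\<in>strings d n. Pn P x * log (real d) (?Q x / real (d ^ k)))"
    using G.vnS_channel_output[where b = d, OF st nn kL] unfolding perp chan_def \<rho>_def coset_mass_def by simp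
  have S2: "vnS d (chanI d \<omega> P n (d ^ n) (outer \<Psi>)) = - (\<Sum>x\<in>strings d n. Pn P x * log (real d) (?q x))"
    using G.vnS_purified_output[where b = d and \<Psi> = \<Psi>, OF st nn kL] \<Psi> unfolding chanI_def \<rho>_def coset_mass_def by simp
  have H: "sperp n L \<subseteq> strings d n" "fzero n \<in> sperp n L" using L0 Lp by (auto simp: sperp_def)
  have dr: "real d > 1" using d_gt1 by simp
  \<comment> \<open>The logarithms split termwise only where both masses are positive; errors of
    probability zero need not satisfy this, but they carry the factor zero.\<close>
  have summand: "Pn P x * log (real d) (?Q x / real (d ^ k)) - Pn P x * log (real d) (?q x) =
      Pn P x * log (real d) (?Q x / ?q x) - Pn P x * real k" if x: "x \<in> strings d n" for x
  proof (cases "Pn P x = 0")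
    case False
    then have px: "Pn P x > 0" using Pn_nonneg[OF x] by simp
    have pos: "?Q x > 0" "?q x > 0" by (rule coset_mass_pos[OF H x px], rule coset_mass_pos[OF Ls L0 x px])
    have "log (real d) (?Q x / real (d ^ k)) = log (real d) (?Q x) - real k"
      using pos dr by (simp add: log_divide log_nat_power)
    moreover have "log (real d) (?Q x / ?q x) = log (real d) (?Q x) - log (real d) (?q x)"
      using pos by (simp add: log_divide)
    ultimately have "log (real d) (?Q x / real (d ^ k)) - log (real d) (?q x) = log (real d) (?Q x / ?q x) - real k"
      by linarith
    then show ?thesis by (simp only: right_diff_distrib[symmetric])
  qed simp
  have "coh_info d \<omega> P n \<rho> = vnS d (chan d \<omega> P n \<rho>) - vnS d (chanI d \<omega> P n (d ^ n) (outer \<Psi>))"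
    by (simp add: coh_info_def \<Psi>_def)
  also have "\<dots> = - (\<Sum>x\<in>strings d n. Pn P x * log (real d) (?Q x / real (d ^ k)) - Pn P x * log (real d) (?q x))"
    unfolding S1 S2 by (simp add: sum_subtractf)
  also have "\<dots> = - (\<Sum>x\<in>strings d n. Pn P x * log (real d) (?Q x / ?q x) - Pn P x * real k)"
    by (simp only: summand cong: sum.cong)
  also have "\<dots> = real k - (\<Sum>x\<in>strings d n. Pn P x * log (real d) (?Q x / ?q x))"
    using Pn_sum[of n] by (simp add: sum_subtractf sum_distrib_right[symmetric])
  finally show "coh_info d \<omega> P n ((1 / of_nat (cdim (d ^ n) C)) \<cdot>\<^sub>m proj (d ^ n) C) = real k -
      (\<Sum>x\<in>strings d n. Pn P x * log (real d) (?Q x / ?q x))" unfolding \<rho> .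
qed

lemma Fstar_limsup_le_1: "R \<ge> 0 \<Longrightarrow> limsup (\<lambda>m. Fstar d \<omega> P (Suc m) (R * real (Suc m))) \<le> 1"
  by (rule Limsup_bounded) (simp add: Fstar_le_1)

text \<open>Codes are built only for lengths that are multiples of n, and a subsequence is enough to
  bound the limit superior from below.\<close>

lemma rate_achievable:
  assumes L: "L \<subseteq> strings d n" "fzero n \<in> L" "\<And>x y. x \<in> L \<Longrightarrow> y \<in> L \<Longrightarrow> fadd d x y \<in> L" "L \<subseteq> sperp n L"
    and k: "d ^ k * card L = d ^ n" and n: "n \<ge> 1"
    and R: "R \<ge> 0" "R * real n < real k -
      (\<Sum>x\<in>strings d n. Pn P x * log (real d) (coset_mass d P (sperp n L) x / coset_mass d P L x))"
  shows "limsup (\<lambda>m. Fstar d \<omega> P (Suc m) (R * real (Suc m))) = 1"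
proof (rule antisym[OF Fstar_limsup_le_1[OF R(1)]])
  define f where "f = (\<lambda>x. log (real d) (coset_mass d P (sperp n L) x / coset_mass d P L x))"
  define \<mu> where "\<mu> = (\<Sum>x\<in>strings d n. Pn P x * f x)"
  define V where "V = (\<Sum>x\<in>strings d n. Pn P x * (f x - \<mu>)\<^sup>2)"
  have dr: "real d > 1" using d_gt1 by simp
  \<comment> \<open>L is contained in its complement, so each ratio of masses at an error of
    positive probability is at least 1.\<close>
  have \<mu>0: "\<mu> \<ge> 0"
    unfolding \<mu>_def
  proof (rule sum_nonneg)
    fix x assume x: "x \<in> strings d n"
    show "0 \<le> Pn P x * f x"
    proof (cases "Pn P x = 0")
      case False
      then have px: "Pn P x > 0" using Pn_nonneg[OF x] by simp
      have q: "coset_mass d P L x > 0" by (rule coset_mass_pos[OF L(1,2) x px])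
      have fH: "finite (sperp n L)" by (rule finite_subset[OF _ finite_strings[of d n]]) (auto simp: sperp_def)
      have "coset_mass d P L x \<le> coset_mass d P (sperp n L) x"
        unfolding coset_mass_def
      proof (rule sum_mono2[OF fH L(4)])
        fix w assume "w \<in> sperp n L - L"
        then have "w \<in> strings d n" by (simp add: sperp_def)
        then show "0 \<le> Pn P (fadd d x w)" by (rule Pn_nonneg[OF fadd_mem[OF d_pos x]])
      qed
      then have "1 \<le> coset_mass d P (sperp n L) x / coset_mass d P L x" using q by (simp add: le_divide_eq)
      then have "0 \<le> f x" unfolding f_def using dr by (simp add: zero_le_log_cancel_iff)
      then show ?thesis using px by simp
    qed simp
  qed
  \<comment> \<open>A third of the gap between the coherent information and R * n, matching the 3 *
    \<delta> used by \<open>block_code_fidelity\<close>.\<close>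
  define \<delta> where "\<delta> = (real k - \<mu> - R * real n) / 3"
  have "3 * \<delta> = real k - \<mu> - R * real n" by (simp add: \<delta>_def)
  moreover have "R * real n < real k - \<mu>" using R(2) by (simp add: \<mu>_def f_def)
  ultimately have \<delta>: "\<delta> > 0" "\<mu> + 3 * \<delta> \<le> real k - R * real n" by linarith+
  \<comment> \<open>The capacity indexes lengths through \<open>Suc\<close>, so length n * (m + 1)
    sits at an index one lower; this also avoids the length 0.\<close>
  define r where "r m = n * Suc m - 1" for m
  have Sr: "Suc (r m) = n * Suc m" for m using n by (simp add: r_def)
  have "strict_mono r"
    unfolding strict_mono_Suc_iff
  proof
    fix m
    have "Suc (r m) < Suc (r (Suc m))" unfolding Sr using n by simp
    then show "r m < r (Suc m)" by simp
  qed
  let ?X = "\<lambda>m. Fstar d \<omega> P (Suc m) (R * real (Suc m))"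
  define a where "a m = 1 - V / (real (Suc m) * \<delta>\<^sup>2) - real d powr (1 - 2 * \<delta> * real (Suc m))" for m
  have lower: "ereal (a m) \<le> (?X \<circ> r) m" for m
    unfolding comp_def Sr a_def
    by (rule block_code_fidelity[OF L k f_def \<mu>_def \<mu>0 V_def R(1) \<delta> zero_less_Suc])
  have "a \<longlonglongrightarrow> 1"
  proof -
    have "(\<lambda>m. V / \<delta>\<^sup>2 * inverse (real (Suc m))) \<longlonglongrightarrow> V / \<delta>\<^sup>2 * 0"
      by (intro tendsto_mult_left LIMSEQ_inverse_real_of_nat)
    then have 1: "(\<lambda>m. V / (real (Suc m) * \<delta>\<^sup>2)) \<longlonglongrightarrow> 0" by (simp add: field_simps)
    define z where "z = real d powr (- 2 * \<delta>)"
    have z: "0 \<le> z" "z < 1" using dr \<delta>(1) by (simp_all add: z_def powr_less_one)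
    \<comment> \<open>Rewritten as a geometric sequence with ratio z below 1, so that it tends to
      0.\<close>
    have "real d powr (1 - 2 * \<delta> * real (Suc m)) = real d * z * z ^ m" for m
    proof -
      have "1 - 2 * \<delta> * real (Suc m) = 1 + (- 2 * \<delta>) + real m * (- 2 * \<delta>)" by (simp add: algebra_simps)
      then have "real d powr (1 - 2 * \<delta> * real (Suc m)) = real d powr 1 * z * real d powr (real m * (- 2 * \<delta>))"
        unfolding z_def by (simp only: powr_add)
      also have "real d powr (real m * (- 2 * \<delta>)) = z ^ m"
      proof -
        have "z > 0" using dr by (simp add: z_def)
        then have "z ^ m = z powr real m" by (simp add: powr_realpow)
        also have "\<dots> = real d powr (- 2 * \<delta> * real m)" unfolding z_def by (rule powr_powr)
        finally show ?thesis by (simp only: mult.commute)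
      qed
      finally show ?thesis using dr by simp
    qed
    moreover have "(\<lambda>m. real d * z * z ^ m) \<longlonglongrightarrow> real d * z * 0"
      by (intro tendsto_mult_left LIMSEQ_realpow_zero z)
    ultimately have 2: "(\<lambda>m. real d powr (1 - 2 * \<delta> * real (Suc m))) \<longlonglongrightarrow> 0" by simp
    have "a \<longlonglongrightarrow> 1 - 0 - 0" unfolding a_def[abs_def] by (intro tendsto_diff tendsto_const 1 2)
    then show ?thesis by simp
  qed
  then have "(\<lambda>m. ereal (a m)) \<longlonglongrightarrow> 1" by (simp add: one_ereal_def)
  then have "limsup (\<lambda>m. ereal (a m)) = 1" by (intro lim_imp_Limsup) simp_all
  then have "1 \<le> limsup (?X \<circ> r)" using Limsup_mono[OF always_eventually, of "\<lambda>m. ereal (a m)" "?X \<circ> r" sequentially] lower by simp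
  also have "\<dots> \<le> limsup ?X" by (rule limsup_subseq_mono[OF \<open>strict_mono r\<close>])
  finally show "1 \<le> limsup ?X" .
qed

section \<open>From achievable rates to the capacity\<close>

lemma capacity_ge:
  assumes "limsup (\<lambda>m. Fstar d \<omega> P (Suc m) (R * real (Suc m))) = 1" "R \<ge> 0"
  shows "ereal R \<le> capacity d \<omega> P"
  unfolding capacity_def using assms by (intro Sup_upper) blast

lemma capacity_nonneg: "0 \<le> capacity d \<omega> P"
proof -
  have "limsup (\<lambda>m. Fstar d \<omega> P (Suc m) (0 * real (Suc m))) = 1"
    by (simp add: Fstar_zero_rate Limsup_const)
  from capacity_ge[OF this] show ?thesis by (simp add: zero_ereal_def)
qed

text \<open>The capacity is an extended real, so it is compared through its real upper bounds z: if
  z were below the coherent information per site, a rate R strictly between them would be achievable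
  and exceed z.\<close>

lemma capacity_ge_coherent_information:
  assumes n: "n \<ge> 1" and C: "C \<in> stab_codes d \<omega> n"
  shows "ereal (coh_info d \<omega> P n ((1 / of_nat (cdim (d ^ n) C)) \<cdot>\<^sub>m proj (d ^ n) C) / real n) \<le> capacity d \<omega> P"
proof -
  obtain L k \<tau> where L: "fsubspace d n L" "self_orth d L"
    and Ceq: "C = {\<psi>\<in>carrier_vec (d ^ n). \<forall>x\<in>L. pauli d \<omega> x *\<^sub>v \<psi> = \<tau> x \<cdot>\<^sub>v \<psi>}"
    and dim: "cdim (d ^ n) C = d ^ k" using C unfolding stab_codes_def by blast
  note S = stab_code_structure[OF L Ceq dim]
  define I where "I = coh_info d \<omega> P n ((1 / of_nat (cdim (d ^ n) C)) \<cdot>\<^sub>m proj (d ^ n) C)"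
  have "ereal (I / real n) \<le> capacity d \<omega> P"
  proof (rule ereal_le_real)
    show "ereal (I / real n) \<le> ereal z" if "capacity d \<omega> P \<le> ereal z" for z
    proof (rule ccontr)
      assume "\<not> ereal (I / real n) \<le> ereal z"
      then have z: "z < I / real n" by simp
      \<comment> \<open>Nonnegativity of the capacity makes R nonnegative, as
        \<open>rate_achievable\<close> requires; it also settles the case of negative coherent
        information.\<close>
      have "0 \<le> ereal z" using capacity_nonneg that by (rule order.trans)
      then have z0: "0 \<le> z" by simp
      obtain R where R: "z < R" "R < I / real n" using dense[OF z] by blast
      have "R * real n < I" using R(2) n by (simp add: less_divide_eq)
      then have "limsup (\<lambda>m. Fstar d \<omega> P (Suc m) (R * real (Suc m))) = 1"
        unfolding I_def S(6) by (intro rate_achievable[OF S(1-5) n]) (use z0 R in simp_all)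
      then have "ereal R \<le> capacity d \<omega> P" by (rule capacity_ge) (use z0 R in simp)
      then show False using that R(1) by (metis ereal_less_eq(3) leD order.trans)
    qed
  qed
  then show ?thesis by (simp add: I_def)
qed

end

theorem theorem1:
  fixes d :: nat and \<omega> :: complex and P :: "nat \<times> nat \<Rightarrow> real"
  assumes "prime d"
    and "\<omega> ^ d = 1" and "\<forall>j. 0 < j \<and> j < d \<longrightarrow> \<omega> ^ j \<noteq> 1"
    and "prob_dist d P"
  shows "capacity d \<omega> P \<ge>
    (SUP n\<in>{1..}. SUP C\<in>stab_codes d \<omega> n.
       ereal (coh_info d \<omega> P n ((1 / of_nat (cdim (d ^ n) C)) \<cdot>\<^sub>m proj (d ^ n) C) / real n))"
proof -
  interpret pauli_channel d \<omega> P by unfold_locales (use assms in auto)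
  show ?thesis by (intro SUP_least capacity_ge_coherent_information) simp_all
qed

end
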